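(* For every positive integer $k$, the satisfiability problem for GBSR sentences (given a GBSR sentence, decide whether it has a model) is $k$-NEXPTIME-hard.
   Context: A first-order sentence $\varphi$ is in standard form if $\varphi = \forall \vec{x}_1 \exists \vec{y}_1 \ldots \forall \vec{x}_n \exists \vec{y}_n.\,\psi$, where the $\vec{x}_i,\vec{y}_i$ are tuples of variables ($\vec{x}_1$ and $\vec{y}_n$ may be empty), $\psi$ is quantifier-free, in negation normal form and uses only the connectives $\wedge,\vee,\neg$, every variable bound in the prefix occurs in $\psi$, and no variable is bound twice. Write $\vec{x} := \vec{x}_1\cup\ldots\cup\vec{x}_n$, $\vec{y}:=\vec{y}_1\cup\ldots\cup\vec{y}_n$, let $\mathrm{At}$ be the set of atoms of $\varphi$, and $\mathrm{vars}(S)$ the set of variables occurring in a set $S$ of atoms. A sentence in standard form that may contain equality and constant symbols but no non-constant function symbols belongs to GBSR iff $\mathrm{At}$ can be partitioned into (possibly empty) sets $\mathrm{At}_0,\ldots,\mathrm{At}_n$ such that (i) $\mathrm{vars}(\mathrm{At}_i)\subseteq \vec{y}_1\cup\ldots\cup\vec{y}_i\cup\vec{x}_{i+1}\cup\ldots\cup\vec{x}_n$ for all $0\le i\le n$, and (ii) $\mathrm{vars}(\mathrm{At}_i)\cap\mathrm{vars}(\mathrm{At}_j)\cap\vec{x}=\emptyset$ for all $0\le i<j\le n$. *)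

theory Defs
  imports "HOL-Computational_Algebra.Polynomial" "HOL-Library.Countable_Set"
begin

section \<open>First-order logic with equality\<close>

text \<open>Variables, function symbols and predicate symbols are named by words over a two-letter
  alphabet; constants are function symbols applied to no argument. A symbol used with two
  different arities counts as two different symbols.\<close>

type_synonym name = "bool list"

datatype tm = Var name | Fun name "tm list"

datatype atm = Eq tm tm | Pred name "tm list"

datatype fm =
    Atom atm
  | Neg fm
  | And fm fm
  | Or fm fm
  | Imp fm fm
  | Iff fm fm
  | All name fm
  | Ex name fm

primrec tm_vars :: "tm \<Rightarrow> name set" where
  "tm_vars (Var x) = {x}"
| "tm_vars (Fun f ts) = \<Union> (set (map tm_vars ts))"

primrec atm_vars :: "atm \<Rightarrow> name set" where
  "atm_vars (Eq s t) = tm_vars s \<union> tm_vars t"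
| "atm_vars (Pred p ts) = \<Union> (tm_vars ` set ts)"

definition vars :: "atm set \<Rightarrow> name set" where
  "vars S = \<Union> (atm_vars ` S)"

primrec atoms :: "fm \<Rightarrow> atm set" where
  "atoms (Atom a) = {a}"
| "atoms (Neg \<phi>) = atoms \<phi>"
| "atoms (And \<phi> \<psi>) = atoms \<phi> \<union> atoms \<psi>"
| "atoms (Or \<phi> \<psi>) = atoms \<phi> \<union> atoms \<psi>"
| "atoms (Imp \<phi> \<psi>) = atoms \<phi> \<union> atoms \<psi>"
| "atoms (Iff \<phi> \<psi>) = atoms \<phi> \<union> atoms \<psi>"
| "atoms (All x \<phi>) = atoms \<phi>"
| "atoms (Ex x \<phi>) = atoms \<phi>"

primrec free_vars :: "fm \<Rightarrow> name set" where
  "free_vars (Atom a) = atm_vars a"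
| "free_vars (Neg \<phi>) = free_vars \<phi>"
| "free_vars (And \<phi> \<psi>) = free_vars \<phi> \<union> free_vars \<psi>"
| "free_vars (Or \<phi> \<psi>) = free_vars \<phi> \<union> free_vars \<psi>"
| "free_vars (Imp \<phi> \<psi>) = free_vars \<phi> \<union> free_vars \<psi>"
| "free_vars (Iff \<phi> \<psi>) = free_vars \<phi> \<union> free_vars \<psi>"
| "free_vars (All x \<phi>) = free_vars \<phi> - {x}"
| "free_vars (Ex x \<phi>) = free_vars \<phi> - {x}"

record 'u fo_structure =
  universe :: "'u set"
  fun_int :: "name \<Rightarrow> 'u list \<Rightarrow> 'u"
  pred_int :: "name \<Rightarrow> 'u list \<Rightarrow> bool"

definition is_structure :: "'u fo_structure \<Rightarrow> bool" where
  "is_structure S \<longleftrightarrow> universe S \<noteq> {} \<and> (\<forall>f. \<forall>us\<in>lists (universe S). fun_int S f us \<in> universe S)"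

primrec eval_tm :: "'u fo_structure \<Rightarrow> (name \<Rightarrow> 'u) \<Rightarrow> tm \<Rightarrow> 'u" where
  "eval_tm S e (Var x) = e x"
| "eval_tm S e (Fun f ts) = fun_int S f (map (eval_tm S e) ts)"

primrec holds_atm :: "'u fo_structure \<Rightarrow> (name \<Rightarrow> 'u) \<Rightarrow> atm \<Rightarrow> bool" where
  "holds_atm S e (Eq s t) \<longleftrightarrow> eval_tm S e s = eval_tm S e t"
| "holds_atm S e (Pred p ts) \<longleftrightarrow> pred_int S p (map (eval_tm S e) ts)"

primrec holds :: "'u fo_structure \<Rightarrow> (name \<Rightarrow> 'u) \<Rightarrow> fm \<Rightarrow> bool" where
  "holds S e (Atom a) \<longleftrightarrow> holds_atm S e a"
| "holds S e (Neg \<phi>) \<longleftrightarrow> \<not> holds S e \<phi>"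
| "holds S e (And \<phi> \<psi>) \<longleftrightarrow> holds S e \<phi> \<and> holds S e \<psi>"
| "holds S e (Or \<phi> \<psi>) \<longleftrightarrow> holds S e \<phi> \<or> holds S e \<psi>"
| "holds S e (Imp \<phi> \<psi>) \<longleftrightarrow> (holds S e \<phi> \<longrightarrow> holds S e \<psi>)"
| "holds S e (Iff \<phi> \<psi>) \<longleftrightarrow> (holds S e \<phi> \<longleftrightarrow> holds S e \<psi>)"
| "holds S e (All x \<phi>) \<longleftrightarrow> (\<forall>u\<in>universe S. holds S (e(x := u)) \<phi>)"
| "holds S e (Ex x \<phi>) \<longleftrightarrow> (\<exists>u\<in>universe S. holds S (e(x := u)) \<phi>)"

definition models :: "'u fo_structure \<Rightarrow> fm \<Rightarrow> bool" where
  "models S \<phi> \<longleftrightarrow> is_structure S \<and> (\<forall>e. range e \<subseteq> universe S \<longrightarrow> holds S e \<phi>)"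

text \<open>HOL cannot quantify over types inside a formula, so domains are taken to be nonempty sets of
  natural numbers. The lemma \<open>satisfiable_of_model\<close> below shows that nothing is lost: a sentence
  with a model over any type whatsoever is satisfiable in this sense.\<close>

definition satisfiable :: "fm \<Rightarrow> bool" where
  "satisfiable \<phi> \<longleftrightarrow> (\<exists>S :: nat fo_structure. models S \<phi>)"


section \<open>Standard form and GBSR\<close>

type_synonym blocks = "(name list \<times> name list) list"

primrec close_prefix :: "blocks \<Rightarrow> fm \<Rightarrow> fm" where
  "close_prefix [] \<psi> = \<psi>"
| "close_prefix (b # bs) \<psi> = foldr All (fst b) (foldr Ex (snd b) (close_prefix bs \<psi>))"

text \<open>Quantifier-free, in negation normal form, with only conjunction, disjunction and negation.\<close>

fun nnf_matrix :: "fm \<Rightarrow> bool" where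
  "nnf_matrix (Atom a) = True"
| "nnf_matrix (Neg (Atom a)) = True"
| "nnf_matrix (And \<phi> \<psi>) = (nnf_matrix \<phi> \<and> nnf_matrix \<psi>)"
| "nnf_matrix (Or \<phi> \<psi>) = (nnf_matrix \<phi> \<and> nnf_matrix \<psi>)"
| "nnf_matrix _ = False"

definition bound_vars :: "blocks \<Rightarrow> name list" where
  "bound_vars B = concat (map (\<lambda>(xs, ys). xs @ ys) B)"

text \<open>The pair at index \<open>i\<close> of \<open>B\<close> (counted from 0) holds the tuples \<open>x\<close> and \<open>y\<close> of index
  \<open>i + 1\<close>. Only the first universal and the last existential tuple may be empty.\<close>

definition standard_form :: "blocks \<Rightarrow> fm \<Rightarrow> fm \<Rightarrow> bool" where
  "standard_form B \<psi> \<phi> \<longleftrightarrow>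
     \<phi> = close_prefix B \<psi> \<and> free_vars \<phi> = {} \<and> B \<noteq> [] \<and>
     (\<forall>i<length B. (0 < i \<longrightarrow> fst (B ! i) \<noteq> []) \<and> (Suc i < length B \<longrightarrow> snd (B ! i) \<noteq> [])) \<and>
     nnf_matrix \<psi> \<and> set (bound_vars B) \<subseteq> vars (atoms \<psi>) \<and> distinct (bound_vars B)"

primrec constants_only_tm :: "tm \<Rightarrow> bool" where
  "constants_only_tm (Var x) = True"
| "constants_only_tm (Fun f ts) = (ts = [])"

primrec constants_only_atm :: "atm \<Rightarrow> bool" where
  "constants_only_atm (Eq s t) = (constants_only_tm s \<and> constants_only_tm t)"
| "constants_only_atm (Pred p ts) = (\<forall>t\<in>set ts. constants_only_tm t)"

definition gbsr_partition :: "blocks \<Rightarrow> atm set \<Rightarrow> (nat \<Rightarrow> atm set) \<Rightarrow> bool" where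
  "gbsr_partition B At P \<longleftrightarrow>
     (let n = length B; X = (\<lambda>i. set (fst (B ! i))); Y = (\<lambda>i. set (snd (B ! i))) in
       (\<Union>i\<le>n. P i) = At \<and>
       (\<forall>i j. i < j \<and> j \<le> n \<longrightarrow> P i \<inter> P j = {}) \<and>
       (\<forall>i\<le>n. vars (P i) \<subseteq> (\<Union>j\<in>{..<i}. Y j) \<union> (\<Union>j\<in>{i..<n}. X j)) \<and>
       (\<forall>i j. i < j \<and> j \<le> n \<longrightarrow> vars (P i) \<inter> vars (P j) \<inter> (\<Union>l<n. X l) = {}))"

definition gbsr :: "fm set" where
  "gbsr = {\<phi>. \<exists>B \<psi>. standard_form B \<psi> \<phi> \<and> (\<forall>a\<in>atoms \<phi>. constants_only_atm a) \<and>
                (\<exists>P. gbsr_partition B (atoms \<phi>) P)}"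


section \<open>Formulas as words\<close>

text \<open>Words are lists of tape symbols, which are natural numbers; 0 is reserved for the blank.
  Formulas are written in prefix notation, with 1 and 2 as the letters of names and 3 as an
  end marker for names and argument lists.\<close>

type_synonym word = "nat list"

definition enc_name :: "name \<Rightarrow> word" where
  "enc_name x = map (\<lambda>b. if b then 2 else 1) x @ [3]"

primrec enc_tm :: "tm \<Rightarrow> word" where
  "enc_tm (Var x) = 4 # enc_name x"
| "enc_tm (Fun f ts) = 5 # enc_name f @ concat (map enc_tm ts) @ [3]"

primrec enc_atm :: "atm \<Rightarrow> word" where
  "enc_atm (Eq s t) = 6 # enc_tm s @ enc_tm t"
| "enc_atm (Pred p ts) = 7 # enc_name p @ concat (map enc_tm ts) @ [3]"

primrec enc_fm :: "fm \<Rightarrow> word" where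
  "enc_fm (Atom a) = enc_atm a"
| "enc_fm (Neg \<phi>) = 8 # enc_fm \<phi>"
| "enc_fm (And \<phi> \<psi>) = 9 # enc_fm \<phi> @ enc_fm \<psi>"
| "enc_fm (Or \<phi> \<psi>) = 10 # enc_fm \<phi> @ enc_fm \<psi>"
| "enc_fm (Imp \<phi> \<psi>) = 11 # enc_fm \<phi> @ enc_fm \<psi>"
| "enc_fm (Iff \<phi> \<psi>) = 12 # enc_fm \<phi> @ enc_fm \<psi>"
| "enc_fm (All x \<phi>) = 13 # enc_name x @ enc_fm \<phi>"
| "enc_fm (Ex x \<phi>) = 14 # enc_name x @ enc_fm \<phi>"


section \<open>Turing machines\<close>

text \<open>Nondeterministic machines with any positive number of tapes, each infinite in both
  directions. A transition maps a state and the list of scanned symbols to a new state and, for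
  each tape, the symbol to write and the head movement. Finiteness of the transition set keeps the
  states and the tape alphabet finite.\<close>

datatype move = Go_Left | Stay | Go_Right

type_synonym transition = "(nat \<times> nat list) \<times> (nat \<times> (nat \<times> move) list)"

record tmachine =
  tapes :: nat
  start :: nat
  accept :: nat
  transitions :: "transition set"

definition wf_tmachine :: "tmachine \<Rightarrow> bool" where
  "wf_tmachine M \<longleftrightarrow> 1 \<le> tapes M \<and> finite (transitions M) \<and>
     (\<forall>((q, rs), (q', as)) \<in> transitions M. length rs = tapes M \<and> length as = tapes M \<and> q \<noteq> accept M)"

definition deterministic :: "tmachine \<Rightarrow> bool" where
  "deterministic M \<longleftrightarrow> single_valued (transitions M)"

type_synonym tape = "(int \<Rightarrow> nat) \<times> int"

type_synonym config = "nat \<times> tape list"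

definition scan :: "tape \<Rightarrow> nat" where
  "scan tp = fst tp (snd tp)"

fun move_head :: "move \<Rightarrow> int \<Rightarrow> int" where
  "move_head Go_Left h = h - 1"
| "move_head Stay h = h"
| "move_head Go_Right h = h + 1"

definition act :: "nat \<times> move \<Rightarrow> tape \<Rightarrow> tape" where
  "act a tp = ((fst tp)(snd tp := fst a), move_head (snd a) (snd tp))"

definition step :: "tmachine \<Rightarrow> config \<Rightarrow> config \<Rightarrow> bool" where
  "step M c c' \<longleftrightarrow> (\<exists>as. ((fst c, map scan (snd c)), (fst c', as)) \<in> transitions M \<and>
                        snd c' = map2 act as (snd c))"

definition word_tape :: "word \<Rightarrow> int \<Rightarrow> nat" where
  "word_tape w i = (if 0 \<le> i \<and> nat i < length w then w ! nat i else 0)"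

definition init :: "tmachine \<Rightarrow> word \<Rightarrow> config" where
  "init M w = (start M, (word_tape w, 0) # replicate (tapes M - 1) (word_tape [], 0))"

definition reaches_in :: "tmachine \<Rightarrow> nat \<Rightarrow> word \<Rightarrow> config \<Rightarrow> bool" where
  "reaches_in M n w c \<longleftrightarrow> (step M ^^ n) (init M w) c"

definition accepts :: "tmachine \<Rightarrow> word \<Rightarrow> bool" where
  "accepts M w \<longleftrightarrow> (\<exists>n c. reaches_in M n w c \<and> fst c = accept M)"

definition all_runs_within :: "tmachine \<Rightarrow> word \<Rightarrow> nat \<Rightarrow> bool" where
  "all_runs_within M w T \<longleftrightarrow> (\<forall>n c. reaches_in M n w c \<longrightarrow> n \<le> T)"

text \<open>The output is the contents of the last tape when the accepting state is reached.\<close>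

definition outputs_within :: "tmachine \<Rightarrow> word \<Rightarrow> nat \<Rightarrow> word \<Rightarrow> bool" where
  "outputs_within M w T v \<longleftrightarrow>
     (\<exists>n\<le>T. \<exists>c. reaches_in M n w c \<and> fst c = accept M \<and> fst (last (snd c)) = word_tape v)"


section \<open>Decision problems, k-NEXPTIME and hardness\<close>

text \<open>A decision problem is the set of its instances together with the set of its yes-instances.\<close>

type_synonym problem = "word set \<times> word set"

primrec tower :: "nat \<Rightarrow> nat \<Rightarrow> nat" where
  "tower 0 m = m"
| "tower (Suc k) m = 2 ^ tower k m"

definition k_nexptime :: "nat \<Rightarrow> problem set" where
  "k_nexptime k = {(lists \<Sigma>, L) | \<Sigma> L. finite \<Sigma> \<and> 0 \<notin> \<Sigma> \<and> L \<subseteq> lists \<Sigma> \<and>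
     (\<exists>M (p :: nat poly). wf_tmachine M \<and>
        (\<forall>w\<in>lists \<Sigma>. all_runs_within M w (tower k (poly p (length w))) \<and>
                     (w \<in> L \<longleftrightarrow> accepts M w)))}"

definition polytime_on :: "word set \<Rightarrow> (word \<Rightarrow> word) \<Rightarrow> bool" where
  "polytime_on I f \<longleftrightarrow> (\<exists>M (p :: nat poly). wf_tmachine M \<and> deterministic M \<and>
     (\<forall>w\<in>I. outputs_within M w (poly p (length w)) (f w)))"

definition poly_reducible :: "problem \<Rightarrow> problem \<Rightarrow> bool" (infix \<open>\<le>\<^sub>p\<close> 50) where
  "A \<le>\<^sub>p B \<longleftrightarrow> (\<exists>f. polytime_on (fst A) f \<and>
     (\<forall>w\<in>fst A. f w \<in> fst B \<and> (w \<in> snd A \<longleftrightarrow> f w \<in> snd B)))"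

definition k_nexptime_hard :: "nat \<Rightarrow> problem \<Rightarrow> bool" where
  "k_nexptime_hard k B \<longleftrightarrow> (\<forall>A\<in>k_nexptime k. A \<le>\<^sub>p B)"

definition gbsr_sat :: problem where
  "gbsr_sat = (enc_fm ` gbsr, enc_fm ` {\<phi> \<in> gbsr. satisfiable \<phi>})"


section \<open>The word encoding is injective and avoids the blank\<close>

lemma enc_name_prefix: "enc_name x @ r = enc_name y @ s \<Longrightarrow> x = y \<and> r = s"
proof (induction x arbitrary: y)
  case Nil
  then show ?case by (cases y) (auto simp: enc_name_def split: if_splits)
next
  case (Cons a x)
  then show ?case by (cases y) (fastforce simp: enc_name_def split: if_splits)+
qed

lemma enc_tms_prefix:
  assumes "\<And>t t' r s. t \<in> set ts \<Longrightarrow> enc_tm t @ r = enc_tm t' @ s \<Longrightarrow> t = t' \<and> r = s"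
    and "concat (map enc_tm ts) @ 3 # r = concat (map enc_tm us) @ 3 # s"
  shows "ts = us \<and> r = s"
  using assms
proof (induction ts arbitrary: us)
  case Nil
  show ?case
  proof (cases us)
    case Nil
    then show ?thesis using Nil.prems by simp
  next
    case (Cons u us')
    then show ?thesis using Nil.prems by (cases u) auto
  qed
next
  case (Cons t ts)
  show ?case
  proof (cases us)
    case Nil
    then show ?thesis using Cons.prems by (cases t) auto
  next
    case (Cons u us')
    then have "enc_tm t @ (concat (map enc_tm ts) @ 3 # r) = enc_tm u @ (concat (map enc_tm us') @ 3 # s)"
      using Cons.prems(2) by simp
    then have "t = u \<and> concat (map enc_tm ts) @ 3 # r = concat (map enc_tm us') @ 3 # s"
      by (rule Cons.prems(1)[rotated]) simp
    moreover have "ts = us' \<and> r = s"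
    proof (rule Cons.IH)
      show "t = t' \<and> r = s" if "t \<in> set ts" "enc_tm t @ r = enc_tm t' @ s" for t t' r s
        using that(2) by (rule Cons.prems(1)[rotated]) (use that(1) in simp)
    qed (use calculation in simp)
    ultimately show ?thesis using Cons by simp
  qed
qed

lemma enc_tm_prefix: "enc_tm t @ r = enc_tm t' @ s \<Longrightarrow> t = t' \<and> r = s"
proof (induction t arbitrary: t' r s)
  case (Var x)
  then show ?case by (cases t') (auto dest: enc_name_prefix)
next
  case (Fun f ts)
  then obtain g us where t': "t' = Fun g us" by (cases t') auto
  then have "f = g \<and> concat (map enc_tm ts) @ 3 # r = concat (map enc_tm us) @ 3 # s"
    using Fun.prems by (auto dest: enc_name_prefix)
  moreover from this have "ts = us \<and> r = s" by (intro enc_tms_prefix[OF Fun.IH]) simp_all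
  ultimately show ?case using t' by simp
qed

lemma enc_atm_prefix: "enc_atm a @ r = enc_atm b @ s \<Longrightarrow> a = b \<and> r = s"
proof (cases a; cases b)
  fix p q ts us
  assume *: "enc_atm a @ r = enc_atm b @ s" "a = Pred p ts" "b = Pred q us"
  then have "p = q \<and> concat (map enc_tm ts) @ 3 # r = concat (map enc_tm us) @ 3 # s"
    by (auto dest: enc_name_prefix)
  moreover from this have "ts = us \<and> r = s" by (intro enc_tms_prefix[OF enc_tm_prefix]) simp_all
  ultimately show ?thesis using * by simp
qed (auto dest!: enc_tm_prefix)

lemma enc_fm_prefix: "enc_fm \<phi> @ r = enc_fm \<psi> @ s \<Longrightarrow> \<phi> = \<psi> \<and> r = s"
proof (induction \<phi> arbitrary: \<psi> r s)
  case (Atom a)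
  show ?case
  proof (cases \<psi>)
    case (Atom b)
    then have "enc_atm a @ r = enc_atm b @ s" using Atom.prems by simp
    then have "a = b \<and> r = s" by (rule enc_atm_prefix)
    then show ?thesis using Atom by simp
  qed (use Atom.prems in \<open>cases a; simp\<close>)+
next
  case (Neg \<phi>)
  show ?case
  proof (cases \<psi>)
    case (Atom b)
    then show ?thesis using Neg.prems by (cases b) auto
  next
    case (Neg \<psi>')
    then have "enc_fm \<phi> @ r = enc_fm \<psi>' @ s" using Neg.prems by simp
    then have "\<phi> = \<psi>' \<and> r = s" by (rule Neg.IH)
    then show ?thesis using Neg by simp
  qed (use Neg.prems in auto)
next
  case (And \<phi>1 \<phi>2)
  show ?case
  proof (cases \<psi>)
    case (Atom b)
    then show ?thesis using And.prems by (cases b) auto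
  next
    case (And \<psi>1 \<psi>2)
    then have "enc_fm \<phi>1 @ enc_fm \<phi>2 @ r = enc_fm \<psi>1 @ enc_fm \<psi>2 @ s"
      using And.prems by simp
    then have "\<phi>1 = \<psi>1 \<and> enc_fm \<phi>2 @ r = enc_fm \<psi>2 @ s" by (rule And.IH(1))
    moreover from this have "\<phi>2 = \<psi>2 \<and> r = s" by (intro And.IH(2)) simp
    ultimately show ?thesis using And by simp
  qed (use And.prems in auto)
next
  case (Or \<phi>1 \<phi>2)
  show ?case
  proof (cases \<psi>)
    case (Atom b)
    then show ?thesis using Or.prems by (cases b) auto
  next
    case (Or \<psi>1 \<psi>2)
    then have "enc_fm \<phi>1 @ enc_fm \<phi>2 @ r = enc_fm \<psi>1 @ enc_fm \<psi>2 @ s"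
      using Or.prems by simp
    then have "\<phi>1 = \<psi>1 \<and> enc_fm \<phi>2 @ r = enc_fm \<psi>2 @ s" by (rule Or.IH(1))
    moreover from this have "\<phi>2 = \<psi>2 \<and> r = s" by (intro Or.IH(2)) simp
    ultimately show ?thesis using Or by simp
  qed (use Or.prems in auto)
next
  case (Imp \<phi>1 \<phi>2)
  show ?case
  proof (cases \<psi>)
    case (Atom b)
    then show ?thesis using Imp.prems by (cases b) auto
  next
    case (Imp \<psi>1 \<psi>2)
    then have "enc_fm \<phi>1 @ enc_fm \<phi>2 @ r = enc_fm \<psi>1 @ enc_fm \<psi>2 @ s"
      using Imp.prems by simp
    then have "\<phi>1 = \<psi>1 \<and> enc_fm \<phi>2 @ r = enc_fm \<psi>2 @ s" by (rule Imp.IH(1))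
    moreover from this have "\<phi>2 = \<psi>2 \<and> r = s" by (intro Imp.IH(2)) simp
    ultimately show ?thesis using Imp by simp
  qed (use Imp.prems in auto)
next
  case (Iff \<phi>1 \<phi>2)
  show ?case
  proof (cases \<psi>)
    case (Atom b)
    then show ?thesis using Iff.prems by (cases b) auto
  next
    case (Iff \<psi>1 \<psi>2)
    then have "enc_fm \<phi>1 @ enc_fm \<phi>2 @ r = enc_fm \<psi>1 @ enc_fm \<psi>2 @ s"
      using Iff.prems by simp
    then have "\<phi>1 = \<psi>1 \<and> enc_fm \<phi>2 @ r = enc_fm \<psi>2 @ s" by (rule Iff.IH(1))
    moreover from this have "\<phi>2 = \<psi>2 \<and> r = s" by (intro Iff.IH(2)) simp
    ultimately show ?thesis using Iff by simp
  qed (use Iff.prems in auto)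
next
  case (All x \<phi>)
  show ?case
  proof (cases \<psi>)
    case (Atom b)
    then show ?thesis using All.prems by (cases b) auto
  next
    case (All y \<psi>')
    then have "enc_name x @ enc_fm \<phi> @ r = enc_name y @ enc_fm \<psi>' @ s"
      using All.prems by simp
    then have "x = y \<and> enc_fm \<phi> @ r = enc_fm \<psi>' @ s" by (rule enc_name_prefix)
    moreover from this have "\<phi> = \<psi>' \<and> r = s" by (intro All.IH) simp
    ultimately show ?thesis using All by simp
  qed (use All.prems in auto)
next
  case (Ex x \<phi>)
  show ?case
  proof (cases \<psi>)
    case (Atom b)
    then show ?thesis using Ex.prems by (cases b) auto
  next
    case (Ex y \<psi>')
    then have "enc_name x @ enc_fm \<phi> @ r = enc_name y @ enc_fm \<psi>' @ s"
      using Ex.prems by simp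
    then have "x = y \<and> enc_fm \<phi> @ r = enc_fm \<psi>' @ s" by (rule enc_name_prefix)
    moreover from this have "\<phi> = \<psi>' \<and> r = s" by (intro Ex.IH) simp
    ultimately show ?thesis using Ex by simp
  qed (use Ex.prems in auto)
qed

lemma inj_enc_fm: "inj enc_fm"
proof (rule injI)
  fix \<phi> \<psi>
  assume "enc_fm \<phi> = enc_fm \<psi>"
  then have "enc_fm \<phi> @ [] = enc_fm \<psi> @ []" by simp
  from enc_fm_prefix[OF this] show "\<phi> = \<psi>" by simp
qed

lemma zero_notin_enc_name: "0 \<notin> set (enc_name x)"
  by (auto simp: enc_name_def)

lemma zero_notin_enc_tm: "0 \<notin> set (enc_tm t)"
  by (induction t) (auto simp: zero_notin_enc_name)

lemma zero_notin_enc_fm: "0 \<notin> set (enc_fm \<phi>)"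
proof (induction \<phi>)
  case (Atom a)
  then show ?case by (cases a) (auto simp: zero_notin_enc_name zero_notin_enc_tm)
qed (auto simp: zero_notin_enc_name)


section \<open>Models over arbitrary types\<close>

instance tm :: countable by countable_datatype
instance atm :: countable by countable_datatype
instance fm :: countable by countable_datatype

lemma finite_tm_vars: "finite (tm_vars t)"
  by (induction t) auto

lemma finite_free_vars: "finite (free_vars \<phi>)"
proof (induction \<phi>)
  case (Atom a)
  then show ?case by (cases a) (auto simp: finite_tm_vars)
qed auto

lemma eval_tm_cong: "(\<And>x. x \<in> tm_vars t \<Longrightarrow> e x = e' x) \<Longrightarrow> eval_tm S e t = eval_tm S e' t"
proof (induction t)
  case (Fun f ts)
  then have "map (eval_tm S e) ts = map (eval_tm S e') ts" by auto
  then show ?case by (metis eval_tm.simps(2))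
qed auto

lemma holds_cong: "(\<And>x. x \<in> free_vars \<phi> \<Longrightarrow> e x = e' x) \<Longrightarrow> holds S e \<phi> = holds S e' \<phi>"
proof (induction \<phi> arbitrary: e e')
  case (Atom a)
  show ?case
  proof (cases a)
    case (Eq s t)
    then have "eval_tm S e s = eval_tm S e' s" "eval_tm S e t = eval_tm S e' t"
      using Atom by (auto intro!: eval_tm_cong)
    then show ?thesis using Eq by simp
  next
    case (Pred p ts)
    then have "map (eval_tm S e) ts = map (eval_tm S e') ts"
      using Atom by (auto intro!: eval_tm_cong)
    then show ?thesis using Pred by (metis holds.simps(1) holds_atm.simps(2))
  qed
next
  case (Neg \<phi>)
  have "holds S e \<phi> = holds S e' \<phi>" by (rule Neg.IH) (use Neg.prems in simp)
  then show ?case by simp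
next
  case (And \<phi>1 \<phi>2)
  have "holds S e \<phi>1 = holds S e' \<phi>1" by (rule And.IH(1)) (use And.prems in simp)
  moreover have "holds S e \<phi>2 = holds S e' \<phi>2" by (rule And.IH(2)) (use And.prems in simp)
  ultimately show ?case by simp
next
  case (Or \<phi>1 \<phi>2)
  have "holds S e \<phi>1 = holds S e' \<phi>1" by (rule Or.IH(1)) (use Or.prems in simp)
  moreover have "holds S e \<phi>2 = holds S e' \<phi>2" by (rule Or.IH(2)) (use Or.prems in simp)
  ultimately show ?case by simp
next
  case (Imp \<phi>1 \<phi>2)
  have "holds S e \<phi>1 = holds S e' \<phi>1" by (rule Imp.IH(1)) (use Imp.prems in simp)
  moreover have "holds S e \<phi>2 = holds S e' \<phi>2" by (rule Imp.IH(2)) (use Imp.prems in simp)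
  ultimately show ?case by simp
next
  case (Iff \<phi>1 \<phi>2)
  have "holds S e \<phi>1 = holds S e' \<phi>1" by (rule Iff.IH(1)) (use Iff.prems in simp)
  moreover have "holds S e \<phi>2 = holds S e' \<phi>2" by (rule Iff.IH(2)) (use Iff.prems in simp)
  ultimately show ?case by simp
next
  case (All x \<phi>)
  have "holds S (e(x := u)) \<phi> = holds S (e'(x := u)) \<phi>" for u
    by (rule All.IH) (use All.prems in auto)
  then show ?case by simp
next
  case (Ex x \<phi>)
  have "holds S (e(x := u)) \<phi> = holds S (e'(x := u)) \<phi>" for u
    by (rule Ex.IH) (use Ex.prems in auto)
  then show ?case by simp
qed

text \<open>Closing a set once under the functions of \<open>S\<close> and under witnesses, chosen by \<open>W\<close>, for
  formulas whose free variables take finitely many values in the set.\<close>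

definition hull_step ::
  "'u fo_structure \<Rightarrow> (name \<Rightarrow> fm \<Rightarrow> (name \<times> 'u) list \<Rightarrow> 'u) \<Rightarrow> 'u set \<Rightarrow> 'u set" where
  "hull_step S W A = A \<union> (\<lambda>(f, us). fun_int S f us) ` (UNIV \<times> lists A)
     \<union> (\<lambda>(x, \<phi>, l). W x \<phi> l) ` (UNIV \<times> UNIV \<times> lists (UNIV \<times> A))"

lemma satisfiable_of_model:
  fixes S :: "'u fo_structure"
  assumes "models S \<phi>"
  shows "satisfiable \<phi>"
proof -
  have S: "is_structure S" using assms by (simp add: models_def)
  then obtain d where d: "d \<in> universe S" by (auto simp: is_structure_def)
  define asg :: "(name \<times> 'u) list \<Rightarrow> name \<Rightarrow> 'u"
    where "asg l x = (case map_of l x of Some u \<Rightarrow> u | None \<Rightarrow> d)" for l x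
  define W where "W x \<psi> l = (if \<exists>u\<in>universe S. holds S ((asg l)(x := u)) \<psi>
      then SOME u. u \<in> universe S \<and> holds S ((asg l)(x := u)) \<psi> else d)" for x \<psi> l
  have W_dom: "W x \<psi> l \<in> universe S" for x \<psi> l
  proof (cases "\<exists>u\<in>universe S. holds S ((asg l)(x := u)) \<psi>")
    case True
    then have "\<exists>u. u \<in> universe S \<and> holds S ((asg l)(x := u)) \<psi>" by blast
    from someI_ex[OF this] show ?thesis using True by (simp add: W_def)
  next
    case False
    then show ?thesis using d by (simp add: W_def)
  qed
  have W_wit: "holds S ((asg l)(x := W x \<psi> l)) \<psi>"
    if "u \<in> universe S" "holds S ((asg l)(x := u)) \<psi>" for x \<psi> l u
  proof -
    have "\<exists>u. u \<in> universe S \<and> holds S ((asg l)(x := u)) \<psi>" using that by blast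
    from someI_ex[OF this] show ?thesis using that by (auto simp: W_def)
  qed
  define A where "A n = (hull_step S W ^^ n) {d}" for n
  define H where "H = (\<Union>n. A n)"
  have A_Suc: "A (Suc n) = hull_step S W (A n)" for n by (simp add: A_def)
  have "countable (A n)" for n
  proof (induction n)
    case 0
    then show ?case by (simp add: A_def)
  next
    case (Suc n)
    then show ?case unfolding A_Suc hull_step_def by (intro countable_Un countable_image countable_SIGMA countable_lists) auto
  qed
  then have cH: "countable H" by (simp add: H_def)
  have "A n \<subseteq> universe S" for n
  proof (induction n)
    case 0
    then show ?case using d by (simp add: A_def)
  next
    case (Suc n)
    then have "fun_int S f us \<in> universe S" if "us \<in> lists (A n)" for f us
      using S that lists_mono[OF Suc] unfolding is_structure_def by blast
    then show ?case unfolding A_Suc hull_step_def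
      by (intro Un_least image_subsetI Suc.IH) (auto simp: W_dom split: prod.split)
  qed
  then have H_dom: "H \<subseteq> universe S" by (auto simp: H_def)
  have dH: "d \<in> H" unfolding H_def A_def by (auto intro!: exI[of _ 0])
  have A_mono: "m \<le> n \<Longrightarrow> A m \<subseteq> A n" for m n
    by (rule lift_Suc_mono_le[of A]) (auto simp: A_Suc hull_step_def)
  have fin_A: "\<exists>n. F \<subseteq> A n" if "finite F" "F \<subseteq> H" for F
    using that
  proof (induction F rule: finite_induct)
    case (insert a F)
    then obtain m n where "F \<subseteq> A m" "a \<in> A n" by (auto simp: H_def)
    then have "insert a F \<subseteq> A (max m n)" using A_mono[of m "max m n"] A_mono[of n "max m n"] by auto
    then show ?case by blast
  qed simp
  have H_fun: "fun_int S f us \<in> H" if us: "us \<in> lists H" for f us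
  proof -
    obtain n where "set us \<subseteq> A n" using fin_A[of "set us"] us by auto
    then have "us \<in> lists (A n)" by auto
    then have "fun_int S f us \<in> A (Suc n)" unfolding A_Suc hull_step_def
      by (intro UnI1 UnI2 image_eqI[of _ _ "(f, us)"]) simp_all
    then show ?thesis by (auto simp: H_def)
  qed
  have H_wit: "W x \<psi> l \<in> H" if l: "snd ` set l \<subseteq> H" for x \<psi> l
  proof -
    obtain n where "snd ` set l \<subseteq> A n" using fin_A[of "snd ` set l"] l by auto
    then have "l \<in> lists (UNIV \<times> A n)" by auto
    then have "(x, \<psi>, l) \<in> UNIV \<times> UNIV \<times> lists (UNIV \<times> A n)" by simp
    then have "W x \<psi> l \<in> A (Suc n)" unfolding A_Suc hull_step_def
      by (intro UnI2 image_eqI[of _ _ "(x, \<psi>, l)"]) simp_all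
    then show ?thesis by (auto simp: H_def)
  qed
  have wit: "\<exists>v\<in>H. holds S (e(x := v)) \<psi>"
    if e: "range e \<subseteq> H" and u: "u \<in> universe S" "holds S (e(x := u)) \<psi>" for e x \<psi> u
  proof -
    obtain vs where vs: "set vs = free_vars \<psi>" using finite_list[OF finite_free_vars[of \<psi>]] by (elim exE)
    define l where "l = map (\<lambda>y. (y, e y)) vs"
    have asg: "asg l y = e y" if "y \<in> free_vars \<psi>" for y
      using that vs by (simp add: asg_def l_def map_of_map_restrict)
    have eq: "holds S ((asg l)(x := v)) \<psi> = holds S (e(x := v)) \<psi>" for v
      by (rule holds_cong) (use asg in auto)
    have "holds S (e(x := W x \<psi> l)) \<psi>" using W_wit[of u l x \<psi>] u unfolding eq by simp
    moreover have "W x \<psi> l \<in> H" by (rule H_wit) (use e in \<open>auto simp: l_def\<close>)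
    ultimately show ?thesis by blast
  qed
  define h where "h = to_nat_on H"
  define g where "g = inv_into H h"
  have inj: "inj_on h H" unfolding h_def by (rule inj_on_to_nat_on[OF cH])
  have gh: "g (h u) = u" if "u \<in> H" for u using inj that by (simp add: g_def)
  have hg: "h (g n) = n" if "n \<in> h ` H" for n
    using that gh by auto
  have g_in: "g n \<in> H" if "n \<in> h ` H" for n
    using that gh by auto
  have g_range: "range (\<lambda>y. g (e y)) \<subseteq> H" if "range e \<subseteq> h ` H" for e :: "name \<Rightarrow> nat"
    using that by (intro image_subsetI g_in) blast
  define S' :: "nat fo_structure" where
    "S' = \<lparr>universe = h ` H, fun_int = (\<lambda>f ns. h (fun_int S f (map g ns))),
           pred_int = (\<lambda>p ns. pred_int S p (map g ns))\<rparr>"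
  have S'_sel: "universe S' = h ` H" "fun_int S' f ns = h (fun_int S f (map g ns))"
    "pred_int S' p ns = pred_int S p (map g ns)" for f p ns by (simp_all add: S'_def)
  have tm: "eval_tm S' e t \<in> h ` H \<and> g (eval_tm S' e t) = eval_tm S (\<lambda>y. g (e y)) t"
    if e: "range e \<subseteq> h ` H" for e t
  proof (induction t)
    case (Var x)
    then show ?case using e by auto
  next
    case (Fun f ts)
    have eq: "map g (map (eval_tm S' e) ts) = map (eval_tm S (\<lambda>y. g (e y))) ts" using Fun by simp
    have "map g (map (eval_tm S' e) ts) \<in> lists H"
    proof (rule in_listsI, rule ballI)
      fix u assume "u \<in> set (map g (map (eval_tm S' e) ts))"
      then obtain t where "t \<in> set ts" "u = g (eval_tm S' e t)" by auto
      moreover have "g (eval_tm S' e t) \<in> H" using Fun.IH[OF \<open>t \<in> set ts\<close>] by (intro g_in) simp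
      ultimately show "u \<in> H" by simp
    qed
    then have "fun_int S f (map g (map (eval_tm S' e) ts)) \<in> H" by (rule H_fun)
    then have "eval_tm S' e (Fun f ts) \<in> h ` H"
        "g (eval_tm S' e (Fun f ts)) = fun_int S f (map g (map (eval_tm S' e) ts))"
      using gh by (simp_all add: S'_sel)
    then show ?case unfolding eq by simp
  qed
  have fm: "holds S' e \<psi> = holds S (\<lambda>y. g (e y)) \<psi>" if "range e \<subseteq> h ` H" for e \<psi>
    using that
  proof (induction \<psi> arbitrary: e)
    case (Atom a)
    show ?case
    proof (cases a)
      case (Eq s t)
      have "eval_tm S' e s = eval_tm S' e t \<longleftrightarrow> g (eval_tm S' e s) = g (eval_tm S' e t)"
        using tm[OF Atom, of s] tm[OF Atom, of t] hg by metis
      then show ?thesis using tm[OF Atom, of s] tm[OF Atom, of t] Eq by simp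
    next
      case (Pred p ts)
      have "map g (map (eval_tm S' e) ts) = map (eval_tm S (\<lambda>y. g (e y))) ts" using tm[OF Atom] by simp
      then show ?thesis unfolding Pred holds.simps(1) holds_atm.simps(2) S'_sel by (simp only:)
    qed
  next
    case (All x \<psi>)
    have IH: "holds S' (e(x := h u)) \<psi> = holds S ((\<lambda>y. g (e y))(x := u)) \<psi>" if "u \<in> H" for u
    proof -
      have "range (e(x := h u)) \<subseteq> h ` H" using All.prems that by auto
      moreover have "(\<lambda>y. g ((e(x := h u)) y)) = (\<lambda>y. g (e y))(x := u)" using gh[OF that] by (simp add: fun_eq_iff)
      ultimately show ?thesis using All.IH[of "e(x := h u)"] by (simp only:)
    qed
    have "range (\<lambda>y. g (e y)) \<subseteq> H" by (rule g_range[OF All.prems])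
    then have "(\<exists>u\<in>universe S. holds S ((\<lambda>y. g (e y))(x := u)) (Neg \<psi>)) = (\<exists>u\<in>H. holds S ((\<lambda>y. g (e y))(x := u)) (Neg \<psi>))"
      using wit[of "\<lambda>y. g (e y)" _ x "Neg \<psi>"] H_dom by blast
    then have "(\<forall>u\<in>universe S. holds S ((\<lambda>y. g (e y))(x := u)) \<psi>) = (\<forall>u\<in>H. holds S ((\<lambda>y. g (e y))(x := u)) \<psi>)"
      unfolding holds.simps(2) by blast
    then show ?case using IH by (simp add: S'_sel)
  next
    case (Ex x \<psi>)
    have IH: "holds S' (e(x := h u)) \<psi> = holds S ((\<lambda>y. g (e y))(x := u)) \<psi>" if "u \<in> H" for u
    proof -
      have "range (e(x := h u)) \<subseteq> h ` H" using Ex.prems that by auto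
      moreover have "(\<lambda>y. g ((e(x := h u)) y)) = (\<lambda>y. g (e y))(x := u)" using gh[OF that] by (simp add: fun_eq_iff)
      ultimately show ?thesis using Ex.IH[of "e(x := h u)"] by (simp only:)
    qed
    have "range (\<lambda>y. g (e y)) \<subseteq> H" by (rule g_range[OF Ex.prems])
    then have "(\<exists>u\<in>universe S. holds S ((\<lambda>y. g (e y))(x := u)) \<psi>) = (\<exists>u\<in>H. holds S ((\<lambda>y. g (e y))(x := u)) \<psi>)"
      using wit[of "\<lambda>y. g (e y)" _ x \<psi>] H_dom by blast
    then show ?case using IH by (simp add: S'_sel)
  qed auto
  have "is_structure S'"
    unfolding is_structure_def S'_sel
  proof (intro conjI allI ballI imageI H_fun)
    show "h ` H \<noteq> {}" using dH by blast
    show "map g ns \<in> lists H" if "ns \<in> lists (h ` H)" for ns using that g_in by (auto simp: in_lists_conv_set)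
  qed
  moreover have "holds S' e \<phi>" if e: "range e \<subseteq> h ` H" for e
  proof -
    have "range (\<lambda>y. g (e y)) \<subseteq> universe S" using g_range[OF e] H_dom by (rule subset_trans)
    then show ?thesis using fm[OF e] assms by (simp add: models_def)
  qed
  ultimately have "models S' \<phi>" by (simp add: models_def S'_sel)
  then show ?thesis by (auto simp: satisfiable_def)
qed

end

theory Submission
  imports Defs
begin

text \<open>
  Let \<open>M\<close> be a nondeterministic machine with running time \<open>tower k (p n)\<close>. A sentence in which no atom
  contains both universal and existential variables is in GBSR. Such sentences cannot say directly that
  every \<open>x\<close> has a successor \<open>y\<close>, but if numbers are given by their bits, then
  \<open>\<forall>x \<exists>y \<forall>b \<exists>b'. b' \<sim> b \<and> (bit b of x + 1 \<longleftrightarrow> bit b' of y)\<close> is separated, and \<open>b' \<sim> b\<close> can be unfolded in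
  the same way one exponential level further down, until the positions are constants. Universal axioms
  that scan the bits along the successor relation of the lower level turn equality of bits into equality
  of elements. Hence \<open>K\<close> levels above \<open>n + 1\<close> constants give a chain of length \<open>tower K (n + 1)\<close>. Since
  \<open>K\<close> may be any number depending only on \<open>M\<close>, \<open>k\<close> and \<open>p\<close>, it is chosen so large that this exceeds the
  running time, and no constants beyond one per input position are needed. On this chain a run of \<open>M\<close> is
  described by universal axioms.

  For the direction from models to runs the length of the chain is irrelevant: the axioms forbid heads to
  leave the chain, so every model shows a genuine run, which can only stop in the accepting state.
\<close>

section \<open>Transducers as Turing machines\<close>

text \<open>The obstacle is that a separated sentence cannot compare an existential variable with a
  universal one, not even by equality. The prefix is therefore used as a game. On each level, from
  the top down, a move \<open>vx l\<close> is answered by \<open>vy l\<close> and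
  \<open>vs l\<close>, and only afterwards is a bit position challenged one level below; so the same
  two answers must be right at all bits. The recursion ends at level 0, where both players are
  compared with constants.

  The sentence nowhere defines binary addition: \<open>pG\<close> is an unconstrained predicate. The
  axioms only force \<open>pS\<close> to be a total injective function on each level, and each level
  to be finite. Hence the orbit of zero is a cycle, and a scan that starts at zero arrives at its
  predecessor, which is all that the direction from models to runs needs. Counting in binary takes
  place in the intended model alone.

  Since K does not depend on the input, neither do the prefix and the axioms. The input enters only
  through short subformulas whose constants carry unary indices, so a machine that sweeps over a
  block of marks computes the reduction.\<close>

locale transducer =
  fixes l0 halt :: "'l::{countable,finite}"
    and u0 :: word
    and \<Gamma>0 \<Gamma>1 :: "nat set"
    and \<delta> :: "'l \<Rightarrow> nat \<Rightarrow> nat \<Rightarrow> 'l \<times> word \<times> move \<times> nat \<times> move"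
  assumes fin: "finite \<Gamma>0" "finite \<Gamma>1" and zero: "0 \<in> \<Gamma>0" "0 \<in> \<Gamma>1"
begin

text \<open>Tape 0 is read only, tape 1 is the work tape, tape 2 the output. A state pairs a label with the
  word that is still to be written to the output before the label acts.\<close>

definition strs :: "word set" where
  "strs = insert u0 ((\<lambda>(l, a, b). fst (snd (\<delta> l a b))) ` (UNIV \<times> \<Gamma>0 \<times> \<Gamma>1))"

text \<open>States contain pending words, so only finitely many of these may occur if the transition
  set is to be finite.\<close>

definition pend :: "word set" where
  "pend = (\<Union>s\<in>strs. (\<lambda>i. drop i s) ` {..length s})"

text \<open>The third scanned symbol is the blank because the output head always stands on the first
  cell after the output. The label \<open>halt\<close> is excluded since no transition may leave the
  accepting state.\<close>

definition move_trans :: "transition set" where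
  "move_trans = (\<lambda>(l, a, b). case \<delta> l a b of (l', u, m, c, m') \<Rightarrow>
     ((to_nat (l, [] :: word), [a, b, 0]), (to_nat (l', u), [(a, m), (c, m'), (0, Stay)])))
     ` ((UNIV - {halt}) \<times> \<Gamma>0 \<times> \<Gamma>1)"

definition emit_trans :: "transition set" where
  "emit_trans = (\<lambda>(l :: 'l, u, a, b).
     ((to_nat (l, u), [a, b, 0]), (to_nat (l, tl u), [(a, Stay), (b, Stay), (hd u, Go_Right)])))
     ` (UNIV \<times> (pend - {[]}) \<times> \<Gamma>0 \<times> \<Gamma>1)"

definition tm :: tmachine where
  "tm = \<lparr>tapes = 3, start = to_nat (l0, u0), accept = to_nat (halt, [] :: word),
         transitions = move_trans \<union> emit_trans\<rparr>"

definition cfg :: "'l \<Rightarrow> word \<Rightarrow> word \<Rightarrow> int \<Rightarrow> (int \<Rightarrow> nat) \<Rightarrow> int \<Rightarrow> word \<Rightarrow> config" where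
  "cfg l u w i tp h out =
     (to_nat (l, u), [(word_tape w, i), (tp, h), (word_tape out, int (length out))])"

lemma finite_strs: "finite strs"
  unfolding strs_def using fin by simp

lemma finite_pend: "finite pend"
  unfolding pend_def using finite_strs by simp

lemma wf_tm: "wf_tmachine tm"
  unfolding wf_tmachine_def tm_def
  using finite_pend fin
  by (auto simp: move_trans_def emit_trans_def split: prod.splits)

text \<open>Moves act on an empty pending word and emissions on a nonempty one, so the two kinds
  never compete.\<close>

lemma deterministic_tm: "deterministic tm"
  unfolding deterministic_def tm_def single_valued_def
  by (auto simp: move_trans_def emit_trans_def split: prod.splits)

lemma pend_tl: "s # u \<in> pend \<Longrightarrow> u \<in> pend"
proof -
  assume "s # u \<in> pend"
  then obtain v i where v: "v \<in> strs" "i \<le> length v" "s # u = drop i v" by (auto simp: pend_def)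
  then have "u = drop (Suc i) v" by (metis drop_Suc list.sel(3) tl_drop)
  moreover have "Suc i \<le> length v" using v
    by (metis Suc_leI drop_all le_neq_implies_less length_0_conv list.distinct(1) order_refl)
  ultimately show ?thesis using v by (auto simp: pend_def)
qed

lemma strs_pend: "u \<in> strs \<Longrightarrow> u \<in> pend"
  unfolding pend_def by (auto intro!: bexI[of _ u] image_eqI[of _ _ 0])

lemma word_tape_snoc: "(word_tape out)(int (length out) := s) = word_tape (out @ [s])"
  by (auto simp: word_tape_def fun_eq_iff nth_append)

lemma word_tape_end: "word_tape out (int (length out)) = 0"
  by (simp add: word_tape_def)

lemma emit:
  assumes "u \<in> pend" "word_tape w i \<in> \<Gamma>0" "tp h \<in> \<Gamma>1"
  shows "(step tm ^^ length u) (cfg l u w i tp h out) (cfg l [] w i tp h (out @ u))"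
  using assms(1)
proof (induction u arbitrary: out)
  case Nil
  then show ?case by simp
next
  case (Cons s u)
  have "((to_nat (l, s # u), [word_tape w i, tp h, 0]),
      (to_nat (l, u), [(word_tape w i, Stay), (tp h, Stay), (s, Go_Right)])) \<in> emit_trans"
    unfolding emit_trans_def
    by (rule image_eqI[of _ _ "(l, s # u, word_tape w i, tp h)"]) (use Cons.prems assms in auto)
  then have "step tm (cfg l (s # u) w i tp h out) (cfg l u w i tp h (out @ [s]))"
    unfolding step_def cfg_def tm_def
    by (intro exI[of _ "[(word_tape w i, Stay), (tp h, Stay), (s, Go_Right)]"])
       (auto simp: scan_def act_def word_tape_end word_tape_snoc)
  moreover have "(step tm ^^ length u) (cfg l u w i tp h (out @ [s])) (cfg l [] w i tp h (out @ s # u))"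
    using Cons.IH[of "out @ [s]"] pend_tl[OF Cons.prems] by simp
  ultimately show ?case unfolding list.size(4) add_0_right add_Suc_right by (rule relpowp_Suc_I2)
qed

definition runs_to :: "nat \<Rightarrow> config \<Rightarrow> config \<Rightarrow> bool" where
  "runs_to t c c' \<longleftrightarrow> (\<exists>n\<le>t. (step tm ^^ n) c c')"

lemma runs_to_refl: "runs_to t c c"
  unfolding runs_to_def by (intro exI[of _ 0]) simp

lemma runs_to_trans: "runs_to s c c' \<Longrightarrow> runs_to t c' c'' \<Longrightarrow> runs_to (s + t) c c''"
  unfolding runs_to_def by (metis add_mono relpowp_trans)

lemma runs_to_mono: "runs_to s c c' \<Longrightarrow> s \<le> t \<Longrightarrow> runs_to t c c'"
  unfolding runs_to_def by (meson le_trans)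

text \<open>Bounds one application of the table: the word is written letter by letter, and
  \<open>Suc\<close> pays for the move itself.\<close>

definition cost :: nat where
  "cost = Suc (Max (length ` strs))"

lemma length_strs: "u \<in> strs \<Longrightarrow> length u < cost"
  unfolding cost_def using finite_strs by (simp add: le_imp_less_Suc)

lemma word_tape_in: "set w \<subseteq> \<Gamma>0 \<Longrightarrow> word_tape w i \<in> \<Gamma>0"
  using zero by (auto simp: word_tape_def)

lemma macro_step:
  assumes "l \<noteq> halt" "set w \<subseteq> \<Gamma>0" "range tp \<subseteq> \<Gamma>1" "c \<in> \<Gamma>1"
    and d: "\<delta> l (word_tape w i) (tp h) = (l', u, m, c, m')"
  shows "runs_to cost (cfg l [] w i tp h out)
    (cfg l' [] w (move_head m i) (tp(h := c)) (move_head m' h) (out @ u))"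
proof -
  have in0: "word_tape w j \<in> \<Gamma>0" for j using word_tape_in assms by blast
  have in1: "tp j \<in> \<Gamma>1" for j using assms by blast
  have u: "u \<in> strs" unfolding strs_def
    by (rule insertI2, rule image_eqI[of _ _ "(l, word_tape w i, tp h)"]) (use d in0 in1 in auto)
  have "((to_nat (l, [] :: word), [word_tape w i, tp h, 0]),
      (to_nat (l', u), [(word_tape w i, m), (c, m'), (0, Stay)])) \<in> move_trans"
    unfolding move_trans_def
    by (rule image_eqI[of _ _ "(l, word_tape w i, tp h)"]) (use d in0 in1 assms in auto)
  then have "step tm (cfg l [] w i tp h out)
      (cfg l' u w (move_head m i) (tp(h := c)) (move_head m' h) out)"
    unfolding step_def cfg_def tm_def
    by (intro exI[of _ "[(word_tape w i, m), (c, m'), (0, Stay)]"])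
       (use word_tape_end[of out] in \<open>auto simp: scan_def act_def fun_upd_idem\<close>)
  moreover have "(step tm ^^ length u) (cfg l' u w (move_head m i) (tp(h := c)) (move_head m' h) out)
     (cfg l' [] w (move_head m i) (tp(h := c)) (move_head m' h) (out @ u))"
    by (rule emit) (use u strs_pend in0 in1 assms in auto)
  ultimately have "(step tm ^^ Suc (length u)) (cfg l [] w i tp h out)
     (cfg l' [] w (move_head m i) (tp(h := c)) (move_head m' h) (out @ u))"
    by (rule relpowp_Suc_I2)
  then show ?thesis using length_strs[OF u] unfolding runs_to_def
    by (intro exI[of _ "Suc (length u)"]) auto
qed

lemma start_step:
  assumes "set w \<subseteq> \<Gamma>0"
  shows "runs_to cost (init tm w) (cfg l0 [] w 0 (word_tape []) 0 u0)"
proof -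
  have "u0 \<in> strs" by (simp add: strs_def)
  moreover have "init tm w = cfg l0 u0 w 0 (word_tape []) 0 []"
    by (simp add: init_def tm_def cfg_def eval_nat_numeral)
  moreover have "word_tape [] 0 \<in> \<Gamma>1" using zero by (simp add: word_tape_def)
  ultimately show ?thesis
    using emit[of u0 w 0 "word_tape []" 0 l0 "[]"] word_tape_in[OF assms] length_strs[of u0] strs_pend
    unfolding runs_to_def by (intro exI[of _ "length u0"]) auto
qed

lemma outputs_withinI:
  assumes "runs_to t (init tm w) (cfg halt [] w' i tp h out)"
  shows "outputs_within tm w t out"
  using assms unfolding runs_to_def outputs_within_def reaches_in_def
  by (force simp: cfg_def tm_def)

end

section \<open>A transducer that writes unary indices\<close>

datatype kind = Chain | Wrap | Disj
datatype label = Scan | Fwd kind | Bwd kind | Next | Halt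

instance kind :: countable by countable_datatype
instance label :: countable by countable_datatype

lemma UNIV_kind: "UNIV = {Chain, Wrap, Disj}"
  using kind.exhaust by auto

lemma UNIV_label: "UNIV = insert Scan (insert Next (insert Halt (range Fwd \<union> range Bwd)))"
  by (auto intro: label.exhaust)

instance kind :: finite by standard (simp add: UNIV_kind)
instance label :: finite by standard (subst UNIV_label, simp)

definition marks :: "nat set" where
  "marks = {0, 1}"

text \<open>The work tape holds an index in unary, as a block of 1s. A forward sweep over the block, followed
  by a backward sweep, writes the index to the output twice. The chain loop adds a mark on the right in
  every round, the final loop removes one on the left.\<close>

locale sweep =
  fixes \<Sigma> :: "nat set" and u0 :: word and opn :: "nat \<Rightarrow> word" and pre mid post :: "kind \<Rightarrow> word" and fin :: word
  assumes fin\<Sigma>: "finite \<Sigma>" and zero\<Sigma>: "0 \<notin> \<Sigma>"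
begin

text \<open>The kinds are the three shapes of input-dependent subformulas: links between cells, the
  closing atom, and the disjuncts for level 0. Each mentions an index twice.
  \<open>Fwd Chain\<close> turns round by adding a mark, so its backward sweep writes the next
  index; the other kinds turn without adding one. The letter 2 is the code of \<open>True\<close>,
  the letter that spells an index in \<open>nm\<close>.\<close>

fun dl :: "label \<Rightarrow> nat \<Rightarrow> nat \<Rightarrow> label \<times> word \<times> move \<times> nat \<times> move" where
  "dl Scan a b = (if a = 0 then (Fwd Wrap, pre Wrap, Stay, b, Stay) else (Fwd Chain, opn a, Stay, b, Stay))"
| "dl (Fwd k) a b = (if b = 1 then (Fwd k, [2], Stay, 1, Go_Right)
     else if k = Chain then (Bwd k, mid k, Stay, 1, Stay) else (Bwd k, mid k, Stay, 0, Go_Left))"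
| "dl (Bwd k) a b = (if b = 1 then (Bwd k, [2], Stay, 1, Go_Left)
     else case k of Chain \<Rightarrow> (Scan, post Chain, Go_Right, 0, Go_Right)
       | Wrap \<Rightarrow> (Fwd Disj, post Wrap @ pre Disj, Stay, 0, Go_Right)
       | Disj \<Rightarrow> (Next, post Disj, Stay, 0, Go_Right))"
| "dl Next a b = (if b = 1 then (Fwd Disj, pre Disj, Stay, 0, Go_Right) else (Halt, fin, Stay, 0, Stay))"
| "dl Halt a b = (Halt, [], Stay, 0, Stay)"

sublocale transducer Scan Halt u0 "insert 0 \<Sigma>" marks dl
  by standard (use fin\<Sigma> in \<open>auto simp: marks_def\<close>)

definition mk :: "int \<Rightarrow> int \<Rightarrow> int \<Rightarrow> nat" where
  "mk lo hi i = (if lo \<le> i \<and> i < hi then 1 else 0)"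

lemma range_mk: "range (mk lo hi) \<subseteq> marks"
  by (auto simp: mk_def marks_def)

lemma mstep:
  assumes "l \<noteq> Halt" "w \<in> lists \<Sigma>" "c \<in> marks"
    and "dl l (word_tape w i) (mk lo hi h) = (l', u, m, c, m')"
    and "(mk lo hi)(h := c) = tp'" "move_head m i = i'" "move_head m' h = h'" "out @ u = out'"
  shows "runs_to cost (cfg l [] w i (mk lo hi) h out) (cfg l' [] w i' tp' h' out')"
proof -
  have "set w \<subseteq> insert 0 \<Sigma>" using assms(2) by auto
  from macro_step[OF assms(1) this range_mk assms(3) assms(4), of out]
  show ?thesis unfolding assms(5-8) .
qed

lemma sweep_fwd:
  assumes "w \<in> lists \<Sigma>" "lo \<le> h" "h + int n = hi"
  shows "runs_to (n * cost) (cfg (Fwd k) [] w i (mk lo hi) h out)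
    (cfg (Fwd k) [] w i (mk lo hi) hi (out @ replicate n 2))"
  using assms(2-)
proof (induction n arbitrary: h out)
  case 0
  then show ?case by (simp add: runs_to_refl)
next
  case (Suc n)
  have "runs_to cost (cfg (Fwd k) [] w i (mk lo hi) h out) (cfg (Fwd k) [] w i (mk lo hi) (h + 1) (out @ [2]))"
    by (rule mstep[where c = 1 and u = "[2]" and m = Stay and m' = Go_Right]) (use Suc.prems assms in \<open>auto simp: mk_def marks_def fun_eq_iff\<close>)
  from runs_to_trans[OF this Suc.IH[of "h + 1" "out @ [2]"]] show ?case using Suc.prems by simp
qed

lemma sweep_bwd:
  assumes "w \<in> lists \<Sigma>" "h < hi" "h + 1 = lo + int n"
  shows "runs_to (n * cost) (cfg (Bwd k) [] w i (mk lo hi) h out)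
    (cfg (Bwd k) [] w i (mk lo hi) (lo - 1) (out @ replicate n 2))"
  using assms(2-)
proof (induction n arbitrary: h out)
  case 0
  then have "h = lo - 1" by simp
  then show ?case by (simp add: runs_to_refl)
next
  case (Suc n)
  have "runs_to cost (cfg (Bwd k) [] w i (mk lo hi) h out) (cfg (Bwd k) [] w i (mk lo hi) (h - 1) (out @ [2]))"
    by (rule mstep[where c = 1 and u = "[2]" and m = Stay and m' = Go_Left]) (use Suc.prems assms in \<open>auto simp: mk_def marks_def fun_eq_iff\<close>)
  from runs_to_trans[OF this Suc.IH[of "h - 1" "out @ [2]"]] show ?case using Suc.prems by simp
qed

definition chain_out :: "nat \<Rightarrow> nat \<Rightarrow> word" where
  "chain_out a i = opn a @ replicate i 2 @ mid Chain @ replicate (Suc i) 2 @ post Chain"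

definition kind_out :: "kind \<Rightarrow> nat \<Rightarrow> word" where
  "kind_out k n = pre k @ replicate n 2 @ mid k @ replicate n 2 @ post k"

lemma chain_step:
  assumes w: "w \<in> lists \<Sigma>" and i: "i < length w"
  shows "runs_to ((2 * i + 4) * cost) (cfg Scan [] w (int i) (mk 0 (int i)) 0 out)
    (cfg Scan [] w (int (Suc i)) (mk 0 (int (Suc i))) 0 (out @ chain_out (w ! i) i))"
proof -
  have "w ! i \<in> \<Sigma>" using w i by auto
  then have a: "word_tape w (int i) = w ! i" "w ! i \<noteq> 0" using zero\<Sigma> i by (auto simp: word_tape_def intro: gr0I)
  let ?o1 = "out @ opn (w ! i)"
  let ?o2 = "?o1 @ replicate i 2"
  let ?o3 = "?o2 @ mid Chain"
  let ?o4 = "?o3 @ replicate (Suc i) 2"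
  have 1: "runs_to cost (cfg Scan [] w (int i) (mk 0 (int i)) 0 out) (cfg (Fwd Chain) [] w (int i) (mk 0 (int i)) 0 ?o1)"
    by (rule mstep[where c = "mk 0 (int i) 0" and u = "opn (w ! i)" and m = Stay and m' = Stay]) (use w a in \<open>auto simp: mk_def marks_def fun_eq_iff\<close>)
  have 2: "runs_to (i * cost) (cfg (Fwd Chain) [] w (int i) (mk 0 (int i)) 0 ?o1) (cfg (Fwd Chain) [] w (int i) (mk 0 (int i)) (int i) ?o2)"
    by (rule sweep_fwd) (use w in auto)
  have 3: "runs_to cost (cfg (Fwd Chain) [] w (int i) (mk 0 (int i)) (int i) ?o2) (cfg (Bwd Chain) [] w (int i) (mk 0 (int (Suc i))) (int i) ?o3)"
    by (rule mstep[where c = 1 and u = "mid Chain" and m = Stay and m' = Stay]) (use w in \<open>auto simp: mk_def marks_def fun_eq_iff\<close>)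
  have 4: "runs_to (Suc i * cost) (cfg (Bwd Chain) [] w (int i) (mk 0 (int (Suc i))) (int i) ?o3) (cfg (Bwd Chain) [] w (int i) (mk 0 (int (Suc i))) (0 - 1) ?o4)"
    by (rule sweep_bwd) (use w in auto)
  have 5: "runs_to cost (cfg (Bwd Chain) [] w (int i) (mk 0 (int (Suc i))) (0 - 1) ?o4) (cfg Scan [] w (int (Suc i)) (mk 0 (int (Suc i))) 0 (?o4 @ post Chain))"
    by (rule mstep[where c = 0 and u = "post Chain" and m = Go_Right and m' = Go_Right]) (use w in \<open>auto simp: mk_def marks_def fun_eq_iff\<close>)
  from runs_to_trans[OF 1 runs_to_trans[OF 2 runs_to_trans[OF 3 runs_to_trans[OF 4 5]]]]
  have "runs_to ((2 * i + 4) * cost) (cfg Scan [] w (int i) (mk 0 (int i)) 0 out)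
    (cfg Scan [] w (int (Suc i)) (mk 0 (int (Suc i))) 0 (?o4 @ post Chain))"
    by (rule runs_to_mono) (simp add: algebra_simps)
  then show ?thesis by (simp add: chain_out_def)
qed

lemma chain_loop:
  assumes w: "w \<in> lists \<Sigma>" and "n \<le> length w"
  shows "runs_to (n * (2 * n + 4) * cost) (cfg Scan [] w 0 (mk 0 0) 0 out)
    (cfg Scan [] w (int n) (mk 0 (int n)) 0 (out @ concat (map (\<lambda>i. chain_out (w ! i) i) [0..<n])))"
  using assms(2)
proof (induction n)
  case 0
  then show ?case by (simp add: runs_to_refl)
next
  case (Suc n)
  then have "runs_to (n * (2 * n + 4) * cost) (cfg Scan [] w 0 (mk 0 0) 0 out)
    (cfg Scan [] w (int n) (mk 0 (int n)) 0 (out @ concat (map (\<lambda>i. chain_out (w ! i) i) [0..<n])))" by simp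
  from runs_to_trans[OF this chain_step[OF w]] Suc.prems
  have "runs_to (n * (2 * n + 4) * cost + (2 * n + 4) * cost) (cfg Scan [] w 0 (mk 0 0) 0 out)
    (cfg Scan [] w (int (Suc n)) (mk 0 (int (Suc n))) 0 (out @ concat (map (\<lambda>i. chain_out (w ! i) i) [0..<Suc n])))"
    by simp
  then show ?case by (rule runs_to_mono) (simp add: algebra_simps)
qed

lemma kind_sweep:
  assumes w: "w \<in> lists \<Sigma>" and k: "k \<noteq> Chain" and h: "lo + int n = hi"
  shows "runs_to ((2 * n + 1) * cost) (cfg (Fwd k) [] w i (mk lo hi) lo out)
    (cfg (Bwd k) [] w i (mk lo hi) (lo - 1) (out @ replicate n 2 @ mid k @ replicate n 2))"
proof -
  let ?o2 = "out @ replicate n 2"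
  let ?o3 = "?o2 @ mid k"
  have 1: "runs_to (n * cost) (cfg (Fwd k) [] w i (mk lo hi) lo out) (cfg (Fwd k) [] w i (mk lo hi) hi ?o2)"
    by (rule sweep_fwd) (use w h in auto)
  have 2: "runs_to cost (cfg (Fwd k) [] w i (mk lo hi) hi ?o2) (cfg (Bwd k) [] w i (mk lo hi) (hi - 1) ?o3)"
    by (rule mstep[where c = 0 and u = "mid k" and m = Stay and m' = Go_Left]) (use w k in \<open>auto simp: mk_def marks_def fun_eq_iff\<close>)
  have 3: "runs_to (n * cost) (cfg (Bwd k) [] w i (mk lo hi) (hi - 1) ?o3) (cfg (Bwd k) [] w i (mk lo hi) (lo - 1) (?o3 @ replicate n 2))"
    by (rule sweep_bwd) (use w h in auto)
  from runs_to_trans[OF 1 runs_to_trans[OF 2 3]]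
  have "runs_to ((2 * n + 1) * cost) (cfg (Fwd k) [] w i (mk lo hi) lo out)
    (cfg (Bwd k) [] w i (mk lo hi) (lo - 1) (?o3 @ replicate n 2))"
    by (rule runs_to_mono) (simp add: algebra_simps)
  then show ?thesis by simp
qed

text \<open>Induction on the length of the block: each round erases the leftmost mark while the
  right end stays, so the indices come out in decreasing order. This is why \<open>matrix\<close>
  lists the disjuncts in reverse. The first \<open>pre Disj\<close> is already written because the
  transition that enters the round emits it.\<close>

lemma disj_loop:
  assumes w: "w \<in> lists \<Sigma>" and "lo + int n = hi"
  shows "runs_to ((n + 1) * (2 * n + 4) * cost) (cfg (Fwd Disj) [] w i (mk lo hi) lo (out @ pre Disj))
    (cfg Halt [] w i (mk hi hi) hi (out @ concat (map (kind_out Disj) (rev [0..<Suc n])) @ fin))"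
  using assms(2)
proof (induction n arbitrary: lo out)
  case 0
  let ?o = "out @ pre Disj @ mid Disj"
  have 1: "runs_to cost (cfg (Fwd Disj) [] w i (mk lo hi) lo (out @ pre Disj)) (cfg (Bwd Disj) [] w i (mk lo hi) (lo - 1) ?o)"
    using kind_sweep[OF w, of Disj lo 0 hi i "out @ pre Disj"] 0 by simp
  have 2: "runs_to cost (cfg (Bwd Disj) [] w i (mk lo hi) (lo - 1) ?o) (cfg Next [] w i (mk lo hi) lo (?o @ post Disj))"
    by (rule mstep[where c = 0 and u = "post Disj" and m = Stay and m' = Go_Right]) (use w in \<open>auto simp: mk_def marks_def fun_eq_iff\<close>)
  have 3: "runs_to cost (cfg Next [] w i (mk lo hi) lo (?o @ post Disj)) (cfg Halt [] w i (mk hi hi) hi ((?o @ post Disj) @ fin))"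
    by (rule mstep[where c = 0 and u = "fin" and m = Stay and m' = Stay]) (use w 0 in \<open>auto simp: mk_def marks_def fun_eq_iff\<close>)
  have eq: "(?o @ post Disj) @ fin = out @ concat (map (kind_out Disj) (rev [0..<Suc 0])) @ fin"
    by (simp add: kind_out_def)
  from runs_to_trans[OF 1 runs_to_trans[OF 2 3]]
  show ?case unfolding eq by (rule runs_to_mono) simp
next
  case (Suc n)
  let ?o = "out @ pre Disj @ replicate (Suc n) 2 @ mid Disj @ replicate (Suc n) 2"
  have 1: "runs_to ((2 * Suc n + 1) * cost) (cfg (Fwd Disj) [] w i (mk lo hi) lo (out @ pre Disj)) (cfg (Bwd Disj) [] w i (mk lo hi) (lo - 1) ?o)"
    using kind_sweep[OF w, of Disj lo "Suc n" hi i "out @ pre Disj"] Suc.prems by simp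
  have 2: "runs_to cost (cfg (Bwd Disj) [] w i (mk lo hi) (lo - 1) ?o) (cfg Next [] w i (mk lo hi) lo (?o @ post Disj))"
    by (rule mstep[where c = 0 and u = "post Disj" and m = Stay and m' = Go_Right]) (use w in \<open>auto simp: mk_def marks_def fun_eq_iff\<close>)
  have 3: "runs_to cost (cfg Next [] w i (mk lo hi) lo (?o @ post Disj)) (cfg (Fwd Disj) [] w i (mk (lo + 1) hi) (lo + 1) ((?o @ post Disj) @ pre Disj))"
    by (rule mstep[where c = 0 and u = "pre Disj" and m = Stay and m' = Go_Right]) (use w Suc.prems in \<open>auto simp: mk_def marks_def fun_eq_iff\<close>)
  have 4: "runs_to ((n + 1) * (2 * n + 4) * cost) (cfg (Fwd Disj) [] w i (mk (lo + 1) hi) (lo + 1) ((?o @ post Disj) @ pre Disj))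
    (cfg Halt [] w i (mk hi hi) hi ((?o @ post Disj) @ concat (map (kind_out Disj) (rev [0..<Suc n])) @ fin))"
    by (rule Suc.IH) (use Suc.prems in simp)
  have eq: "(?o @ post Disj) @ concat (map (kind_out Disj) (rev [0..<Suc n])) @ fin =
     out @ concat (map (kind_out Disj) (rev [0..<Suc (Suc n)])) @ fin"
    by (simp add: kind_out_def)
  from runs_to_trans[OF 1 runs_to_trans[OF 2 runs_to_trans[OF 3 4]]]
  show ?case unfolding eq by (rule runs_to_mono) (simp add: algebra_simps)
qed

definition sweep_word :: "word \<Rightarrow> word" where
  "sweep_word w = u0 @ concat (map (\<lambda>i. chain_out (w ! i) i) [0..<length w]) @ kind_out Wrap (length w)
     @ concat (map (kind_out Disj) (rev [0..<Suc (length w)])) @ fin"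

text \<open>For input length n the two loops take at most (2n + 1)(2n + 4) macro steps and the rest
  2n + 4, which together give the stated polynomial.\<close>

lemma sweep_output:
  assumes w: "w \<in> lists \<Sigma>"
  shows "outputs_within tm w (poly ([:cost:] * [:4, 4:] * [:4, 2:]) (length w)) (sweep_word w)"
proof -
  define n where "n = length w"
  define o1 where "o1 = u0 @ concat (map (\<lambda>i. chain_out (w ! i) i) [0..<n])"
  let ?o2 = "o1 @ pre Wrap"
  let ?o3 = "?o2 @ replicate n 2 @ mid Wrap @ replicate n 2"
  let ?o4 = "(o1 @ kind_out Wrap n) @ pre Disj"
  have mk0: "word_tape [] = mk 0 0" by (simp add: word_tape_def mk_def fun_eq_iff)
  have wn: "word_tape w (int n) = 0" by (simp add: word_tape_def n_def)
  have 0: "runs_to cost (init tm w) (cfg Scan [] w 0 (mk 0 0) 0 u0)"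
    using start_step[of w] w mk0 by (metis in_listsD insertCI subsetI)
  have 1: "runs_to (n * (2 * n + 4) * cost) (cfg Scan [] w 0 (mk 0 0) 0 u0) (cfg Scan [] w (int n) (mk 0 (int n)) 0 o1)"
    using chain_loop[OF w, of n u0] by (simp add: n_def o1_def)
  have 2: "runs_to cost (cfg Scan [] w (int n) (mk 0 (int n)) 0 o1) (cfg (Fwd Wrap) [] w (int n) (mk 0 (int n)) 0 ?o2)"
    by (rule mstep[where c = "mk 0 (int n) 0" and u = "pre Wrap" and m = Stay and m' = Stay]) (use w wn in \<open>auto simp: mk_def marks_def fun_eq_iff\<close>)
  have 3: "runs_to ((2 * n + 1) * cost) (cfg (Fwd Wrap) [] w (int n) (mk 0 (int n)) 0 ?o2) (cfg (Bwd Wrap) [] w (int n) (mk 0 (int n)) (0 - 1) ?o3)"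
    by (rule kind_sweep) (use w in auto)
  have 4: "runs_to cost (cfg (Bwd Wrap) [] w (int n) (mk 0 (int n)) (0 - 1) ?o3) (cfg (Fwd Disj) [] w (int n) (mk 0 (int n)) 0 ?o4)"
    by (rule mstep[where c = 0 and u = "post Wrap @ pre Disj" and m = Stay and m' = Go_Right]) (use w in \<open>auto simp: mk_def marks_def fun_eq_iff kind_out_def\<close>)
  have 5: "runs_to ((n + 1) * (2 * n + 4) * cost) (cfg (Fwd Disj) [] w (int n) (mk 0 (int n)) 0 ?o4)
    (cfg Halt [] w (int n) (mk (int n) (int n)) (int n) ((o1 @ kind_out Wrap n) @ concat (map (kind_out Disj) (rev [0..<Suc n])) @ fin))"
    by (rule disj_loop) (use w in auto)
  have eq: "(o1 @ kind_out Wrap n) @ concat (map (kind_out Disj) (rev [0..<Suc n])) @ fin = sweep_word w"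
    by (simp add: o1_def n_def sweep_word_def)
  have "runs_to (poly ([:cost:] * [:4, 4:] * [:4, 2:]) n) (init tm w) (cfg Halt [] w (int n) (mk (int n) (int n)) (int n) (sweep_word w))"
    using runs_to_trans[OF 0 runs_to_trans[OF 1 runs_to_trans[OF 2 runs_to_trans[OF 3 runs_to_trans[OF 4 5]]]]]
    unfolding eq by (rule runs_to_mono) (simp add: algebra_simps)
  then show ?thesis unfolding n_def by (rule outputs_withinI)
qed

lemma polytime_sweep_word: "polytime_on (lists \<Sigma>) sweep_word"
  unfolding polytime_on_def using wf_tm deterministic_tm sweep_output by blast

end

section \<open>The sentence of an input word\<close>

text \<open>A name codes a tag and an index, both in unary. The index stands last, where the
  transducer can write it as a run of one letter.\<close>

definition nm :: "nat \<Rightarrow> nat \<Rightarrow> name" where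
  "nm i j = replicate i True @ False # replicate j True"

definition nm_tag :: "name \<Rightarrow> nat" where
  "nm_tag x = length (takeWhile id x)"

definition nm_idx :: "name \<Rightarrow> nat" where
  "nm_idx x = length x - Suc (nm_tag x)"

lemma nm_tag_nm [simp]: "nm_tag (nm i j) = i"
  by (simp add: nm_tag_def nm_def takeWhile_append)

lemma nm_idx_nm [simp]: "nm_idx (nm i j) = j"
  unfolding nm_idx_def nm_tag_nm by (simp add: nm_def)

lemma nm_inject [simp]: "nm i j = nm i' j' \<longleftrightarrow> i = i' \<and> j = j'"
  by (metis nm_tag_nm nm_idx_nm)

type_synonym sequent = "atm list \<times> atm list"

text \<open>Falsity and truth have to be built from an atom. One without variables satisfies the
  variable condition of every part of a GBSR partition.\<close>

definition FF :: fm where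
  "FF = Neg (Atom (Eq (Fun (nm 0 0) []) (Fun (nm 0 0) [])))"

definition TT :: fm where
  "TT = Atom (Eq (Fun (nm 0 0) []) (Fun (nm 0 0) []))"

fun seq_fm :: "sequent \<Rightarrow> fm" where
  "seq_fm (ps, qs) = foldr (\<lambda>a. Or (Neg (Atom a))) ps (foldr (\<lambda>a. Or (Atom a)) qs FF)"

definition seqs_fm :: "sequent list \<Rightarrow> fm" where
  "seqs_fm sqs = foldr (\<lambda>s. And (seq_fm s)) sqs TT"

fun sat :: "'u fo_structure \<Rightarrow> (name \<Rightarrow> 'u) \<Rightarrow> sequent \<Rightarrow> bool" where
  "sat S e (ps, qs) \<longleftrightarrow> ((\<forall>p\<in>set ps. holds_atm S e p) \<longrightarrow> (\<exists>q\<in>set qs. holds_atm S e q))"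

lemma holds_TT [simp]: "holds S e TT"
  by (simp add: TT_def)

lemma holds_FF [simp]: "\<not> holds S e FF"
  by (simp add: FF_def)

lemma holds_seq_fm: "holds S e (seq_fm s) \<longleftrightarrow> sat S e s"
proof (cases s)
  case (Pair ps qs)
  have "holds S e (foldr (\<lambda>a. Or (Atom a)) qs FF) \<longleftrightarrow> (\<exists>q\<in>set qs. holds_atm S e q)"
    by (induction qs) auto
  then have "holds S e (seq_fm (ps, qs)) \<longleftrightarrow> sat S e (ps, qs)"
    by (induction ps) auto
  then show ?thesis using Pair by simp
qed

lemma holds_seqs_fm: "holds S e (seqs_fm sqs) \<longleftrightarrow> (\<forall>s\<in>set sqs. sat S e s)"
  by (induction sqs) (auto simp: seqs_fm_def holds_seq_fm)

section \<open>Vocabulary and axioms\<close>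

abbreviation "v i \<equiv> Var (nm 0 i)"
abbreviation "vx l \<equiv> Var (nm 1 l)"
abbreviation "vy l \<equiv> Var (nm 2 l)"
abbreviation "vs l \<equiv> Var (nm 3 l)"

abbreviation "cell i \<equiv> Fun (nm 0 i) []"
abbreviation "zc l \<equiv> Fun (nm 1 l) []"
abbreviation "midc \<equiv> Fun (nm 2 0) []"

abbreviation "pL l x \<equiv> Pred (nm 0 l) [x]"
abbreviation "pJ x b \<equiv> Pred (nm 1 0) [x, b]"
abbreviation "pG x b \<equiv> Pred (nm 1 1) [x, b]"
abbreviation "pS x y \<equiv> Pred (nm 1 2) [x, y]"
abbreviation "pD x y b \<equiv> Pred (nm 1 3) [x, y, b]"
abbreviation "pF x y b \<equiv> Pred (nm 1 4) [x, y, b]"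
abbreviation "pLt x y \<equiv> Pred (nm 1 5) [x, y]"
abbreviation "pW x y \<equiv> Pred (nm 1 6) [x, y]"
abbreviation "pA b x \<equiv> Pred (nm 1 7) [b, x]"
abbreviation "pEr x \<equiv> Pred (nm 1 8) [x]"
abbreviation "pEl x \<equiv> Pred (nm 1 9) [x]"
abbreviation "pI a x y \<equiv> Pred (nm 2 a) [x, y]"
abbreviation "pQ q t \<equiv> Pred (nm 3 q) [t]"
abbreviation "pR r t \<equiv> Pred (nm 4 r) [t]"
abbreviation "pH j t x \<equiv> Pred (nm 5 j) [t, x]"
abbreviation "pC j a t x \<equiv> Pred (nm (6 + j) a) [t, x]"

text \<open>Intended meaning. The elements of level 0 (\<open>pL 0\<close>) are \<open>cell 0, \<dots>, cell (length w)\<close>; an element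
  of level \<open>l + 1\<close> is a number whose bit at a level \<open>l\<close> position \<open>b\<close> is given by \<open>pJ\<close>, and \<open>zc l\<close> is
  the zero of level \<open>l\<close>. \<open>pS\<close> is the cyclic successor on each level and \<open>pG x\<close> gives the bits of the
  successor of \<open>x\<close>. \<open>pD x y b\<close> says that \<open>x\<close> and \<open>y\<close> agree on all bits up to \<open>b\<close>; \<open>pF x y b\<close> says this of
  the successor of \<open>x\<close> and of \<open>y\<close>.

  \<open>pI a\<close> links consecutive cells, the first of which carries the input letter \<open>a\<close>, and \<open>pW\<close> marks the
  last cell. Elements of the top level serve both as times and as tape positions: \<open>pQ q t\<close> (state),
  \<open>pR r t\<close> (transition taken), \<open>pH j t x\<close> (head of tape \<open>j\<close>) and \<open>pC j a t x\<close> (symbol on tape \<open>j\<close>).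
  \<open>pA b x\<close> places cell \<open>b\<close> at position \<open>x\<close>, starting from \<open>midc\<close>; \<open>pEr\<close> and \<open>pEl\<close> are the blank parts of
  the input tape to the right and to the left of the input; \<open>pLt\<close> orders the positions.\<close>

definition base_axs :: "sequent list" where
  "base_axs = [
    ([pS (v 0) (v 1), pS (v 0) (v 2)], [Eq (v 1) (v 2)]),
    ([pS (v 0) (v 2), pS (v 1) (v 2)], [Eq (v 0) (v 1)]),
    ([pW (v 0) (v 1)], [pS (v 0) (cell 0)]),
    ([pW (v 0) (v 1)], [pL 0 (v 0)]),
    ([pW (v 0) (v 1)], [pL 0 (cell 0)]),
    ([pS (v 2) (v 3), pD (v 0) (v 1) (v 2), pJ (v 0) (v 3), pJ (v 1) (v 3)], [pD (v 0) (v 1) (v 3)]),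
    ([pS (v 2) (v 3), pD (v 0) (v 1) (v 2)], [pJ (v 0) (v 3), pJ (v 1) (v 3), pD (v 0) (v 1) (v 3)]),
    ([pS (v 2) (v 3), pF (v 0) (v 1) (v 2), pG (v 0) (v 3), pJ (v 1) (v 3)], [pF (v 0) (v 1) (v 3)]),
    ([pS (v 2) (v 3), pF (v 0) (v 1) (v 2)], [pG (v 0) (v 3), pJ (v 1) (v 3), pF (v 0) (v 1) (v 3)])]"

definition letter_axs :: "nat \<Rightarrow> sequent list" where
  "letter_axs a = [
    ([pI a (v 0) (v 1)], [pS (v 0) (v 1)]),
    ([pI a (v 0) (v 1)], [pL 0 (v 0)]),
    ([pI a (v 0) (v 1)], [pL 0 (v 1)])]"

text \<open>\<open>pD\<close> and \<open>pF\<close> are only forced upwards: agreement at zero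
  starts a scan, \<open>base_axs\<close> carry it along \<open>pS\<close>, and a scan that has
  arrived at the predecessor of zero yields equality or successorship. Agreement of two bits takes
  two sequents, one for both set and one for both unset.\<close>

definition level_axs :: "nat \<Rightarrow> sequent list" where
  "level_axs l = [
    ([pJ (v 0) (zc l), pJ (v 1) (zc l)], [pD (v 0) (v 1) (zc l)]),
    ([], [pJ (v 0) (zc l), pJ (v 1) (zc l), pD (v 0) (v 1) (zc l)]),
    ([pS (v 2) (zc l), pD (v 0) (v 1) (v 2), pL (Suc l) (v 0), pL (Suc l) (v 1)], [Eq (v 0) (v 1)]),
    ([pG (v 0) (zc l), pJ (v 1) (zc l)], [pF (v 0) (v 1) (zc l)]),
    ([], [pG (v 0) (zc l), pJ (v 1) (zc l), pF (v 0) (v 1) (zc l)]),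
    ([pS (v 2) (zc l), pF (v 0) (v 1) (v 2), pL (Suc l) (v 0), pL (Suc l) (v 1)], [pS (v 0) (v 1)])]"

definition sort_axs :: "nat \<Rightarrow> sequent list" where
  "sort_axs l = [([], [pL l (zc l)]), ([pL l (vx l)], [pL l (vy l)]), ([pL l (vx l)], [pL l (vs l)])]"

text \<open>The existential variables answer the universal ones: \<open>vy l\<close> must be a copy of \<open>vx l\<close> and \<open>vs l\<close> its
  successor. Both are pinned down bit by bit, the bit positions being compared one level below.\<close>

definition game_axs :: "nat \<Rightarrow> sequent list" where
  "game_axs l = (let gd = [pL (Suc l) (vx (Suc l)), pL l (vx l)] in [
    (pJ (vx (Suc l)) (vx l) # gd, [pJ (vy (Suc l)) (vy l)]),
    (pJ (vy (Suc l)) (vy l) # gd, [pJ (vx (Suc l)) (vx l)]),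
    (pG (vx (Suc l)) (vx l) # gd, [pJ (vs (Suc l)) (vy l)]),
    (pJ (vs (Suc l)) (vy l) # gd, [pG (vx (Suc l)) (vx l)])])"

locale simulation =
  fixes M :: tmachine and K :: nat and ts :: "transition list" and Gs Qs :: "nat list"
begin

abbreviation "zK \<equiv> zc K"

text \<open>The order rules out cycles of \<open>pS\<close> on the top level that avoid \<open>zK\<close>, so that a head moving
  through positions without crossing \<open>zK\<close> never returns to the same one.\<close>

definition order_axs :: "sequent list" where
  "order_axs = [
    ([pS (v 0) (v 1), pL K (v 0)], [Eq (v 1) zK, pLt (v 0) (v 1)]),
    ([pLt (v 0) (v 1), pLt (v 1) (v 2)], [pLt (v 0) (v 2)]),
    ([pLt (v 0) (v 0)], [])]"

text \<open>The second sequent keeps the input from running over \<open>zK\<close>, the point where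
  the cyclic chain of positions is cut open.\<close>

definition input_axs :: "nat \<Rightarrow> sequent list" where
  "input_axs a = [
    ([pA (v 0) (v 1), pI a (v 0) (v 2), pS (v 1) (v 3)], [pA (v 2) (v 3)]),
    ([pA (v 0) (v 1), pI a (v 0) (v 2), pS (v 1) (v 3), Eq (v 3) zK], []),
    ([pA (v 0) (v 1), pI a (v 0) (v 2)], [pC 0 a zK (v 1)])]"

text \<open>The last cell carries no letter, so its position is the first blank after the input.
  Both blank parts stop at \<open>zK\<close>; otherwise they would go round the cycle and reach the
  input from the other side.\<close>

definition blank_axs :: "sequent list" where
  "blank_axs = [
    ([], [pA (cell 0) midc]),
    ([pA (v 0) (v 1), pW (v 0) (v 0)], [pEr (v 1)]),
    ([pEr (v 0)], [pC 0 0 zK (v 0)]),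
    ([pEr (v 0), pS (v 0) (v 1)], [Eq (v 1) zK, pEr (v 1)]),
    ([pS (v 0) midc], [Eq midc zK, pEl (v 0)]),
    ([pEl (v 0)], [pC 0 0 zK (v 0)]),
    ([pEl (v 0), pS (v 1) (v 0)], [Eq (v 0) zK, pEl (v 1)])]"

text \<open>The last sequent is what makes a shown run continue until it accepts. In the intended
  model it survives after the end of the run because the accepting configuration is then repeated
  forever.\<close>

definition start_axs :: "sequent list" where
  "start_axs = [
    ([], [pQ (start M) zK]),
    ([], [pL K midc]),
    ([pL K (v 0)], pQ (accept M) (v 0) # map (\<lambda>r. pR r (v 0)) [0..<length ts])]"

definition tape_axs :: "nat \<Rightarrow> sequent list" where
  "tape_axs j = [
    ([], [pH j zK midc]),
    ([pH j (v 0) (v 1), pH j (v 0) (v 2)], [Eq (v 1) (v 2)])]"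

definition empty_tape_ax :: "nat \<Rightarrow> sequent" where
  "empty_tape_ax j = ([pL K (v 0)], [pC j 0 zK (v 0)])"

definition state_ax :: "nat \<times> nat \<Rightarrow> sequent" where
  "state_ax = (\<lambda>(q, q'). ([pQ q (v 0), pQ q' (v 0)], []))"

definition symbol_ax :: "nat \<Rightarrow> nat \<times> nat \<Rightarrow> sequent" where
  "symbol_ax j = (\<lambda>(a, b). ([pC j a (v 0) (v 1), pC j b (v 0) (v 1)], []))"

definition distinct_pairs :: "nat list \<Rightarrow> (nat \<times> nat) list" where
  "distinct_pairs xs = filter (\<lambda>(a, b). a \<noteq> b) (List.product xs xs)"

text \<open>The sequents with empty succedent forbid a head to cross the cut at \<open>zK\<close>: a
  move to the right may not arrive there, a move to the left may not start there.\<close>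

fun move_axs :: "nat \<Rightarrow> nat \<Rightarrow> move \<Rightarrow> sequent list" where
  "move_axs r j Stay = [
    ([pR r (v 0), pS (v 0) (v 1), pH j (v 0) (v 2)], [pH j (v 1) (v 2)])]"
| "move_axs r j Go_Right = [
    ([pR r (v 0), pS (v 0) (v 1), pH j (v 0) (v 2), pS (v 2) (v 3)], [pH j (v 1) (v 3)]),
    ([pR r (v 0), pH j (v 0) (v 2), pS (v 2) (v 3), Eq (v 3) zK], [])]"
| "move_axs r j Go_Left = [
    ([pR r (v 0), pS (v 0) (v 1), pH j (v 0) (v 2), pS (v 3) (v 2)], [pH j (v 1) (v 3)]),
    ([pR r (v 0), pH j (v 0) (v 2), Eq (v 2) zK], [])]"

text \<open>The last group is the frame condition, one sequent per symbol: a symbol persists unless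
  the head is on its cell.\<close>

definition head_axs :: "nat \<Rightarrow> nat \<Rightarrow> nat \<Rightarrow> nat \<times> move \<Rightarrow> sequent list" where
  "head_axs r j a b = [
    ([pR r (v 0), pH j (v 0) (v 2)], [pC j a (v 0) (v 2)]),
    ([pR r (v 0), pS (v 0) (v 1), pH j (v 0) (v 2)], [pC j (fst b) (v 1) (v 2)])] @ move_axs r j (snd b) @
    map (\<lambda>a'. ([pR r (v 0), pS (v 0) (v 1), pC j a' (v 0) (v 2)], [pH j (v 0) (v 2), pC j a' (v 1) (v 2)])) Gs"

definition state_axs :: "nat \<Rightarrow> sequent list" where
  "state_axs r = [
    ([pR r (v 0)], [pQ (fst (fst (ts ! r))) (v 0)]),
    ([pR r (v 0), pS (v 0) (v 1)], [pQ (fst (snd (ts ! r))) (v 1)])]"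

definition trans_axs :: "nat \<Rightarrow> sequent list" where
  "trans_axs r = state_axs r @
    concat (map (\<lambda>j. head_axs r j (snd (fst (ts ! r)) ! j) (snd (snd (ts ! r)) ! j)) [0..<tapes M])"

definition axs :: "sequent list" where
  "axs = base_axs @ order_axs @ blank_axs @ start_axs @ concat (map letter_axs Gs)
    @ concat (map input_axs Gs) @ concat (map sort_axs [0..<Suc K]) @ concat (map level_axs [0..<K])
    @ concat (map game_axs [0..<K]) @ concat (map tape_axs [0..<tapes M])
    @ map empty_tape_ax [1..<tapes M] @ map state_ax (distinct_pairs Qs)
    @ concat (map (\<lambda>j. map (symbol_ax j) (distinct_pairs Gs)) [0..<tapes M])
    @ concat (map trans_axs [0..<length ts])"

section \<open>Matrix and quantifier prefix\<close>

definition chain_fm :: "nat \<Rightarrow> nat \<Rightarrow> fm" where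
  "chain_fm a i = Atom (pI a (cell i) (cell (Suc i)))"

text \<open>The atom \<open>Eq (vx 0) (vy 0)\<close> would mix universal and existential variables.
  Comparing each side with the same constant avoids this, at the price of one disjunct per
  cell.\<close>

definition same_fm :: "nat \<Rightarrow> fm" where
  "same_fm i = And (Atom (Eq (vx 0) (cell i))) (Atom (Eq (vy 0) (cell i)))"

text \<open>The conjuncts stand in the order in which the transducer writes them. Everything from
  the final negated atom on is independent of the input.\<close>

definition matrix :: "word \<Rightarrow> fm" where
  "matrix w = foldr (\<lambda>i. And (chain_fm (w ! i) i)) [0..<length w]
    (And (Atom (pW (cell (length w)) (cell (length w))))
      (And (foldr (\<lambda>i. Or (same_fm i)) (rev [0..<Suc (length w)]) (Neg (Atom (pL 0 (vx 0)))))
        (seqs_fm axs)))"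

text \<open>Higher levels come first: the answers on level l + 1 are fixed before the bit position
  on level l is chosen.\<close>

definition blks :: "nat \<Rightarrow> blocks" where
  "blks n = map (\<lambda>l. ([nm 1 l], [nm 2 l, nm 3 l])) (rev [0..<n])"

definition prefix :: blocks where
  "prefix = (map (nm 0) [0..<4] @ [nm 1 K], [nm 2 K, nm 3 K]) # blks K"

definition sentence :: "word \<Rightarrow> fm" where
  "sentence w = close_prefix prefix (matrix w)"

section \<open>Membership in GBSR\<close>

definition XS :: "name set" where
  "XS = nm 0 ` {..<4} \<union> nm 1 ` {..K}"

definition YS :: "name set" where
  "YS = nm 2 ` {..K} \<union> nm 3 ` {..K}"

definition separated :: "atm \<Rightarrow> bool" where
  "separated a \<longleftrightarrow> constants_only_atm a \<and> (atm_vars a \<subseteq> XS \<or> atm_vars a \<subseteq> YS)"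

lemma atoms_seq_fm: "atoms (seq_fm (ps, qs)) = set ps \<union> set qs \<union> {Eq (cell 0) (cell 0)}"
proof -
  have "atoms (foldr (\<lambda>a. Or (Atom a)) qs FF) = set qs \<union> {Eq (cell 0) (cell 0)}"
    by (induction qs) (auto simp: FF_def)
  then show ?thesis by (induction ps) auto
qed

lemma atoms_seqs_fm:
  "atoms (seqs_fm sqs) = (\<Union>s\<in>set sqs. set (fst s) \<union> set (snd s)) \<union> {Eq (cell 0) (cell 0)}"
proof (induction sqs)
  case (Cons s sqs)
  then show ?case by (cases s) (auto simp: seqs_fm_def atoms_seq_fm simp del: seq_fm.simps)
qed (simp add: seqs_fm_def TT_def)

lemma atoms_foldr_And: "atoms (foldr (\<lambda>i. And (f i)) xs \<phi>) = (\<Union>i\<in>set xs. atoms (f i)) \<union> atoms \<phi>"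
  by (induction xs) auto

lemma atoms_foldr_Or: "atoms (foldr (\<lambda>i. Or (f i)) xs \<phi>) = (\<Union>i\<in>set xs. atoms (f i)) \<union> atoms \<phi>"
  by (induction xs) auto

lemma nnf_foldr_And: "nnf_matrix (foldr (\<lambda>i. And (f i)) xs \<phi>) \<longleftrightarrow> (\<forall>i\<in>set xs. nnf_matrix (f i)) \<and> nnf_matrix \<phi>"
  by (induction xs) auto

lemma nnf_foldr_Or: "nnf_matrix (foldr (\<lambda>i. Or (f i)) xs \<phi>) \<longleftrightarrow> (\<forall>i\<in>set xs. nnf_matrix (f i)) \<and> nnf_matrix \<phi>"
  by (induction xs) auto

lemma nnf_seq_fm: "nnf_matrix (seq_fm s)"
  by (cases s) (simp add: nnf_foldr_Or FF_def)

lemma nnf_matrix_matrix: "nnf_matrix (matrix w)"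
  unfolding matrix_def seqs_fm_def
  by (simp add: nnf_foldr_And nnf_foldr_Or nnf_seq_fm chain_fm_def same_fm_def TT_def)

lemma XS_simps: "nm 0 0 \<in> XS" "nm 0 (Suc 0) \<in> XS" "nm 0 2 \<in> XS" "nm 0 3 \<in> XS"
  "nm 1 l \<in> XS \<longleftrightarrow> l \<le> K" "nm (Suc 0) l \<in> XS \<longleftrightarrow> l \<le> K"
  by (auto simp: XS_def)

lemma YS_simps: "nm 2 l \<in> YS \<longleftrightarrow> l \<le> K" "nm 3 l \<in> YS \<longleftrightarrow> l \<le> K"
  by (auto simp: YS_def)

lemma separated_move_axs: "s \<in> set (move_axs r j m) \<Longrightarrow> a \<in> set (fst s) \<union> set (snd s) \<Longrightarrow> separated a"
  by (cases m) (auto simp: separated_def XS_simps)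

lemma separated_trans_axs: "s \<in> set (trans_axs r) \<Longrightarrow> a \<in> set (fst s) \<union> set (snd s) \<Longrightarrow> separated a"
proof -
  assume s: "s \<in> set (trans_axs r)" and a: "a \<in> set (fst s) \<union> set (snd s)"
  consider "s \<in> set (state_axs r)"
    | j where "s \<in> set (head_axs r j (snd (fst (ts ! r)) ! j) (snd (snd (ts ! r)) ! j))"
    using s by (auto simp: trans_axs_def)
  then show "separated a"
  proof cases
    case 1
    then show ?thesis using a by (auto simp: state_axs_def separated_def XS_simps)
  next
    case 2
    then consider "s \<in> set (move_axs r j (snd (snd (snd (ts ! r)) ! j)))" | "separated a"
      using a by (auto simp: head_axs_def separated_def XS_simps)
    then show ?thesis using separated_move_axs a by cases
  qed
qed

lemma separated_axs:
  assumes "s \<in> set axs" "a \<in> set (fst s) \<union> set (snd s)"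
  shows "separated a"
proof -
  define ok :: "sequent \<Rightarrow> bool" where "ok s \<longleftrightarrow> (\<forall>a\<in>set (fst s) \<union> set (snd s). separated a)" for s
  have "\<forall>s\<in>set axs. ok s"
    unfolding axs_def set_append ball_Un set_concat set_map ball_UN ball_simps
  proof (intro conjI ballI)
    show "ok s" if "s \<in> set base_axs" for s
      using that by (auto simp: ok_def base_axs_def separated_def XS_simps)
    show "ok s" if "s \<in> set order_axs" for s
      using that by (auto simp: ok_def order_axs_def separated_def XS_simps)
    show "ok s" if "s \<in> set blank_axs" for s
      using that by (auto simp: ok_def blank_axs_def separated_def XS_simps)
    show "ok s" if "s \<in> set start_axs" for s
      using that by (auto simp: ok_def start_axs_def separated_def XS_simps)
    show "ok s" if "s \<in> set (letter_axs b)" for s b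
      using that by (auto simp: ok_def letter_axs_def separated_def XS_simps)
    show "ok s" if "s \<in> set (input_axs b)" for s b
      using that by (auto simp: ok_def input_axs_def separated_def XS_simps)
    show "ok s" if "l \<in> set [0..<Suc K]" "s \<in> set (sort_axs l)" for s l
      using that by (auto simp: ok_def sort_axs_def separated_def XS_simps YS_simps)
    show "ok s" if "s \<in> set (level_axs l)" for s l
      using that by (auto simp: ok_def level_axs_def separated_def XS_simps)
    show "ok s" if "l \<in> set [0..<K]" "s \<in> set (game_axs l)" for s l
      using that by (auto simp: ok_def game_axs_def Let_def separated_def XS_simps YS_simps)
    show "ok s" if "s \<in> set (tape_axs j)" for s j
      using that by (auto simp: ok_def tape_axs_def separated_def XS_simps)
    show "ok (empty_tape_ax j)" for j
      by (auto simp: ok_def empty_tape_ax_def separated_def XS_simps)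
    show "ok (state_ax j)" for j
      by (auto simp: ok_def state_ax_def separated_def XS_simps split: prod.splits)
    show "ok (symbol_ax i j)" for i j
      by (auto simp: ok_def symbol_ax_def separated_def XS_simps split: prod.splits)
    show "ok s" if "s \<in> set (trans_axs r)" for s r
      using that separated_trans_axs unfolding ok_def by blast
  qed
  then show ?thesis using assms unfolding ok_def by blast
qed

lemma separated_matrix:
  assumes "a \<in> atoms (matrix w)"
  shows "separated a"
proof -
  have "separated a" if "a \<in> atoms (seqs_fm axs)"
    using that separated_axs by (auto simp: atoms_seqs_fm separated_def)
  then show ?thesis using assms unfolding matrix_def atoms_foldr_And atoms_foldr_Or atoms.simps
    by (auto simp: chain_fm_def same_fm_def separated_def XS_simps YS_simps)
qed

lemma free_vars_qf: "nnf_matrix \<phi> \<Longrightarrow> free_vars \<phi> = vars (atoms \<phi>)"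
  by (induction \<phi> rule: nnf_matrix.induct) (auto simp: vars_def)

lemma free_vars_close_prefix: "free_vars (close_prefix B \<psi>) = free_vars \<psi> - set (bound_vars B)"
proof (induction B)
  case (Cons b B)
  have "free_vars (foldr All xs \<phi>) = free_vars \<phi> - set xs" for xs \<phi> by (induction xs) auto
  moreover have "free_vars (foldr Ex xs \<phi>) = free_vars \<phi> - set xs" for xs \<phi> by (induction xs) auto
  ultimately show ?case using Cons by (cases b) (auto simp: bound_vars_def)
qed (simp add: bound_vars_def)

lemma atoms_close_prefix: "atoms (close_prefix B \<psi>) = atoms \<psi>"
proof (induction B)
  case (Cons b B)
  have "atoms (foldr All xs \<phi>) = atoms \<phi>" for xs \<phi> by (induction xs) auto
  moreover have "atoms (foldr Ex xs \<phi>) = atoms \<phi>" for xs \<phi> by (induction xs) auto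
  ultimately show ?case using Cons by simp
qed simp

lemma bound_vars_blks: "set (bound_vars (blks n)) = nm 1 ` {..<n} \<union> nm 2 ` {..<n} \<union> nm 3 ` {..<n}"
  by (auto simp: bound_vars_def blks_def)

lemma bound_vars_prefix: "set (bound_vars prefix) = XS \<union> YS"
proof -
  have "set (bound_vars prefix) = nm 0 ` {..<4} \<union> {nm 1 K, nm 2 K, nm 3 K} \<union> set (bound_vars (blks K))"
    by (auto simp: prefix_def bound_vars_def)
  moreover have "{..K} = insert K {..<K}" by auto
  ultimately show ?thesis unfolding bound_vars_blks XS_def YS_def by auto
qed

lemma distinct_bound_vars_blks: "distinct (bound_vars (blks n))"
proof (induction n)
  case (Suc n)
  have "bound_vars (blks (Suc n)) = [nm 1 n, nm 2 n, nm 3 n] @ bound_vars (blks n)"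
    by (simp add: blks_def bound_vars_def)
  then show ?case using Suc by (auto simp: bound_vars_blks)
qed (simp add: blks_def bound_vars_def)

lemma distinct_bound_vars_prefix: "distinct (bound_vars prefix)"
proof -
  have "bound_vars prefix = map (nm 0) [0..<4] @ [nm 1 K, nm 2 K, nm 3 K] @ bound_vars (blks K)"
    by (simp add: prefix_def bound_vars_def)
  then show ?thesis using distinct_bound_vars_blks[of K] by (auto simp: bound_vars_blks distinct_map inj_on_def)
qed

lemma in_axs:
  "s \<in> set base_axs \<Longrightarrow> s \<in> set axs" "s \<in> set order_axs \<Longrightarrow> s \<in> set axs"
  "s \<in> set blank_axs \<Longrightarrow> s \<in> set axs" "s \<in> set start_axs \<Longrightarrow> s \<in> set axs"
  "a \<in> set Gs \<Longrightarrow> s \<in> set (letter_axs a) \<Longrightarrow> s \<in> set axs"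
  "a \<in> set Gs \<Longrightarrow> s \<in> set (input_axs a) \<Longrightarrow> s \<in> set axs"
  "l \<le> K \<Longrightarrow> s \<in> set (sort_axs l) \<Longrightarrow> s \<in> set axs"
  "l < K \<Longrightarrow> s \<in> set (level_axs l) \<Longrightarrow> s \<in> set axs"
  "l < K \<Longrightarrow> s \<in> set (game_axs l) \<Longrightarrow> s \<in> set axs"
  "j < tapes M \<Longrightarrow> s \<in> set (tape_axs j) \<Longrightarrow> s \<in> set axs"
  "1 \<le> j \<Longrightarrow> j < tapes M \<Longrightarrow> empty_tape_ax j \<in> set axs"
  "p \<in> set (distinct_pairs Qs) \<Longrightarrow> state_ax p \<in> set axs"
  "j < tapes M \<Longrightarrow> p \<in> set (distinct_pairs Gs) \<Longrightarrow> symbol_ax j p \<in> set axs"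
  "r < length ts \<Longrightarrow> s \<in> set (trans_axs r) \<Longrightarrow> s \<in> set axs"
  unfolding axs_def set_append set_concat set_map by (auto simp del: upt_Suc)

lemma bound_vars_occur: "XS \<union> YS \<subseteq> vars (atoms (matrix w))"
proof -
  have *: "atm_vars a \<subseteq> vars (atoms (matrix w))" if "s \<in> set axs" "a \<in> set (fst s) \<union> set (snd s)" for s a
    using that unfolding matrix_def atoms_foldr_And atoms_foldr_Or atoms.simps atoms_seqs_fm vars_def by blast
  have v: "nm 0 i \<in> vars (atoms (matrix w))" if "i < 4" for i
  proof -
    \<comment> \<open>Two atoms of this scanning axiom together contain all four of
      \<open>v 0\<close> to \<open>v 3\<close>.\<close>
    let ?s = "([pS (v 2) (v 3), pD (v 0) (v 1) (v 2)], [pJ (v 0) (v 3), pJ (v 1) (v 3), pD (v 0) (v 1) (v 3)])"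
    have "?s \<in> set axs" by (rule in_axs(1)) (simp add: base_axs_def)
    from *[OF this, of "pS (v 2) (v 3)"] *[OF this, of "pD (v 0) (v 1) (v 2)"] that
    show ?thesis by (auto simp: numeral_eq_Suc less_Suc_eq)
  qed
  have x: "nm 1 l \<in> vars (atoms (matrix w)) \<and> nm 2 l \<in> vars (atoms (matrix w)) \<and> nm 3 l \<in> vars (atoms (matrix w))"
    if "l \<le> K" for l
  proof -
    have "([pL l (vx l)], [pL l (vy l)]) \<in> set axs" "([pL l (vx l)], [pL l (vs l)]) \<in> set axs"
      using in_axs(7)[OF that] by (simp_all add: sort_axs_def)
    from *[OF this(1), of "pL l (vx l)"] *[OF this(1), of "pL l (vy l)"] *[OF this(2), of "pL l (vs l)"]
    show ?thesis by simp
  qed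
  show ?thesis using v x by (auto simp: XS_def YS_def)
qed

text \<open>Part 0 of a partition may use all universal variables and no existential one, and part K
  + 1 is the other way round. Separated atoms fit into these two parts, and the parts in between
  stay empty.\<close>

lemma sentence_gbsr: "sentence w \<in> gbsr"
proof -
  have vars: "vars (atoms (matrix w)) \<subseteq> XS \<union> YS"
    using separated_matrix by (fastforce simp: vars_def separated_def)
  have len: "length prefix = Suc K" by (simp add: prefix_def blks_def)
  have X: "(\<Union>i<Suc K. set (fst (prefix ! i))) = XS"
  proof -
    have "(\<Union>i<length prefix. set (fst (prefix ! i))) = (\<Union>b\<in>set prefix. set (fst b))"
      by (metis (no_types, lifting) SUP_cong atLeast_upt image_image list.set_map map_nth)
    also have "\<dots> = nm 0 ` {..<4} \<union> nm 1 ` insert K {..<K}"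
      by (auto simp: prefix_def blks_def)
    finally show ?thesis unfolding len XS_def by (simp add: lessThan_Suc[symmetric] lessThan_Suc_atMost)
  qed
  have Y: "(\<Union>i<Suc K. set (snd (prefix ! i))) = YS"
  proof -
    have "(\<Union>i<length prefix. set (snd (prefix ! i))) = (\<Union>b\<in>set prefix. set (snd b))"
      by (metis (no_types, lifting) SUP_cong atLeast_upt image_image list.set_map map_nth)
    also have "\<dots> = nm 2 ` insert K {..<K} \<union> nm 3 ` insert K {..<K}"
      by (auto simp: prefix_def blks_def)
    finally show ?thesis unfolding len YS_def by (simp add: lessThan_Suc[symmetric] lessThan_Suc_atMost)
  qed
  have std: "standard_form prefix (matrix w) (sentence w)"
    unfolding standard_form_def
  proof (intro conjI allI impI)
    show "free_vars (sentence w) = {}"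
      using vars by (simp add: sentence_def free_vars_close_prefix free_vars_qf nnf_matrix_matrix bound_vars_prefix)
    show "fst (prefix ! i) \<noteq> []" if "i < length prefix" for i
      using that unfolding len by (cases i) (auto simp: prefix_def blks_def)
    show "snd (prefix ! i) \<noteq> []" if "i < length prefix" for i
      using that unfolding len by (cases i) (auto simp: prefix_def blks_def)
    show "prefix \<noteq> []" by (simp add: prefix_def)
    show "set (bound_vars prefix) \<subseteq> vars (atoms (matrix w))"
      using bound_vars_occur bound_vars_prefix by simp
  qed (simp_all add: sentence_def nnf_matrix_matrix distinct_bound_vars_prefix)
  define P where "P i = (if i = 0 then {a \<in> atoms (matrix w). atm_vars a \<subseteq> XS}
     else if i = Suc K then {a \<in> atoms (matrix w). \<not> atm_vars a \<subseteq> XS} else {})" for i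
  have disj: "XS \<inter> YS = {}" by (auto simp: XS_def YS_def)
  have P0: "vars (P 0) \<subseteq> XS" by (auto simp: P_def vars_def)
  have PK: "vars (P (Suc K)) \<subseteq> YS" using separated_matrix by (fastforce simp: P_def vars_def separated_def)
  have "gbsr_partition prefix (atoms (matrix w)) P"
    unfolding gbsr_partition_def Let_def len
  proof (intro conjI allI impI)
    show "(\<Union>i\<le>Suc K. P i) = atoms (matrix w)"
    proof
      show "(\<Union>i\<le>Suc K. P i) \<subseteq> atoms (matrix w)" by (auto simp: P_def)
      have "atoms (matrix w) \<subseteq> P 0 \<union> P (Suc K)" by (auto simp: P_def)
      then show "atoms (matrix w) \<subseteq> (\<Union>i\<le>Suc K. P i)" by fastforce
    qed
    show "P i \<inter> P j = {}" if "i < j \<and> j \<le> Suc K" for i j using that by (auto simp: P_def)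
    show "vars (P i) \<subseteq> (\<Union>j\<in>{..<i}. set (snd (prefix ! j))) \<union> (\<Union>j\<in>{i..<Suc K}. set (fst (prefix ! j)))"
      if i: "i \<le> Suc K" for i
    proof -
      consider "i = 0" | "i = Suc K" | "0 < i" "i < Suc K" using i by linarith
      then show ?thesis
      proof cases
        case 1
        then show ?thesis using P0 X by (simp add: lessThan_atLeast0)
      next
        case 2
        then show ?thesis using PK Y by simp
      next
        case 3
        then show ?thesis by (simp add: P_def vars_def)
      qed
    qed
    show "vars (P i) \<inter> vars (P j) \<inter> (\<Union>l<Suc K. set (fst (prefix ! l))) = {}" if ij: "i < j \<and> j \<le> Suc K" for i j
    proof (cases "j = Suc K")
      case True
      then show ?thesis using PK disj X by blast
    next
      case False
      then have "P j = {}" using ij by (simp add: P_def)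
      then show ?thesis by (simp add: vars_def)
    qed
  qed
  moreover have "atoms (sentence w) = atoms (matrix w)" by (simp add: sentence_def atoms_close_prefix)
  ultimately show ?thesis unfolding gbsr_def using std separated_matrix by (auto simp: separated_def)
qed

section \<open>The encoded sentence as transducer output\<close>

fun enc_prefix :: "blocks \<Rightarrow> word" where
  "enc_prefix [] = []"
| "enc_prefix ((xs, ys) # B) = concat (map (\<lambda>x. 13 # enc_name x) xs) @ concat (map (\<lambda>x. 14 # enc_name x) ys) @ enc_prefix B"

lemma enc_close_prefix: "enc_fm (close_prefix B \<psi>) = enc_prefix B @ enc_fm \<psi>"
proof (induction B)
  case (Cons b B)
  have "enc_fm (foldr All xs \<phi>) = concat (map (\<lambda>x. 13 # enc_name x) xs) @ enc_fm \<phi>" for xs \<phi>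
    by (induction xs) auto
  moreover have "enc_fm (foldr Ex xs \<phi>) = concat (map (\<lambda>x. 14 # enc_name x) xs) @ enc_fm \<phi>" for xs \<phi>
    by (induction xs) auto
  ultimately show ?case using Cons by (cases b) simp
qed simp

text \<open>The encodings of the input-dependent subformulas, cut open where the two unary indices
  stand: \<open>[5, 1]\<close> begins a constant \<open>cell i\<close>, and \<open>[3, 3]\<close>
  ends it. The final 9 in \<open>post_word Wrap\<close> is the conjunction of the disjuncts with the
  axioms.\<close>

definition pre_word :: "kind \<Rightarrow> word" where
  "pre_word k = (case k of Chain \<Rightarrow> [] | Wrap \<Rightarrow> 9 # 7 # enc_name (nm 1 6) @ [5, 1]
     | Disj \<Rightarrow> 10 # 9 # 6 # enc_tm (vx 0) @ [5, 1])"

definition mid_word :: "kind \<Rightarrow> word" where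
  "mid_word k = (if k = Disj then [3, 3, 6] @ enc_tm (vy 0) @ [5, 1] else [3, 3, 5, 1])"

definition post_word :: "kind \<Rightarrow> word" where
  "post_word k = (case k of Chain \<Rightarrow> [3, 3, 3] | Wrap \<Rightarrow> [3, 3, 3, 9] | Disj \<Rightarrow> [3, 3])"

definition opn_word :: "nat \<Rightarrow> word" where
  "opn_word a = 9 # 7 # enc_name (nm 2 a) @ [5, 1]"

definition fin_word :: word where
  "fin_word = enc_fm (Neg (Atom (pL 0 (vx 0)))) @ enc_fm (seqs_fm axs)"

lemma enc_foldr_And: "enc_fm (foldr (\<lambda>i. And (f i)) xs \<phi>) = concat (map (\<lambda>i. 9 # enc_fm (f i)) xs) @ enc_fm \<phi>"
  by (induction xs) auto

lemma enc_foldr_Or: "enc_fm (foldr (\<lambda>i. Or (f i)) xs \<phi>) = concat (map (\<lambda>i. 10 # enc_fm (f i)) xs) @ enc_fm \<phi>"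
  by (induction xs) auto

lemma enc_cell: "enc_tm (cell i) = [5, 1] @ replicate i 2 @ [3, 3]"
  by (simp add: enc_name_def nm_def)

lemma polytime_sentence:
  assumes "finite \<Sigma>" "0 \<notin> \<Sigma>"
  shows "polytime_on (lists \<Sigma>) (\<lambda>w. enc_fm (sentence w))"
proof -
  interpret sweep \<Sigma> "enc_prefix prefix" opn_word pre_word mid_word post_word fin_word
    by standard (use assms in auto)
  have chain: "chain_out a i = 9 # enc_fm (chain_fm a i)" for a i
    unfolding chain_fm_def enc_fm.simps enc_atm.simps list.map concat.simps enc_cell
    by (simp add: chain_out_def opn_word_def mid_word_def post_word_def)
  have disj: "kind_out Disj i = 10 # enc_fm (same_fm i)" for i
    unfolding same_fm_def enc_fm.simps enc_atm.simps enc_cell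
    by (simp add: kind_out_def pre_word_def mid_word_def post_word_def)
  have wrap: "kind_out Wrap i = 9 # enc_fm (Atom (pW (cell i) (cell i))) @ [9]" for i
    unfolding enc_fm.simps enc_atm.simps list.map concat.simps enc_cell
    by (simp add: kind_out_def pre_word_def mid_word_def post_word_def)
  have "sweep_word w = enc_fm (sentence w)" for w
    unfolding sweep_word_def sentence_def enc_close_prefix matrix_def enc_foldr_And enc_foldr_Or enc_fm.simps(3)
      chain disj wrap
    unfolding fin_word_def by (simp add: comp_def del: enc_tm.simps upt_Suc)
  then show ?thesis using polytime_sweep_word by presburger
qed

end

section \<open>From models to accepting runs\<close>

lemma funpow_cancel:
  assumes "inj_on f A" "\<And>x. x \<in> A \<Longrightarrow> f x \<in> A" "a \<in> A" "b \<in> A" "(f ^^ i) a = (f ^^ i) b"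
  shows "a = b"
  using assms(3-5)
proof (induction i arbitrary: a b)
  case (Suc i)
  then have "(f ^^ i) (f a) = (f ^^ i) (f b)" by (simp add: funpow_swap1)
  then have "f a = f b" using Suc assms by blast
  then show ?case using Suc.prems assms(1) by (auto dest: inj_onD)
qed simp

text \<open>Pigeonhole gives a repetition in the orbit, injectivity shifts it back to z, and the
  least period admits no earlier repetition.\<close>

lemma finite_orbit:
  assumes fin: "finite A" and inj: "inj_on f A" and f: "\<And>x. x \<in> A \<Longrightarrow> f x \<in> A" and z: "z \<in> A"
  obtains n where "n > 0" "(f ^^ n) z = z" "inj_on (\<lambda>i. (f ^^ i) z) {..<n}"
proof -
  have in_A: "(f ^^ i) z \<in> A" for i by (induction i) (use z f in auto)
  have cancel: "(f ^^ (j - i)) z = z" if "i < j" "(f ^^ i) z = (f ^^ j) z" for i j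
  proof -
    have "(f ^^ i) ((f ^^ (j - i)) z) = (f ^^ i) z"
      using that by (simp flip: funpow_add comp_apply[of "f ^^ i"])
    then show ?thesis using funpow_cancel[OF inj f] in_A z by blast
  qed
  have "range (\<lambda>i. (f ^^ i) z) \<subseteq> A" using in_A by auto
  then have "\<not> inj_on (\<lambda>i. (f ^^ i) z) UNIV"
    using fin finite_imageD finite_subset infinite_UNIV_nat by blast
  then obtain i j where "i \<noteq> j" "(f ^^ i) z = (f ^^ j) z" unfolding inj_on_def by auto
  then have ex: "\<exists>n. n > 0 \<and> (f ^^ n) z = z"
    using cancel[of i j] cancel[of j i] by (cases i j rule: linorder_cases) (auto intro: exI[of _ "j - i"] exI[of _ "i - j"])
  define n where "n = (LEAST n. n > 0 \<and> (f ^^ n) z = z)"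
  have n: "n > 0" "(f ^^ n) z = z" using LeastI_ex[OF ex] by (simp_all add: n_def)
  have n_le: "n \<le> k" if "k > 0" "(f ^^ k) z = z" for k using that by (simp add: n_def Least_le)
  have "inj_on (\<lambda>i. (f ^^ i) z) {..<n}"
  proof (rule linorder_inj_onI')
    fix i j assume ij: "i \<in> {..<n}" "j \<in> {..<n}" "i < j"
    show "(f ^^ i) z \<noteq> (f ^^ j) z"
    proof
      assume "(f ^^ i) z = (f ^^ j) z"
      then have "n \<le> j - i" using n_le[of "j - i"] cancel ij by simp
      then show False using ij by simp
    qed
  qed
  then show ?thesis using n that by blast
qed

locale machine_simulation = simulation +
  assumes wf: "wf_tmachine M" and ts: "set ts = transitions M"
    and Gs0: "0 \<in> set Gs"
    and Gs: "\<And>q rs q' as. ((q, rs), (q', as)) \<in> transitions M \<Longrightarrow> set rs \<subseteq> set Gs \<and> fst ` set as \<subseteq> set Gs"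
    and Qs0: "start M \<in> set Qs" "accept M \<in> set Qs"
    and Qs: "\<And>q rs q' as. ((q, rs), (q', as)) \<in> transitions M \<Longrightarrow> q \<in> set Qs \<and> q' \<in> set Qs"

context simulation
begin

abbreviation "bv n \<equiv> set (bound_vars (blks n))"

lemma nm_bv: "nm i l \<in> bv n \<longleftrightarrow> (i = 1 \<or> i = 2 \<or> i = 3) \<and> l < n"
  by (auto simp: bound_vars_blks)

lemma bv_Suc: "bv (Suc n) = bv n \<union> {nm 1 n, nm 2 n, nm 3 n}"
  unfolding bound_vars_blks by (auto simp: less_Suc_eq)

lemma close_blks_Suc:
  "close_prefix (blks (Suc n)) \<psi> = All (nm 1 n) (Ex (nm 2 n) (Ex (nm 3 n) (close_prefix (blks n) \<psi>)))"
  by (simp add: blks_def)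

lemma holds_matrix:
  "holds S e (matrix w) \<longleftrightarrow> (\<forall>i<length w. pred_int S (nm 2 (w ! i)) [fun_int S (nm 0 i) [], fun_int S (nm 0 (Suc i)) []]) \<and>
     pred_int S (nm 1 6) [fun_int S (nm 0 (length w)) [], fun_int S (nm 0 (length w)) []] \<and>
     (pred_int S (nm 0 0) [e (nm 1 0)] \<longrightarrow> (\<exists>i\<le>length w. e (nm 1 0) = fun_int S (nm 0 i) [] \<and> e (nm 2 0) = fun_int S (nm 0 i) [])) \<and>
     (\<forall>s\<in>set axs. sat S e s)"
proof -
  have A: "holds S e (foldr (\<lambda>i. And (f i)) xs \<phi>) \<longleftrightarrow> (\<forall>i\<in>set xs. holds S e (f i)) \<and> holds S e \<phi>" for f \<phi> and xs :: "nat list"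
    by (induction xs) auto
  have O: "holds S e (foldr (\<lambda>i. Or (f i)) xs \<phi>) \<longleftrightarrow> (\<exists>i\<in>set xs. holds S e (f i)) \<or> holds S e \<phi>" for f \<phi> and xs :: "nat list"
    by (induction xs) auto
  show ?thesis unfolding matrix_def A holds.simps O holds_seqs_fm
    by (auto simp: chain_fm_def same_fm_def less_Suc_eq_le simp del: upt_Suc)
qed

end

section \<open>What the axioms say in a model\<close>

locale sentence_model = machine_simulation +
  fixes S :: "'u fo_structure" and w :: word
  assumes mod: "models S (sentence w)" and w: "set w \<subseteq> set Gs"
begin

abbreviation "U \<equiv> universe S"
abbreviation "P i j us \<equiv> pred_int S (nm i j) us"
abbreviation "cst i j \<equiv> fun_int S (nm i j) []"

definition Lv :: "nat \<Rightarrow> 'u set" where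
  "Lv l = {x \<in> U. P 0 l [x]}"

lemma cst_U: "cst i j \<in> U"
  using mod by (auto simp: models_def is_structure_def)

text \<open>For axioms on the variables \<open>v i\<close> the moves of the game do not matter, so
  the universal variables of the blocks simply take arbitrary elements.\<close>

lemma play:
  assumes "holds S e (close_prefix (blks n) \<psi>)" "range e \<subseteq> U"
  shows "\<exists>e'. range e' \<subseteq> U \<and> (\<forall>x. x \<notin> bv n \<longrightarrow> e' x = e x) \<and> holds S e' \<psi>"
  using assms
proof (induction n arbitrary: e)
  case 0
  then show ?case by (auto simp: blks_def)
next
  case (Suc n)
  obtain a where a: "a \<in> U" using cst_U by blast
  then obtain b b' where b: "b \<in> U" "b' \<in> U"
    and h: "holds S (e(nm 1 n := a, nm 2 n := b, nm 3 n := b')) (close_prefix (blks n) \<psi>)"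
    using Suc.prems unfolding close_blks_Suc by auto
  have "range (e(nm 1 n := a, nm 2 n := b, nm 3 n := b')) \<subseteq> U" using a b Suc.prems by auto
  from Suc.IH[OF h this] obtain e' where "range e' \<subseteq> U" "holds S e' \<psi>"
    "\<forall>x. x \<notin> bv n \<longrightarrow> e' x = (e(nm 1 n := a, nm 2 n := b, nm 3 n := b')) x" by blast
  then show ?case unfolding bv_Suc by (intro exI[of _ e']) auto
qed

lemma holds_sentence:
  assumes "v0 \<in> U" "v1 \<in> U" "v2 \<in> U" "v3 \<in> U"
  obtains e where "range e \<subseteq> U" "e (nm 0 0) = v0" "e (nm 0 (Suc 0)) = v1" "e (nm 0 2) = v2" "e (nm 0 3) = v3"
    "holds S e (close_prefix (blks (Suc K)) (matrix w))"
proof -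
  have "sentence w = All (nm 0 0) (All (nm 0 1) (All (nm 0 2) (All (nm 0 3) (close_prefix (blks (Suc K)) (matrix w)))))"
    by (simp add: sentence_def prefix_def close_blks_Suc numeral_eq_Suc)
  moreover have "holds S (\<lambda>_. v0) (sentence w)" using mod assms by (auto simp: models_def)
  ultimately have "holds S ((\<lambda>_. v0)(nm 0 0 := v0, nm 0 1 := v1, nm 0 2 := v2, nm 0 3 := v3)) (close_prefix (blks (Suc K)) (matrix w))"
    using assms by simp
  then show ?thesis by (rule that[rotated 5]) (use assms in auto)
qed

lemma axs_hold:
  assumes "v0 \<in> U" "v1 \<in> U" "v2 \<in> U" "v3 \<in> U"
  obtains e where "e (nm 0 0) = v0" "e (nm 0 (Suc 0)) = v1" "e (nm 0 2) = v2" "e (nm 0 3) = v3"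
    "\<forall>s\<in>set axs. sat S e s"
proof -
  obtain e where e: "range e \<subseteq> U" "e (nm 0 0) = v0" "e (nm 0 (Suc 0)) = v1" "e (nm 0 2) = v2" "e (nm 0 3) = v3"
    "holds S e (close_prefix (blks (Suc K)) (matrix w))" using holds_sentence[OF assms] by blast
  from play[OF e(6,1)] obtain e' where e': "\<forall>x. x \<notin> bv (Suc K) \<longrightarrow> e' x = e x" "holds S e' (matrix w)" by blast
  have "e' (nm 0 i) = e (nm 0 i)" for i using e'(1) nm_bv by simp
  then show ?thesis using that[of e'] e e'(2) unfolding holds_matrix by simp
qed

lemma chain_facts:
  "i < length w \<Longrightarrow> P 2 (w ! i) [cst 0 i, cst 0 (Suc i)]" "P 1 6 [cst 0 (length w), cst 0 (length w)]"
proof -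
  obtain a where a: "a \<in> U" using cst_U by blast
  obtain e where e: "range e \<subseteq> U" "holds S e (close_prefix (blks (Suc K)) (matrix w))" using holds_sentence[OF a a a a] by blast
  from play[OF e(2,1)] obtain e' where "holds S e' (matrix w)" by blast
  then show "i < length w \<Longrightarrow> P 2 (w ! i) [cst 0 i, cst 0 (Suc i)]" "P 1 6 [cst 0 (length w), cst 0 (length w)]"
    unfolding holds_matrix by auto
qed

lemma base_sem:
  assumes "v0 \<in> U" "v1 \<in> U" "v2 \<in> U" "v3 \<in> U"
  shows "P 1 2 [v0, v1] \<Longrightarrow> P 1 2 [v0, v2] \<Longrightarrow> v1 = v2"
    "P 1 2 [v0, v2] \<Longrightarrow> P 1 2 [v1, v2] \<Longrightarrow> v0 = v1"
    "P 1 6 [v0, v1] \<Longrightarrow> P 1 2 [v0, cst 0 0] \<and> P 0 0 [v0] \<and> P 0 0 [cst 0 0]"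
    "P 1 2 [v2, v3] \<Longrightarrow> P 1 3 [v0, v1, v2] \<Longrightarrow> P 1 0 [v0, v3] = P 1 0 [v1, v3] \<Longrightarrow> P 1 3 [v0, v1, v3]"
    "P 1 2 [v2, v3] \<Longrightarrow> P 1 4 [v0, v1, v2] \<Longrightarrow> P 1 1 [v0, v3] = P 1 0 [v1, v3] \<Longrightarrow> P 1 4 [v0, v1, v3]"
proof -
  obtain e where e: "e (nm 0 0) = v0" "e (nm 0 (Suc 0)) = v1" "e (nm 0 2) = v2" "e (nm 0 3) = v3"
    and all: "\<forall>s\<in>set axs. sat S e s" using axs_hold[OF assms] by blast
  have "\<forall>s\<in>set base_axs. sat S e s" using all in_axs(1) by blast
  note * = this[unfolded base_axs_def, simplified, unfolded e]
  show "P 1 2 [v0, v1] \<Longrightarrow> P 1 2 [v0, v2] \<Longrightarrow> v1 = v2" using * by simp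
  show "P 1 2 [v0, v2] \<Longrightarrow> P 1 2 [v1, v2] \<Longrightarrow> v0 = v1" using * by simp
  show "P 1 6 [v0, v1] \<Longrightarrow> P 1 2 [v0, cst 0 0] \<and> P 0 0 [v0] \<and> P 0 0 [cst 0 0]" using * by simp
  show "P 1 2 [v2, v3] \<Longrightarrow> P 1 3 [v0, v1, v2] \<Longrightarrow> P 1 0 [v0, v3] = P 1 0 [v1, v3] \<Longrightarrow> P 1 3 [v0, v1, v3]" using * by auto
  show "P 1 2 [v2, v3] \<Longrightarrow> P 1 4 [v0, v1, v2] \<Longrightarrow> P 1 1 [v0, v3] = P 1 0 [v1, v3] \<Longrightarrow> P 1 4 [v0, v1, v3]" using * by auto
qed

lemma letter_sem:
  assumes "a \<in> set Gs" "x \<in> U" "y \<in> U" "P 2 a [x, y]"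
  shows "P 1 2 [x, y]" "P 0 0 [x]" "P 0 0 [y]"
proof -
  obtain e where e: "e (nm 0 0) = x" "e (nm 0 (Suc 0)) = y"
    and all: "\<forall>s\<in>set axs. sat S e s" using axs_hold[OF assms(2,3,2,2)] by blast
  have "\<forall>s\<in>set (letter_axs a). sat S e s" using all in_axs(5)[OF assms(1)] by blast
  note * = this[unfolded letter_axs_def, simplified, unfolded e]
  show "P 1 2 [x, y]" "P 0 0 [x]" "P 0 0 [y]" using * assms by simp_all
qed

lemma level_sem:
  assumes "l < K" "v0 \<in> U" "v1 \<in> U" "v2 \<in> U"
  shows "P 1 0 [v0, cst 1 l] = P 1 0 [v1, cst 1 l] \<Longrightarrow> P 1 3 [v0, v1, cst 1 l]"
    "P 1 1 [v0, cst 1 l] = P 1 0 [v1, cst 1 l] \<Longrightarrow> P 1 4 [v0, v1, cst 1 l]"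
    "P 1 2 [v2, cst 1 l] \<Longrightarrow> P 1 3 [v0, v1, v2] \<Longrightarrow> P 0 (Suc l) [v0] \<Longrightarrow> P 0 (Suc l) [v1] \<Longrightarrow> v0 = v1"
    "P 1 2 [v2, cst 1 l] \<Longrightarrow> P 1 4 [v0, v1, v2] \<Longrightarrow> P 0 (Suc l) [v0] \<Longrightarrow> P 0 (Suc l) [v1] \<Longrightarrow> P 1 2 [v0, v1]"
proof -
  obtain e where e: "e (nm 0 0) = v0" "e (nm 0 (Suc 0)) = v1" "e (nm 0 2) = v2"
    and all: "\<forall>s\<in>set axs. sat S e s" using axs_hold[OF assms(2,3,4,4)] by blast
  have "\<forall>s\<in>set (level_axs l). sat S e s" using all in_axs(8)[OF assms(1)] by blast
  note * = this[unfolded level_axs_def, simplified, unfolded e]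
  show "P 1 0 [v0, cst 1 l] = P 1 0 [v1, cst 1 l] \<Longrightarrow> P 1 3 [v0, v1, cst 1 l]"
    "P 1 1 [v0, cst 1 l] = P 1 0 [v1, cst 1 l] \<Longrightarrow> P 1 4 [v0, v1, cst 1 l]" using * by auto
  show "P 1 2 [v2, cst 1 l] \<Longrightarrow> P 1 3 [v0, v1, v2] \<Longrightarrow> P 0 (Suc l) [v0] \<Longrightarrow> P 0 (Suc l) [v1] \<Longrightarrow> v0 = v1"
    "P 1 2 [v2, cst 1 l] \<Longrightarrow> P 1 4 [v0, v1, v2] \<Longrightarrow> P 0 (Suc l) [v0] \<Longrightarrow> P 0 (Suc l) [v1] \<Longrightarrow> P 1 2 [v0, v1]"
    using * by auto
qed

lemma z_Lv: "l \<le> K \<Longrightarrow> cst 1 l \<in> Lv l"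
proof -
  assume l: "l \<le> K"
  obtain a where a: "a \<in> U" using cst_U by blast
  obtain e where "\<forall>s\<in>set axs. sat S e s" using axs_hold[OF a a a a] by blast
  then have "\<forall>s\<in>set (sort_axs l). sat S e s" using in_axs(7)[OF l] by blast
  then have "sat S e ([], [pL l (zc l)])" by (simp add: sort_axs_def)
  then show ?thesis using cst_U by (simp add: Lv_def)
qed

section \<open>Induction over the levels of a model\<close>

definition good :: "nat \<Rightarrow> bool" where
  "good l \<longleftrightarrow> finite (Lv l) \<and> (\<forall>x\<in>Lv l. \<exists>y\<in>Lv l. P 1 2 [x, y])"

lemma good_cycle:
  assumes "good l" "l \<le> K"
  obtains f n where "\<And>x. x \<in> Lv l \<Longrightarrow> f x \<in> Lv l \<and> P 1 2 [x, f x]" "inj_on f (Lv l)"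
    "n > 0" "(f ^^ n) (cst 1 l) = cst 1 l" "inj_on (\<lambda>i. (f ^^ i) (cst 1 l)) {..<n}"
proof -
  obtain f where f: "\<And>x. x \<in> Lv l \<Longrightarrow> f x \<in> Lv l \<and> P 1 2 [x, f x]"
    using assms(1) unfolding good_def by metis
  have inj: "inj_on f (Lv l)"
  proof (rule inj_onI)
    fix x y assume xy: "x \<in> Lv l" "y \<in> Lv l" "f x = f y"
    then show "x = y" using base_sem(2)[of x y "f x" x] f[of x] f[of y] by (auto simp: Lv_def)
  qed
  obtain n where "n > 0" "(f ^^ n) (cst 1 l) = cst 1 l" "inj_on (\<lambda>i. (f ^^ i) (cst 1 l)) {..<n}"
    using finite_orbit[OF _ inj _ z_Lv[OF assms(2)]] f assms(1) unfolding good_def by blast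
  then show ?thesis using that f inj by blast
qed

text \<open>Every level closes up to a cycle through its zero, so a property that is passed on along \<open>pS\<close>
  reaches the predecessor of zero; this is what makes the scanning predicates \<open>pD\<close> and \<open>pF\<close> work.\<close>

lemma scan_induct:
  assumes "good l" "l \<le> K"
  obtains b where "b \<in> Lv l" "P 1 2 [b, cst 1 l]"
    "\<forall>Q. Q (cst 1 l) \<longrightarrow> (\<forall>x\<in>Lv l. \<forall>y\<in>Lv l. Q x \<longrightarrow> P 1 2 [x, y] \<longrightarrow> Q y) \<longrightarrow> Q b"
proof -
  obtain f n where f: "\<And>x. x \<in> Lv l \<Longrightarrow> f x \<in> Lv l \<and> P 1 2 [x, f x]" and n: "n > 0" "(f ^^ n) (cst 1 l) = cst 1 l"
    using good_cycle[OF assms] by metis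
  define e where "e i = (f ^^ i) (cst 1 l)" for i
  have e: "e i \<in> Lv l" for i by (induction i) (use z_Lv[OF assms(2)] f in \<open>auto simp: e_def\<close>)
  have e_Suc: "e (Suc i) = f (e i)" for i by (simp add: e_def)
  have last: "f (e (n - 1)) = cst 1 l" using n e_Suc[of "n - 1"] by (simp add: e_def)
  have Q: "Q (e i)" if "Q (cst 1 l)" "\<forall>x\<in>Lv l. \<forall>y\<in>Lv l. Q x \<longrightarrow> P 1 2 [x, y] \<longrightarrow> Q y" for Q i
  proof (induction i)
    case 0
    then show ?case using that by (simp add: e_def)
  next
    case (Suc i)
    then show ?case using that(2) e f[of "e i"] e_Suc by (metis (no_types))
  qed
  show ?thesis by (rule that[of "e (n - 1)"]) (use Q e f[of "e (n - 1)"] last in auto)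
qed

lemma Lv_eqI:
  assumes "good l" "l < K" "x \<in> Lv (Suc l)" "y \<in> Lv (Suc l)"
    and J: "\<And>b. b \<in> Lv l \<Longrightarrow> P 1 0 [x, b] = P 1 0 [y, b]"
  shows "x = y"
proof -
  have z: "cst 1 l \<in> Lv l" using z_Lv assms(2) by simp
  have U: "x \<in> U" "y \<in> U" using assms by (auto simp: Lv_def)
  obtain b where b: "b \<in> Lv l" "P 1 2 [b, cst 1 l]"
    and ind: "\<forall>Q. Q (cst 1 l) \<longrightarrow> (\<forall>x\<in>Lv l. \<forall>y\<in>Lv l. Q x \<longrightarrow> P 1 2 [x, y] \<longrightarrow> Q y) \<longrightarrow> Q b"
    using scan_induct[OF assms(1) less_imp_le[OF assms(2)]] by blast
  have "P 1 3 [x, y, b]"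
  proof (rule ind[rule_format])
    show "P 1 3 [x, y, cst 1 l]" using level_sem(1)[OF assms(2) U U(1)] J[OF z] by blast
    show "P 1 3 [x, y, c]" if "b \<in> Lv l" "c \<in> Lv l" "P 1 3 [x, y, b]" "P 1 2 [b, c]" for b c
      using base_sem(4)[OF U, of b c] that J[of c] by (auto simp: Lv_def)
  qed
  then show ?thesis using level_sem(3)[OF assms(2) U, of b] b assms(3,4) by (auto simp: Lv_def)
qed

lemma Lv_succI:
  assumes "good l" "l < K" "x \<in> Lv (Suc l)" "y \<in> Lv (Suc l)"
    and J: "\<And>b. b \<in> Lv l \<Longrightarrow> P 1 1 [x, b] = P 1 0 [y, b]"
  shows "P 1 2 [x, y]"
proof -
  have z: "cst 1 l \<in> Lv l" using z_Lv assms(2) by simp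
  have U: "x \<in> U" "y \<in> U" using assms by (auto simp: Lv_def)
  obtain b where b: "b \<in> Lv l" "P 1 2 [b, cst 1 l]"
    and ind: "\<forall>Q. Q (cst 1 l) \<longrightarrow> (\<forall>x\<in>Lv l. \<forall>y\<in>Lv l. Q x \<longrightarrow> P 1 2 [x, y] \<longrightarrow> Q y) \<longrightarrow> Q b"
    using scan_induct[OF assms(1) less_imp_le[OF assms(2)]] by blast
  have "P 1 4 [x, y, b]"
  proof (rule ind[rule_format])
    show "P 1 4 [x, y, cst 1 l]" using level_sem(2)[OF assms(2) U U(1)] J[OF z] by blast
    show "P 1 4 [x, y, c]" if "b \<in> Lv l" "c \<in> Lv l" "P 1 4 [x, y, b]" "P 1 2 [b, c]" for b c
      using base_sem(5)[OF U, of b c] that J[of c] by (auto simp: Lv_def)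
  qed
  then show ?thesis using level_sem(4)[OF assms(2) U, of b] b assms(3,4) by (auto simp: Lv_def)
qed

text \<open>The invariant of the game. It ranges over all assignments because it is applied with the
  answers on higher levels already fixed. Level 0 is exempt from the successor clause: no axiom
  relates \<open>vs 0\<close> to the successor of \<open>vx 0\<close>, and successors of cells come
  from the links between them.\<close>

definition forced :: "nat \<Rightarrow> bool" where
  "forced l \<longleftrightarrow> (\<forall>e a. range e \<subseteq> U \<longrightarrow> holds S e (close_prefix (blks (Suc l)) (matrix w)) \<longrightarrow> a \<in> Lv l \<longrightarrow>
     (\<exists>e'. (\<forall>x. x \<notin> bv (Suc l) \<longrightarrow> e' x = e x) \<and> e' (nm 1 l) = a \<and> e' (nm 2 l) = a \<and>
        e' (nm 3 l) \<in> Lv l \<and> (0 < l \<longrightarrow> P 1 2 [a, e' (nm 3 l)]) \<and> holds S e' (matrix w)))"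

lemma holds_close_down:
  assumes "range e \<subseteq> U" "holds S e (close_prefix (blks n) (matrix w))" "l \<le> n"
  shows "\<exists>e'. range e' \<subseteq> U \<and> holds S e' (close_prefix (blks l) (matrix w))"
  using assms
proof (induction n arbitrary: e)
  case (Suc n)
  show ?case
  proof (cases "l = Suc n")
    case True
    then show ?thesis using Suc.prems by blast
  next
    case False
    obtain a where a: "a \<in> U" using cst_U by blast
    then obtain b b' where b: "b \<in> U" "b' \<in> U"
      and h: "holds S (e(nm 1 n := a, nm 2 n := b, nm 3 n := b')) (close_prefix (blks n) (matrix w))"
      using Suc.prems unfolding close_blks_Suc by auto
    have "range (e(nm 1 n := a, nm 2 n := b, nm 3 n := b')) \<subseteq> U" using a b Suc.prems by auto
    from Suc.IH[OF this h] show ?thesis using False Suc.prems by simp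
  qed
qed blast

lemma holds_close: "l \<le> K \<Longrightarrow> \<exists>e. range e \<subseteq> U \<and> holds S e (close_prefix (blks (Suc l)) (matrix w))"
proof -
  assume l: "l \<le> K"
  obtain a where a: "a \<in> U" using cst_U by blast
  obtain e where e: "range e \<subseteq> U" "holds S e (close_prefix (blks (Suc K)) (matrix w))" using holds_sentence[OF a a a a] by blast
  from holds_close_down[OF e] show ?thesis using l by simp
qed

lemma sort_sem:
  assumes "l \<le> K" "holds S e (matrix w)" "P 0 l [e (nm 1 l)]"
  shows "P 0 l [e (nm 2 l)]" "P 0 l [e (nm 3 l)]"
proof -
  have "\<forall>s\<in>set (sort_axs l). sat S e s" using assms(2) in_axs(7)[OF assms(1)] by (auto simp: holds_matrix)
  then show "P 0 l [e (nm 2 l)]" "P 0 l [e (nm 3 l)]" using assms(3) by (simp_all add: sort_axs_def)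
qed

lemma game_sem:
  assumes "l < K" "holds S e (matrix w)" "P 0 (Suc l) [e (nm 1 (Suc l))]" "P 0 l [e (nm 1 l)]"
  shows "P 1 0 [e (nm 1 (Suc l)), e (nm 1 l)] = P 1 0 [e (nm 2 (Suc l)), e (nm 2 l)]"
    "P 1 1 [e (nm 1 (Suc l)), e (nm 1 l)] = P 1 0 [e (nm 3 (Suc l)), e (nm 2 l)]"
proof -
  have "\<forall>s\<in>set (game_axs l). sat S e s" using assms(2) in_axs(9)[OF assms(1)] by (auto simp: holds_matrix)
  then show "P 1 0 [e (nm 1 (Suc l)), e (nm 1 l)] = P 1 0 [e (nm 2 (Suc l)), e (nm 2 l)]"
    "P 1 1 [e (nm 1 (Suc l)), e (nm 1 l)] = P 1 0 [e (nm 3 (Suc l)), e (nm 2 l)]"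
    using assms(3,4) by (auto simp: game_axs_def Let_def)
qed

lemma forced_0: "forced 0"
  unfolding forced_def
proof (intro allI impI)
  fix e a assume e: "range e \<subseteq> U" and h: "holds S e (close_prefix (blks (Suc 0)) (matrix w))" and a: "a \<in> Lv 0"
  then obtain b b' where b: "b \<in> U" "b' \<in> U" and m: "holds S (e(nm 1 0 := a, nm 2 0 := b, nm 3 0 := b')) (matrix w)"
    unfolding close_blks_Suc by (auto simp: blks_def Lv_def)
  let ?e = "e(nm 1 0 := a, nm 2 0 := b, nm 3 0 := b')"
  have "P 0 0 [?e (nm 1 0)]" using a by (simp add: Lv_def)
  with m have "?e (nm 1 0) = ?e (nm 2 0)" unfolding holds_matrix by auto
  moreover have "P 0 0 [?e (nm 3 0)]" by (rule sort_sem(2)[OF _ m]) (use a in \<open>simp_all add: Lv_def\<close>)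
  ultimately show "\<exists>e'. (\<forall>x. x \<notin> bv (Suc 0) \<longrightarrow> e' x = e x) \<and> e' (nm 1 0) = a \<and> e' (nm 2 0) = a \<and>
        e' (nm 3 0) \<in> Lv 0 \<and> (0 < (0::nat) \<longrightarrow> P 1 2 [a, e' (nm 3 0)]) \<and> holds S e' (matrix w)"
    using m b by (intro exI[of _ ?e]) (auto simp: bv_Suc Lv_def)
qed

lemma good_0: "good 0"
  unfolding good_def
proof (intro conjI ballI)
  have *: "\<exists>i\<le>length w. x = cst 0 i" if x: "x \<in> Lv 0" for x
  proof -
    obtain e where "range e \<subseteq> U" "holds S e (close_prefix (blks (Suc 0)) (matrix w))" using holds_close by blast
    with forced_0 x obtain e' where "e' (nm 1 0) = x" "holds S e' (matrix w)" unfolding forced_def by metis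
    then show ?thesis using x by (auto simp: holds_matrix Lv_def)
  qed
  have "Lv 0 \<subseteq> cst 0 ` {..length w}" using * by blast
  then show "finite (Lv 0)" by (rule finite_subset) simp
  fix x assume "x \<in> Lv 0"
  then obtain i where i: "i \<le> length w" "x = cst 0 i" using * by blast
  show "\<exists>y\<in>Lv 0. P 1 2 [x, y]"
  proof (cases "i = length w")
    case True
    have "P 1 6 [x, x]" using chain_facts(2) True i by simp
    then have "P 1 2 [x, cst 0 0]" "P 0 0 [cst 0 0]" using base_sem(3)[of x x x x] i cst_U by auto
    then show ?thesis using cst_U by (auto simp: Lv_def)
  next
    case False
    then have l: "i < length w" using i by simp
    then have "w ! i \<in> set Gs" using w by auto
    from letter_sem[OF this cst_U cst_U chain_facts(1)[OF l]] show ?thesis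
      using i cst_U by (auto simp: Lv_def)
  qed
qed

text \<open>The answers b and b' to the move a are fixed before the move on level l. For every bit
  position c of that level the invariant provides a continuation in which the copy of c is c itself,
  so \<open>game_axs\<close> compare a with b and b' at c. As b and b' are the same in all these
  continuations, b agrees with a in every bit, b' has the bits prescribed by \<open>pG\<close>, and
  the scans finish the argument.\<close>

lemma forced_Suc:
  assumes "l < K" "good l" "forced l"
  shows "forced (Suc l)"
  unfolding forced_def
proof (intro allI impI)
  fix e a assume e: "range e \<subseteq> U" and h: "holds S e (close_prefix (blks (Suc (Suc l))) (matrix w))" and a: "a \<in> Lv (Suc l)"
  then obtain b b' where b: "b \<in> U" "b' \<in> U"
    and m: "holds S (e(nm 1 (Suc l) := a, nm 2 (Suc l) := b, nm 3 (Suc l) := b')) (close_prefix (blks (Suc l)) (matrix w))"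
    unfolding close_blks_Suc[of "Suc l"] by (auto simp: Lv_def)
  define e1 where "e1 = e(nm 1 (Suc l) := a, nm 2 (Suc l) := b, nm 3 (Suc l) := b')"
  have e1: "range e1 \<subseteq> U" using e b a by (auto simp: e1_def Lv_def)
  have *: "\<exists>e'. (\<forall>x. x \<notin> bv (Suc l) \<longrightarrow> e' x = e1 x) \<and> e' (nm 1 l) = c \<and> e' (nm 2 l) = c \<and> holds S e' (matrix w)"
    if "c \<in> Lv l" for c
    using assms(3) e1 m that unfolding forced_def e1_def[symmetric] by blast
  have same: "e' (nm i (Suc l)) = e1 (nm i (Suc l))" if "\<forall>x. x \<notin> bv (Suc l) \<longrightarrow> e' x = e1 x" for e' i
    using that nm_bv by simp
  have e1_sel: "e1 (nm 1 (Suc l)) = a" "e1 (nm 2 (Suc l)) = b" "e1 (nm 3 (Suc l)) = b'" by (simp_all add: e1_def)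
  obtain e' where e': "\<forall>x. x \<notin> bv (Suc l) \<longrightarrow> e' x = e1 x" "holds S e' (matrix w)"
    using *[OF z_Lv] assms(1) by auto
  have bL: "b \<in> Lv (Suc l)" "b' \<in> Lv (Suc l)"
    using sort_sem[of "Suc l" e'] e'(2) assms(1) a b unfolding same[OF e'(1)] e1_sel by (auto simp: Lv_def)
  have bits: "P 1 0 [a, c] = P 1 0 [b, c] \<and> P 1 1 [a, c] = P 1 0 [b', c]" if c: "c \<in> Lv l" for c
  proof -
    obtain e2 where e2: "\<forall>x. x \<notin> bv (Suc l) \<longrightarrow> e2 x = e1 x" "e2 (nm 1 l) = c" "e2 (nm 2 l) = c" "holds S e2 (matrix w)"
      using *[OF c] by blast
    show ?thesis using game_sem[OF assms(1) e2(4)] a c unfolding same[OF e2(1)] e1_sel e2(2,3) by (simp add: Lv_def)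
  qed
  have "a = b" by (rule Lv_eqI[OF assms(2,1) a bL(1)]) (use bits in blast)
  moreover have "P 1 2 [a, b']" by (rule Lv_succI[OF assms(2,1) a bL(2)]) (use bits in blast)
  moreover have "\<forall>x. x \<notin> bv (Suc (Suc l)) \<longrightarrow> e' x = e x"
    using e'(1) unfolding bv_Suc[of "Suc l"] by (auto simp: e1_def)
  ultimately show "\<exists>e'. (\<forall>x. x \<notin> bv (Suc (Suc l)) \<longrightarrow> e' x = e x) \<and> e' (nm 1 (Suc l)) = a \<and> e' (nm 2 (Suc l)) = a \<and>
        e' (nm 3 (Suc l)) \<in> Lv (Suc l) \<and> (0 < Suc l \<longrightarrow> P 1 2 [a, e' (nm 3 (Suc l))]) \<and> holds S e' (matrix w)"
    using e'(2) bL same[OF e'(1)] e1_sel by (intro exI[of _ e']) simp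
qed

text \<open>Elements are determined by their bits, so the level embeds into the power set of the
  finite level below.\<close>

lemma good_Suc:
  assumes "l < K" "good l" "forced (Suc l)"
  shows "good (Suc l)"
  unfolding good_def
proof (intro conjI ballI)
  have "inj_on (\<lambda>x. {b \<in> Lv l. P 1 0 [x, b]}) (Lv (Suc l))"
    by (rule inj_onI, rule Lv_eqI[OF assms(2,1)]) auto
  moreover have "(\<lambda>x. {b \<in> Lv l. P 1 0 [x, b]}) ` Lv (Suc l) \<subseteq> Pow (Lv l)" by auto
  moreover have "finite (Pow (Lv l))" using assms(2) by (simp add: good_def)
  ultimately show "finite (Lv (Suc l))" by (meson inj_on_finite)
  fix x assume x: "x \<in> Lv (Suc l)"
  obtain e where "range e \<subseteq> U" "holds S e (close_prefix (blks (Suc (Suc l))) (matrix w))"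
    using holds_close[of "Suc l"] assms(1) by auto
  with assms(3) x show "\<exists>y\<in>Lv (Suc l). P 1 2 [x, y]" unfolding forced_def by (metis zero_less_Suc)
qed

lemma good_forced: "l \<le> K \<Longrightarrow> good l \<and> forced l"
proof (induction l)
  case 0
  then show ?case using good_0 forced_0 by simp
next
  case (Suc l)
  then show ?case using forced_Suc[of l] good_Suc[of l] by simp
qed

section \<open>The machine axioms in a model\<close>

lemma order_sem:
  assumes "v0 \<in> U" "v1 \<in> U" "v2 \<in> U"
  shows "P 1 2 [v0, v1] \<Longrightarrow> P 0 K [v0] \<Longrightarrow> v1 = cst 1 K \<or> P 1 5 [v0, v1]"
    "P 1 5 [v0, v1] \<Longrightarrow> P 1 5 [v1, v2] \<Longrightarrow> P 1 5 [v0, v2]"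
    "\<not> P 1 5 [v0, v0]"
proof -
  obtain e where e: "e (nm 0 0) = v0" "e (nm 0 (Suc 0)) = v1" "e (nm 0 2) = v2"
    and all: "\<forall>s\<in>set axs. sat S e s" using axs_hold[OF assms(1,2,3,3)] by blast
  have "\<forall>s\<in>set order_axs. sat S e s" using all in_axs(2) by blast
  note * = this[unfolded order_axs_def, simplified, unfolded e]
  show "P 1 2 [v0, v1] \<Longrightarrow> P 0 K [v0] \<Longrightarrow> v1 = cst 1 K \<or> P 1 5 [v0, v1]"
    "P 1 5 [v0, v1] \<Longrightarrow> P 1 5 [v1, v2] \<Longrightarrow> P 1 5 [v0, v2]" "\<not> P 1 5 [v0, v0]"
    using * by auto
qed

lemma input_sem:
  assumes "a \<in> set Gs" "b \<in> U" "x \<in> U" "b' \<in> U" "x' \<in> U" "P 1 7 [b, x]" "P 2 a [b, b']"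
  shows "P 1 2 [x, x'] \<Longrightarrow> P 1 7 [b', x'] \<and> x' \<noteq> cst 1 K" "P 6 a [cst 1 K, x]"
proof -
  obtain e where e: "e (nm 0 0) = b" "e (nm 0 (Suc 0)) = x" "e (nm 0 2) = b'" "e (nm 0 3) = x'"
    and all: "\<forall>s\<in>set axs. sat S e s" using axs_hold[OF assms(2-5)] by blast
  have "\<forall>s\<in>set (input_axs a). sat S e s" using all in_axs(6)[OF assms(1)] by blast
  note * = this[unfolded input_axs_def, simplified, unfolded e]
  show "P 1 2 [x, x'] \<Longrightarrow> P 1 7 [b', x'] \<and> x' \<noteq> cst 1 K" "P 6 a [cst 1 K, x]" using * assms by auto
qed

lemma blank_sem:
  assumes "v0 \<in> U" "v1 \<in> U"
  shows "P 1 7 [cst 0 0, cst 2 0]"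
    "P 1 7 [v0, v1] \<Longrightarrow> P 1 6 [v0, v0] \<Longrightarrow> P 1 8 [v1]"
    "P 1 8 [v0] \<Longrightarrow> P 6 0 [cst 1 K, v0]"
    "P 1 8 [v0] \<Longrightarrow> P 1 2 [v0, v1] \<Longrightarrow> v1 = cst 1 K \<or> P 1 8 [v1]"
    "P 1 2 [v0, cst 2 0] \<Longrightarrow> cst 2 0 = cst 1 K \<or> P 1 9 [v0]"
    "P 1 9 [v0] \<Longrightarrow> P 6 0 [cst 1 K, v0]"
    "P 1 9 [v0] \<Longrightarrow> P 1 2 [v1, v0] \<Longrightarrow> v0 = cst 1 K \<or> P 1 9 [v1]"
proof -
  obtain e where e: "e (nm 0 0) = v0" "e (nm 0 (Suc 0)) = v1"
    and all: "\<forall>s\<in>set axs. sat S e s" using axs_hold[OF assms(1,2,2,2)] by blast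
  have "\<forall>s\<in>set blank_axs. sat S e s" using all in_axs(3) by blast
  note * = this[unfolded blank_axs_def, simplified, unfolded e]
  show "P 1 7 [cst 0 0, cst 2 0]"
    "P 1 7 [v0, v1] \<Longrightarrow> P 1 6 [v0, v0] \<Longrightarrow> P 1 8 [v1]"
    "P 1 8 [v0] \<Longrightarrow> P 6 0 [cst 1 K, v0]"
    "P 1 8 [v0] \<Longrightarrow> P 1 2 [v0, v1] \<Longrightarrow> v1 = cst 1 K \<or> P 1 8 [v1]"
    "P 1 2 [v0, cst 2 0] \<Longrightarrow> cst 2 0 = cst 1 K \<or> P 1 9 [v0]"
    "P 1 9 [v0] \<Longrightarrow> P 6 0 [cst 1 K, v0]"
    "P 1 9 [v0] \<Longrightarrow> P 1 2 [v1, v0] \<Longrightarrow> v0 = cst 1 K \<or> P 1 9 [v1]"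
    using * by auto
qed

lemma start_sem:
  assumes "t \<in> U"
  shows "P 3 (start M) [cst 1 K]" "P 0 K [cst 2 0]"
    "P 0 K [t] \<Longrightarrow> P 3 (accept M) [t] \<or> (\<exists>r<length ts. P 4 r [t])"
proof -
  obtain e where e: "e (nm 0 0) = t"
    and all: "\<forall>s\<in>set axs. sat S e s" using axs_hold[OF assms assms assms assms] by blast
  have "\<forall>s\<in>set start_axs. sat S e s" using all in_axs(4) by blast
  note * = this[unfolded start_axs_def, simplified, unfolded e]
  show "P 3 (start M) [cst 1 K]" "P 0 K [cst 2 0]"
    "P 0 K [t] \<Longrightarrow> P 3 (accept M) [t] \<or> (\<exists>r<length ts. P 4 r [t])"
    using * by auto
qed

lemma tape_sem:
  assumes "j < tapes M" "v0 \<in> U" "v1 \<in> U" "v2 \<in> U"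
  shows "P 5 j [cst 1 K, cst 2 0]" "P 5 j [v0, v1] \<Longrightarrow> P 5 j [v0, v2] \<Longrightarrow> v1 = v2"
proof -
  obtain e where e: "e (nm 0 0) = v0" "e (nm 0 (Suc 0)) = v1" "e (nm 0 2) = v2"
    and all: "\<forall>s\<in>set axs. sat S e s" using axs_hold[OF assms(2,3,4,4)] by blast
  have "\<forall>s\<in>set (tape_axs j). sat S e s" using all in_axs(10)[OF assms(1)] by blast
  note * = this[unfolded tape_axs_def, simplified, unfolded e]
  show "P 5 j [cst 1 K, cst 2 0]" "P 5 j [v0, v1] \<Longrightarrow> P 5 j [v0, v2] \<Longrightarrow> v1 = v2" using * by auto
qed

lemma empty_tape_sem:
  assumes "1 \<le> j" "j < tapes M" "x \<in> Lv K"
  shows "P (6 + j) 0 [cst 1 K, x]"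
proof -
  have x: "x \<in> U" using assms by (simp add: Lv_def)
  obtain e where e: "e (nm 0 0) = x"
    and all: "\<forall>s\<in>set axs. sat S e s" using axs_hold[OF x x x x] by blast
  have "sat S e (empty_tape_ax j)" using all in_axs(11)[OF assms(1,2)] by blast
  then show ?thesis using assms(3) by (simp add: empty_tape_ax_def e Lv_def)
qed

lemma state_sem:
  assumes "q \<in> set Qs" "q' \<in> set Qs" "t \<in> U" "P 3 q [t]" "P 3 q' [t]"
  shows "q = q'"
proof (rule ccontr)
  assume "q \<noteq> q'"
  then have p: "(q, q') \<in> set (distinct_pairs Qs)" using assms by (simp add: distinct_pairs_def)
  obtain e where e: "e (nm 0 0) = t"
    and all: "\<forall>s\<in>set axs. sat S e s" using axs_hold[OF assms(3,3,3,3)] by blast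
  have "sat S e (state_ax (q, q'))" using all in_axs(12)[OF p] by blast
  then show False using assms by (simp add: state_ax_def e)
qed

lemma symbol_sem:
  assumes "j < tapes M" "a \<in> set Gs" "b \<in> set Gs" "t \<in> U" "x \<in> U" "P (6 + j) a [t, x]" "P (6 + j) b [t, x]"
  shows "a = b"
proof (rule ccontr)
  assume "a \<noteq> b"
  then have p: "(a, b) \<in> set (distinct_pairs Gs)" using assms by (simp add: distinct_pairs_def)
  obtain e where e: "e (nm 0 0) = t" "e (nm 0 (Suc 0)) = x"
    and all: "\<forall>s\<in>set axs. sat S e s" using axs_hold[OF assms(4,5,5,5)] by blast
  have "sat S e (symbol_ax j (a, b))" using all in_axs(13)[OF assms(1) p] by blast
  then show False using assms by (simp add: symbol_ax_def e)
qed

lemma trans_sem: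
  assumes r: "r < length ts" "ts ! r = ((q, rs), (q', as))" and U: "t \<in> U" "t' \<in> U" "x \<in> U" "x' \<in> U"
    and R: "P 4 r [t]" and S: "P 1 2 [t, t']"
  shows "P 3 q [t]" "P 3 q' [t']"
    and "j < tapes M \<Longrightarrow> P 5 j [t, x] \<Longrightarrow> P (6 + j) (rs ! j) [t, x] \<and> P (6 + j) (fst (as ! j)) [t', x]"
    and "j < tapes M \<Longrightarrow> a \<in> set Gs \<Longrightarrow> P (6 + j) a [t, x] \<Longrightarrow> P 5 j [t, x] \<or> P (6 + j) a [t', x]"
    and "j < tapes M \<Longrightarrow> P 5 j [t, x] \<Longrightarrow> snd (as ! j) = Stay \<Longrightarrow> P 5 j [t', x]"
    and "j < tapes M \<Longrightarrow> P 5 j [t, x] \<Longrightarrow> snd (as ! j) = Go_Right \<Longrightarrow> P 1 2 [x, x'] \<Longrightarrow> P 5 j [t', x'] \<and> x' \<noteq> cst 1 K"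
    and "j < tapes M \<Longrightarrow> P 5 j [t, x] \<Longrightarrow> snd (as ! j) = Go_Left \<Longrightarrow> x \<noteq> cst 1 K"
    and "j < tapes M \<Longrightarrow> P 5 j [t, x] \<Longrightarrow> snd (as ! j) = Go_Left \<Longrightarrow> P 1 2 [x', x] \<Longrightarrow> P 5 j [t', x']"
proof -
  obtain e where e: "e (nm 0 0) = t" "e (nm 0 (Suc 0)) = t'" "e (nm 0 2) = x" "e (nm 0 3) = x'"
    and all: "\<forall>s\<in>set axs. sat S e s" using axs_hold[OF U] by blast
  have ax: "\<forall>s\<in>set (trans_axs r). sat S e s" using all in_axs(14)[OF r(1)] by blast
  then have "\<forall>s\<in>set (state_axs r). sat S e s" by (auto simp: trans_axs_def)
  then show "P 3 q [t]" "P 3 q' [t']" using R S by (simp_all add: state_axs_def e r)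
  have hd: "\<forall>s\<in>set (head_axs r j (rs ! j) (as ! j)). sat S e s" if "j < tapes M" for j
    using ax that by (auto simp: trans_axs_def r)
  have mv: "\<forall>s\<in>set (move_axs r j (snd (as ! j))). sat S e s" if "j < tapes M" for j
    using hd[OF that] by (auto simp: head_axs_def)
  show "j < tapes M \<Longrightarrow> P 5 j [t, x] \<Longrightarrow> P (6 + j) (rs ! j) [t, x] \<and> P (6 + j) (fst (as ! j)) [t', x]"
    using hd[of j] R S by (auto simp: head_axs_def e)
  show "j < tapes M \<Longrightarrow> a \<in> set Gs \<Longrightarrow> P (6 + j) a [t, x] \<Longrightarrow> P 5 j [t, x] \<or> P (6 + j) a [t', x]"
  proof -
    assume j: "j < tapes M" and a: "a \<in> set Gs" and C: "P (6 + j) a [t, x]"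
    have "sat S e ([pR r (v 0), pS (v 0) (v 1), pC j a (v 0) (v 2)], [pH j (v 0) (v 2), pC j a (v 1) (v 2)])"
      by (rule bspec[OF hd[OF j]]) (use a in \<open>auto simp: head_axs_def\<close>)
    then show ?thesis using R S C by (simp add: e)
  qed
  show "j < tapes M \<Longrightarrow> P 5 j [t, x] \<Longrightarrow> snd (as ! j) = Stay \<Longrightarrow> P 5 j [t', x]"
    using mv[of j] R S by (simp add: e)
  show "j < tapes M \<Longrightarrow> P 5 j [t, x] \<Longrightarrow> snd (as ! j) = Go_Right \<Longrightarrow> P 1 2 [x, x'] \<Longrightarrow> P 5 j [t', x'] \<and> x' \<noteq> cst 1 K"
    using mv[of j] R S by (simp add: e)
  show "j < tapes M \<Longrightarrow> P 5 j [t, x] \<Longrightarrow> snd (as ! j) = Go_Left \<Longrightarrow> x \<noteq> cst 1 K"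
    using mv[of j] R S by (simp add: e)
  show "j < tapes M \<Longrightarrow> P 5 j [t, x] \<Longrightarrow> snd (as ! j) = Go_Left \<Longrightarrow> P 1 2 [x', x] \<Longrightarrow> P 5 j [t', x']"
    using mv[of j] R S by (simp add: e)
qed

end

section \<open>The run shown by a model\<close>

locale cycle_model = sentence_model +
  fixes f :: "'a \<Rightarrow> 'a" and n m0 :: nat
  assumes f: "\<And>x. x \<in> Lv K \<Longrightarrow> f x \<in> Lv K \<and> P 1 2 [x, f x]"
    and period: "(f ^^ n) (cst 1 K) = cst 1 K"
    and inj: "inj_on (\<lambda>i. (f ^^ i) (cst 1 K)) {..<n}"
    and m0: "m0 < n" "(f ^^ m0) (cst 1 K) = cst 2 0"
begin

definition el :: "nat \<Rightarrow> 'a" where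
  "el i = (f ^^ i) (cst 1 K)"

text \<open>The cycle through zero is cut open at zero and read as a window of tape cells, with
  \<open>midc\<close> at coordinate 0 and zero at the left end.\<close>

definition inside :: "int \<Rightarrow> bool" where
  "inside h \<longleftrightarrow> 0 \<le> int m0 + h \<and> int m0 + h < int n"

definition pos :: "int \<Rightarrow> 'a" where
  "pos h = el (nat (int m0 + h))"

lemma el_Lv: "el i \<in> Lv K"
  by (induction i) (use z_Lv f in \<open>auto simp: el_def\<close>)

lemma el_U: "el i \<in> U" "pos h \<in> U" "P 0 K [el i]"
  using el_Lv unfolding pos_def by (auto simp: Lv_def)

lemma el_step: "P 1 2 [el i, el (Suc i)]"
  using f[OF el_Lv[of i]] by (simp add: el_def)

lemma el_eq_z: "i < n \<Longrightarrow> el i = cst 1 K \<longleftrightarrow> i = 0"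
  using inj_onD[OF inj, of i 0] m0 by (auto simp: el_def)

lemma pos_inject: "inside h \<Longrightarrow> inside h' \<Longrightarrow> pos h = pos h' \<longleftrightarrow> h = h'"
proof -
  assume h: "inside h" "inside h'"
  have "nat (int m0 + h) = nat (int m0 + h')" if "pos h = pos h'"
    by (rule inj_onD[OF inj]) (use that h in \<open>auto simp: pos_def el_def inside_def\<close>)
  then show ?thesis using h by (auto simp: inside_def)
qed

lemma pos_step: "inside h \<Longrightarrow> P 1 2 [pos h, pos (h + 1)]"
proof -
  assume "inside h"
  then have "nat (int m0 + (h + 1)) = Suc (nat (int m0 + h))" unfolding inside_def by linarith
  then show ?thesis using el_step unfolding pos_def by simp
qed

lemma inside_right: "inside h \<Longrightarrow> pos (h + 1) \<noteq> cst 1 K \<Longrightarrow> inside (h + 1)"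
proof (rule ccontr)
  assume h: "inside h" "pos (h + 1) \<noteq> cst 1 K" "\<not> inside (h + 1)"
  then have "nat (int m0 + (h + 1)) = n" by (auto simp: inside_def)
  then show False using h period by (simp add: pos_def el_def)
qed

lemma inside_left: "inside h \<Longrightarrow> pos h \<noteq> cst 1 K \<Longrightarrow> inside (h - 1)"
proof (rule ccontr)
  assume h: "inside h" "pos h \<noteq> cst 1 K" "\<not> inside (h - 1)"
  then have "nat (int m0 + h) = 0" by (auto simp: inside_def)
  then show False using h by (simp add: pos_def el_def)
qed

lemma pos_0: "pos 0 = cst 2 0" "inside 0"
  using m0 by (auto simp: pos_def el_def inside_def)

lemma pos_eq_z: "inside h \<Longrightarrow> pos h = cst 1 K \<Longrightarrow> int m0 + h = 0"
  using el_eq_z[of "nat (int m0 + h)"] by (auto simp: inside_def pos_def)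

text \<open>Cells outside the window have no position of their own in the model. Since the head is
  inside, they are not being scanned, and membership in \<open>Gs\<close> is all that is recorded
  about them.\<close>

definition shows_tape :: "nat \<Rightarrow> nat \<Rightarrow> tape \<Rightarrow> bool" where
  "shows_tape i j tp \<longleftrightarrow> inside (snd tp) \<and> P 5 j [el i, pos (snd tp)] \<and>
     (\<forall>h. fst tp h \<in> set Gs \<and> (inside h \<longrightarrow> P (6 + j) (fst tp h) [el i, pos h]))"

definition shows_config :: "nat \<Rightarrow> config \<Rightarrow> bool" where
  "shows_config i c \<longleftrightarrow> fst c \<in> set Qs \<and> P 3 (fst c) [el i] \<and> length (snd c) = tapes M \<and>
     (\<forall>j<tapes M. shows_tape i j (snd c ! j))"

lemma input_link:
  assumes "i \<le> length w"
  shows "inside (int i) \<and> P 1 7 [cst 0 i, pos (int i)]"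
  using assms
proof (induction i)
  case 0
  then show ?case using pos_0 blank_sem(1)[OF cst_U cst_U] by simp
next
  case (Suc i)
  then have i: "inside (int i)" "P 1 7 [cst 0 i, pos (int i)]" by auto
  have "w ! i \<in> set Gs" using w Suc.prems by auto
  from input_sem(1)[OF this cst_U el_U(2) cst_U el_U(2) i(2) chain_facts(1) pos_step[OF i(1)]] Suc.prems
  have "P 1 7 [cst 0 (Suc i), pos (int i + 1)]" "pos (int i + 1) \<noteq> cst 1 K" by auto
  then show ?case using inside_right[OF i(1)] by (simp add: add.commute)
qed

text \<open>Inside the window zero occurs only at the left end, so the exception for
  \<open>zK\<close> in \<open>blank_axs\<close> never stops the propagation to the right.\<close>

lemma right_blank: "inside (int (length w) + int d) \<Longrightarrow> P 1 8 [pos (int (length w) + int d)]"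
proof (induction d)
  case 0
  then show ?case using blank_sem(2)[OF cst_U el_U(2) _ chain_facts(2)] input_link[of "length w"] by simp
next
  case (Suc d)
  let ?h = "int (length w) + int d"
  have eq: "int (length w) + int (Suc d) = ?h + 1" by simp
  have i: "inside ?h" using Suc.prems by (auto simp: inside_def)
  have "pos (?h + 1) = cst 1 K \<or> P 1 8 [pos (?h + 1)]"
    using blank_sem(4)[OF el_U(2) el_U(2) Suc.IH[OF i] pos_step[OF i]] .
  moreover have "pos (?h + 1) \<noteq> cst 1 K"
    using pos_eq_z[of "?h + 1"] Suc.prems unfolding eq by auto
  ultimately show ?case unfolding eq by blast
qed

lemma left_blank: "inside (- int (Suc d)) \<Longrightarrow> P 1 9 [pos (- int (Suc d))]"
proof (induction d)
  case 0
  have "P 1 2 [pos (- 1), pos 0]" using pos_step[of "- 1"] 0 by simp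
  moreover have "cst 2 0 \<noteq> cst 1 K" using pos_eq_z[of 0] pos_0 0 by (auto simp: inside_def)
  ultimately show ?case using blank_sem(5)[OF el_U(2) el_U(2)] pos_0 by auto
next
  case (Suc d)
  let ?h = "- int (Suc d)"
  have i: "inside ?h" using Suc.prems m0 by (auto simp: inside_def)
  have s: "P 1 2 [pos (?h - 1), pos ?h]" using pos_step[of "?h - 1"] Suc.prems by simp
  have "pos ?h = cst 1 K \<or> P 1 9 [pos (?h - 1)]"
    using blank_sem(7)[OF el_U(2) el_U(2) Suc.IH[OF i] s] .
  moreover have "pos ?h \<noteq> cst 1 K"
    using pos_eq_z[OF i] Suc.prems by (auto simp: inside_def)
  ultimately show ?case by simp
qed

lemma shows_init: "shows_config 0 (init M w)"
proof -
  have T: "1 \<le> tapes M" using wf by (simp add: wf_tmachine_def)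
  have el0: "el 0 = cst 1 K" by (simp add: el_def)
  have head: "inside 0" "P 5 j [el 0, pos 0]" if "j < tapes M" for j
    using pos_0 tape_sem(1)[OF that cst_U cst_U cst_U] el0 by auto
  have input: "P 6 (word_tape w h) [el 0, pos h]" if h: "inside h" for h
  proof -
    consider d where "h = - int (Suc d)" | i where "h = int i" "i < length w" | d where "h = int (length w) + int d"
    proof -
      show ?thesis
        using that(1)[of "nat (- h - 1)"] that(2)[of "nat h"] that(3)[of "nat (h - int (length w))"] by linarith
    qed
    then show ?thesis
    proof cases
      case 1
      then show ?thesis using left_blank[of d] h blank_sem(6)[OF el_U(2) el_U(2)] el0 by (auto simp: word_tape_def)
    next
      case 2
      have "w ! i \<in> set Gs" using w 2 by auto
      from input_sem(2)[OF this cst_U el_U(2) cst_U el_U(2) _ chain_facts(1)] input_link[of i] 2 el0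
      show ?thesis by (auto simp: word_tape_def)
    next
      case 3
      then show ?thesis using right_blank[of d] h blank_sem(3)[OF el_U(2) el_U(2)] el0 by (auto simp: word_tape_def)
    qed
  qed
  have tp0: "shows_tape 0 0 (word_tape w, 0)"
    unfolding shows_tape_def using head[of 0] input T w Gs0 by (auto simp: word_tape_def)
  have tpj: "shows_tape 0 j (word_tape [], 0)" if "1 \<le> j" "j < tapes M" for j
    unfolding shows_tape_def using head[of j] that Gs0 empty_tape_sem[OF that el_Lv] el0
    by (auto simp: word_tape_def pos_def)
  show ?thesis unfolding shows_config_def
  proof (intro conjI allI impI)
    show "shows_tape 0 j (snd (init M w) ! j)" if "j < tapes M" for j
      using tp0 tpj[of j] that by (cases j) (auto simp: init_def)
  qed (use Qs0 start_sem(1)[OF cst_U] el0 T in \<open>auto simp: init_def\<close>)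
qed

text \<open>The axioms supply some transition at time i. Uniqueness of state and symbols shows that
  it is applicable to the configuration, and uniqueness of the head position leaves persistence as
  the only option for the cells that are not scanned.\<close>

lemma shows_step:
  assumes c: "shows_config i c" and acc: "fst c \<noteq> accept M"
  shows "\<exists>c'. step M c c' \<and> shows_config (Suc i) c'"
proof -
  have c': "fst c \<in> set Qs" "P 3 (fst c) [el i]" "length (snd c) = tapes M"
    and tp: "\<And>j. j < tapes M \<Longrightarrow> shows_tape i j (snd c ! j)" using c by (auto simp: shows_config_def)
  have "\<not> P 3 (accept M) [el i]" using state_sem[OF c'(1) Qs0(2) el_U(1) c'(2)] acc by blast
  then obtain r where r: "r < length ts" "P 4 r [el i]" using start_sem(3)[OF el_U(1) el_U(3), of i] by blast
  obtain q rs q' as where t: "ts ! r = ((q, rs), (q', as))" by (metis prod.collapse)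
  then have tr: "((q, rs), (q', as)) \<in> transitions M" using r ts by (metis nth_mem)
  then have len: "length rs = tapes M" "length as = tapes M" using wf by (auto simp: wf_tmachine_def)
  note sem = trans_sem[OF r(1) t el_U(1) el_U(1) el_U(2) el_U(2) r(2) el_step]
  have q: "q = fst c" using state_sem[OF _ c'(1) el_U(1) sem(1) c'(2)] Qs[OF tr] by blast
  have rs: "rs = map scan (snd c)"
  proof (rule nth_equalityI)
    show "length rs = length (map scan (snd c))" using len c' by simp
    fix j assume "j < length rs"
    then have j: "j < tapes M" using len by simp
    let ?tp = "snd c ! j"
    have h: "inside (snd ?tp)" "P 5 j [el i, pos (snd ?tp)]" "P (6 + j) (scan ?tp) [el i, pos (snd ?tp)]" "scan ?tp \<in> set Gs"
      using tp[OF j] by (auto simp: shows_tape_def scan_def)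
    have "rs ! j \<in> set Gs" using Gs[OF tr] j len by auto
    then have "rs ! j = scan ?tp"
      using symbol_sem[OF j _ h(4) el_U(1) el_U(2) _ h(3)] sem(3)[OF j h(2)] by blast
    then show "rs ! j = map scan (snd c) ! j" using j c' by simp
  qed
  define d where "d = (q', map2 act as (snd c))"
  have "step M c d" unfolding step_def d_def using tr q rs by auto
  moreover have "shows_config (Suc i) d"
    unfolding shows_config_def
  proof (intro conjI allI impI)
    show "fst d \<in> set Qs" using Qs[OF tr] by (simp add: d_def)
    show "P 3 (fst d) [el (Suc i)]" using sem(2) by (simp add: d_def)
    show "length (snd d) = tapes M" using len c' by (simp add: d_def)
    fix j assume j: "j < tapes M"
    define tp0 where "tp0 = snd c ! j"
    define hd where "hd = snd tp0"
    have h: "inside hd" "P 5 j [el i, pos hd]"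
      and cells: "\<And>h. fst tp0 h \<in> set Gs" "\<And>h. inside h \<Longrightarrow> P (6 + j) (fst tp0 h) [el i, pos h]"
      using tp[OF j] by (auto simp: shows_tape_def tp0_def hd_def)
    have a: "fst (as ! j) \<in> set Gs" using Gs[OF tr] j len by auto
    have d_j: "snd d ! j = ((fst tp0)(hd := fst (as ! j)), move_head (snd (as ! j)) hd)"
      using j len c' by (simp add: d_def act_def tp0_def hd_def)
    have head: "inside (move_head (snd (as ! j)) hd) \<and> P 5 j [el (Suc i), pos (move_head (snd (as ! j)) hd)]"
    proof (cases "snd (as ! j)")
      case Stay
      then show ?thesis using h sem(5)[OF j h(2)] by simp
    next
      case Go_Right
      then show ?thesis using sem(6)[OF j h(2) _ pos_step[OF h(1)]] inside_right[OF h(1)] by simp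
    next
      case Go_Left
      then have i: "inside (hd - 1)" using sem(7)[OF j h(2)] inside_left[OF h(1)] by simp
      have "P 1 2 [pos (hd - 1), pos hd]" using pos_step[OF i] by simp
      then show ?thesis using sem(8)[OF j h(2)] Go_Left i by simp
    qed
    have "P (6 + j) (fst tp0 h') [el (Suc i), pos h']" if "inside h'" "h' \<noteq> hd" for h'
    proof -
      have "\<not> P 5 j [el i, pos h']"
        using tape_sem(2)[OF j el_U(1) el_U(2) el_U(2) h(2)] pos_inject[OF h(1) that(1)] that(2) by blast
      then show ?thesis using sem(4)[OF j cells(1) cells(2)[OF that(1)]] by blast
    qed
    then show "shows_tape (Suc i) j (snd d ! j)"
      unfolding shows_tape_def d_j using head a cells(1) sem(3)[OF j h(2)] by auto
  qed
  ultimately show ?thesis by blast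
qed

text \<open>The number i is not bounded by the period: a step uses only the axioms at the current
  time, so the run may go round the cycle of times as often as needed.\<close>

lemma shows_run: "accepts M w \<or> (\<exists>c. reaches_in M i w c \<and> shows_config i c)"
proof (induction i)
  case 0
  then show ?case using shows_init by (auto simp: reaches_in_def)
next
  case (Suc i)
  then consider "accepts M w" | c where "reaches_in M i w c" "shows_config i c" by blast
  then show ?case
  proof cases
    case 2
    show ?thesis
    proof (cases "fst c = accept M")
      case True
      then show ?thesis using 2 unfolding accepts_def by blast
    next
      case False
      then show ?thesis using shows_step[OF 2(2)] 2(1) by (auto simp: reaches_in_def)
    qed
  qed blast
qed

end

context sentence_model
begin

text \<open>If the cycle of \<open>midc\<close> avoided zero, \<open>order_axs\<close> would put
  each of its elements strictly below the next, and by transitivity \<open>midc\<close> below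
  itself.\<close>

lemma cycle_exists: "\<exists>f n m0. cycle_model M K ts Gs Qs S w f n m0"
proof -
  obtain f n where f: "\<And>x. x \<in> Lv K \<Longrightarrow> f x \<in> Lv K \<and> P 1 2 [x, f x]" and inj: "inj_on f (Lv K)"
    and n: "n > 0" "(f ^^ n) (cst 1 K) = cst 1 K" "inj_on (\<lambda>i. (f ^^ i) (cst 1 K)) {..<n}"
    using good_cycle[of K] good_forced[of K] by blast
  have mid: "cst 2 0 \<in> Lv K" using start_sem(2)[OF cst_U] cst_U by (simp add: Lv_def)
  have it: "(f ^^ i) (cst 2 0) \<in> Lv K" for i by (induction i) (use mid f in auto)
  have fin: "finite (Lv K)" using good_forced[of K] by (simp add: good_def)
  obtain p where p: "p > 0" "(f ^^ p) (cst 2 0) = cst 2 0"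
    using finite_orbit[OF fin inj _ mid] f by blast
  have "\<exists>i\<le>p. (f ^^ i) (cst 2 0) = cst 1 K"
  proof (rule ccontr)
    assume "\<not> (\<exists>i\<le>p. (f ^^ i) (cst 2 0) = cst 1 K)"
    then have no: "(f ^^ i) (cst 2 0) \<noteq> cst 1 K" if "i \<le> p" for i using that by blast
    have "P 1 5 [cst 2 0, (f ^^ Suc i) (cst 2 0)]" if "Suc i \<le> p" for i
      using that
    proof (induction i)
      case 0
      then have "f (cst 2 0) \<noteq> cst 1 K" using no[of "Suc 0"] by simp
      then show ?case using order_sem(1)[of "cst 2 0" "f (cst 2 0)" "cst 2 0"] f[OF mid] mid
        by (auto simp: Lv_def)
    next
      case (Suc i)
      let ?x = "(f ^^ Suc i) (cst 2 0)"
      have x: "?x \<in> Lv K" using it by blast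
      have "f ?x \<noteq> cst 1 K" using no[of "Suc (Suc i)"] Suc.prems by simp
      then have "P 1 5 [?x, f ?x]" using order_sem(1)[of ?x "f ?x" ?x] f[OF x] x by (auto simp: Lv_def)
      then have "P 1 5 [cst 2 0, f ?x]"
        using order_sem(2)[of "cst 2 0" ?x "f ?x"] Suc.IH Suc.prems f[OF x] x mid by (auto simp: Lv_def)
      then show ?case by simp
    qed
    from this[of "p - 1"] p have "P 1 5 [cst 2 0, cst 2 0]" by simp
    then show False using order_sem(3)[OF cst_U cst_U cst_U] by blast
  qed
  then obtain i where i: "i \<le> p" "(f ^^ i) (cst 2 0) = cst 1 K" by blast
  \<comment> \<open>Zero is met after i of the p steps from \<open>midc\<close> back to itself, so
    the remaining p - i steps lead from zero to \<open>midc\<close>. Reduction modulo n brings the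
    index into the window.\<close>
  have "(f ^^ (p - i)) (cst 1 K) = cst 2 0"
    using p(2) i funpow_add[of "p - i" i f] by (simp add: fun_eq_iff flip: i(2))
  moreover have "(f ^^ (j mod n)) (cst 1 K) = (f ^^ j) (cst 1 K)" for j
    by (rule funpow_mod_eq[OF n(2)])
  ultimately have "(f ^^ ((p - i) mod n)) (cst 1 K) = cst 2 0" by simp
  then have "cycle_model M K ts Gs Qs S w f n ((p - i) mod n)"
    by unfold_locales (use f n in auto)
  then show ?thesis by blast
qed

text \<open>Without acceptance the model would show a run of T + 1 steps.\<close>

lemma model_accepts:
  assumes "all_runs_within M w T"
  shows "accepts M w"
proof -
  obtain f n m0 where "cycle_model M K ts Gs Qs S w f n m0" using cycle_exists by blast
  then interpret cycle_model M K ts Gs Qs S w f n m0 .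
  from shows_run[of "Suc T"] assms show ?thesis unfolding all_runs_within_def by fastforce
qed

end

section \<open>From accepting runs to models\<close>

lemma tower_mono: "a \<le> b \<Longrightarrow> tower k a \<le> tower k b"
  by (induction k) auto

lemma tower_add: "tower (j + k) m = tower j (tower k m)"
  by (induction j) auto

lemma add_le_mult_exp:
  fixes x y :: nat
  assumes "0 < x"
  shows "x + y \<le> x * 2 ^ y"
proof (induction y)
  case (Suc y)
  have "Suc (x * 2 ^ y) \<le> x * 2 ^ y + x * 2 ^ y" using assms by simp
  then show ?case using Suc by simp
qed simp

lemma tower_add_le: "tower k a + b \<le> tower k (a + b)"
proof (induction k)
  case (Suc k)
  have "tower (Suc k) a + b \<le> 2 ^ (tower k a + b)" using add_le_mult_exp[of "2 ^ tower k a" b] by (simp add: power_add)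
  also have "\<dots> \<le> 2 ^ tower k (a + b)" using Suc by simp
  finally show ?case by simp
qed simp

lemma le_tower: "m + k \<le> tower k m"
proof (induction k)
  case (Suc k)
  have "m + Suc k \<le> Suc (tower k m)" using Suc by simp
  also have "\<dots> \<le> 2 ^ tower k m" by (simp add: Suc_leI)
  finally show ?case by simp
qed simp

lemma poly_le_exp: "\<exists>D. \<forall>m. poly (p :: nat poly) m \<le> 2 ^ (D * Suc m)"
proof (induction p)
  case 0
  then show ?case by simp
next
  case (pCons a p)
  then obtain D where D: "poly p m \<le> 2 ^ (D * Suc m)" for m by blast
  have "poly (pCons a p) m \<le> 2 ^ ((a + 1 + D) * Suc m)" for m
  proof -
    have x: "x < 2 ^ x" for x :: nat by simp
    have "m * poly p m \<le> 2 ^ m * 2 ^ (D * Suc m)" by (rule mult_mono) (use D x[of m] in \<open>auto intro: less_imp_le\<close>)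
    then have 1: "m * poly p m \<le> 2 ^ (m + D * Suc m)" by (simp add: power_add)
    have "a + m * poly p m \<le> a + 2 ^ (m + D * Suc m)" using 1 by simp
    also have "\<dots> \<le> 2 ^ a * 2 ^ (m + D * Suc m)"
      using add_le_mult_exp[of "2 ^ (m + D * Suc m)" a] by (simp add: ac_simps)
    also have "\<dots> \<le> 2 ^ ((a + 1 + D) * Suc m)" unfolding power_add[symmetric]
      by (rule power_increasing) (auto simp: algebra_simps)
    finally show ?thesis by simp
  qed
  then show ?case by blast
qed

text \<open>The witness is K = k + 3 + D, where D bounds p(m) + m + 5 by an exponential of D(m + 1).
  A tower of height D + 2 over m + 1 is at least that bound, k levels are those of the running time,
  and one more pays for the factor 2.\<close>

lemma tower_dominates: "\<exists>K. \<forall>m. 2 * tower k (poly p m) + m + 3 < tower K (Suc m)"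
proof -
  \<comment> \<open>The added m + 5 absorbs the lower-order terms: for t = tower k (p(m)), 2t + m +
    3 < 2(t + m + 5) \<le> 2^(t + m + 5), and t + m + 5 stays below the tower over p(m) + m +
    5.\<close>
  obtain D where D: "poly (p + [:5, 1:]) m \<le> 2 ^ (D * Suc m)" for m using poly_le_exp by blast
  have "2 * tower k (poly p m) + m + 3 < tower (k + 3 + D) (Suc m)" for m
  proof -
    define t where "t = tower k (poly p m)"
    have dbl: "2 * x \<le> 2 ^ x" if "0 < x" for x :: nat
      using that
    proof (induction x)
      case (Suc x)
      show ?case
      proof (cases "x = 0")
        case False
        then have "2 \<le> (2 :: nat) ^ x" using self_le_power[of 2 x] by simp
        moreover have "2 * x \<le> 2 ^ x" using Suc.IH False by simp
        ultimately have "2 * x + 2 \<le> 2 ^ x + 2 ^ x" by (rule add_mono[rotated])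
        then show ?thesis by simp
      qed simp
    qed simp
    have "D * Suc m \<le> 2 ^ (D + Suc m)"
    proof -
      have "D * Suc m \<le> 2 ^ D * 2 ^ Suc m"
        by (rule mult_mono) (use less_exp[of D] less_exp[of "Suc m"] in \<open>auto simp del: power_Suc\<close>)
      then show ?thesis by (simp add: power_add)
    qed
    also have "\<dots> \<le> 2 ^ tower D (Suc m)" 
      by (rule power_increasing) (use le_tower[of "Suc m" D] in \<open>simp_all add: add.commute\<close>)
    finally have "(2 :: nat) ^ (D * Suc m) \<le> tower (Suc (Suc D)) (Suc m)" by simp
    then have "poly (p + [:5, 1:]) m \<le> tower (Suc (Suc D)) (Suc m)" using D[of m] by (rule le_trans[rotated])
    then have q: "poly p m + (m + 5) \<le> tower (2 + D) (Suc m)" by (simp add: add.commute)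
    have "2 * t + m + 3 < 2 * (t + m + 5)" by simp
    also have "\<dots> \<le> 2 ^ (t + m + 5)" by (rule dbl) simp
    also have "\<dots> \<le> 2 ^ tower k (poly p m + (m + 5))"
      using tower_add_le[of k "poly p m" "m + 5"] by (simp add: t_def add.assoc)
    also have "\<dots> = tower (Suc k) (poly p m + (m + 5))" by simp
    also have "\<dots> \<le> tower (Suc k) (tower (2 + D) (Suc m))" by (rule tower_mono[OF q])
    also have "\<dots> = tower (k + 3 + D) (Suc m)" by (simp only: tower_add[symmetric]) (simp add: eval_nat_numeral)
    finally show ?thesis by (simp add: t_def)
  qed
  then show ?thesis by blast
qed

lemma bits_eqI:
  assumes "a < 2 ^ n" "b < 2 ^ n" "\<And>i. i < n \<Longrightarrow> bit a i = bit b i"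
  shows "a = (b :: nat)"
proof -
  have "take_bit n a = take_bit n b" using assms(3) by (intro bit_eqI) (auto simp: bit_take_bit_iff)
  then show ?thesis using assms(1,2) by (simp add: take_bit_nat_eq_self)
qed

section \<open>The intended model of an accepting run\<close>

locale accepting_run = machine_simulation +
  fixes w :: word and n :: nat and c :: "nat \<Rightarrow> config" and \<rho> :: "nat \<Rightarrow> nat"
  assumes init: "c 0 = init M w"
    and trans: "\<And>i. i < n \<Longrightarrow> \<rho> i < length ts \<and> fst (ts ! \<rho> i) = (fst (c i), map scan (snd (c i))) \<and>
      fst (snd (ts ! \<rho> i)) = fst (c (Suc i)) \<and> snd (c (Suc i)) = map2 act (snd (snd (ts ! \<rho> i))) (snd (c i))"
    and acc: "fst (c n) = accept M"
    and room: "2 * n + length w + 3 < tower K (Suc (length w))"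
begin

abbreviation "tw l \<equiv> tower l (Suc (length w))"

definition Dom :: "(nat \<times> nat) set" where
  "Dom = {(l, x). l \<le> K \<and> x < tw l}"

definition sc :: "nat \<times> nat \<Rightarrow> nat \<times> nat" where
  "sc x = (fst x, Suc (snd x) mod tw (fst x))"

definition J :: "nat \<times> nat \<Rightarrow> nat \<times> nat \<Rightarrow> bool" where
  "J x b \<longleftrightarrow> fst x = Suc (fst b) \<and> bit (snd x) (snd b)"

definition agree :: "nat \<times> nat \<Rightarrow> nat \<times> nat \<Rightarrow> nat \<times> nat \<Rightarrow> bool" where
  "agree x y b \<longleftrightarrow> (\<forall>i\<le>snd b. J x (fst b, i) = J y (fst b, i))"

text \<open>From time n on the configuration is frozen and \<open>pR\<close> fails, so the axioms
  about single steps are void there. In particular they say nothing about the step that wraps round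
  from the last time to zero.\<close>

definition cf :: "nat \<Rightarrow> config" where
  "cf i = c (min i n)"

text \<open>A head moves at most n cells away from its start, so from n + 1 it never comes to
  position 0. The assumption \<open>room\<close> keeps it, and the input, below the last
  position.\<close>

definition mid :: nat where
  "mid = Suc n"

definition rel_val :: "nat \<Rightarrow> nat \<Rightarrow> (nat \<times> nat) list \<Rightarrow> bool" where
  "rel_val i j us = (let x = us ! 0; y = us ! 1; z = us ! 2 in
     if i = 0 then fst x = j
     else if i = 1 then
       (if j = 0 then J x y else if j = 1 then J (sc x) y else if j = 2 then y = sc x
        else if j = 3 then agree x y z else if j = 4 then agree (sc x) y z
        else if j = 5 then fst x = K \<and> fst y = K \<and> snd x < snd y
        else if j = 6 then x = (0, length w) \<and> y = (0, length w)
        else if j = 7 then \<exists>k\<le>length w. x = (0, k) \<and> y = (K, mid + k)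
        else if j = 8 then fst x = K \<and> mid + length w \<le> snd x
        else fst x = K \<and> snd x < mid)
     else if i = 2 then \<exists>k<length w. w ! k = j \<and> x = (0, k) \<and> y = (0, Suc k)
     else if i = 3 then fst x = K \<and> fst (cf (snd x)) = j
     else if i = 4 then fst x = K \<and> snd x < n \<and> \<rho> (snd x) = j
     else if i = 5 then fst x = K \<and> fst y = K \<and> int (snd y) = int mid + snd (snd (cf (snd x)) ! j)
     else fst x = K \<and> fst y = K \<and> fst (snd (cf (snd x)) ! (i - 6)) (int (snd y) - int mid) = j)"

text \<open>The minima put every constant symbol into the domain, also those that do not occur in
  the sentence, as \<open>is_structure\<close> demands.\<close>

definition const_val :: "nat \<Rightarrow> nat \<Rightarrow> nat \<times> nat" where
  "const_val i j = (if i = 0 then (0, min j (length w)) else if i = 1 then (min j K, 0) else (K, mid))"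

definition run_model :: "(nat \<times> nat) fo_structure" where
  "run_model = \<lparr>universe = Dom, fun_int = (\<lambda>f us. const_val (nm_tag f) (nm_idx f)),
          pred_int = (\<lambda>p us. rel_val (nm_tag p) (nm_idx p) us)\<rparr>"

lemma run_model_simps [simp]: "universe run_model = Dom" "fun_int run_model (nm i j) us = const_val i j" "pred_int run_model (nm i j) us = rel_val i j us"
  by (simp_all add: run_model_def)

lemma const_val_simps [simp]: "const_val 0 j = (0, min j (length w))" "const_val (Suc 0) j = (min j K, 0)" "const_val 2 j = (K, mid)"
  by (simp_all add: const_val_def)

lemma rel_val_simps [simp]:
  "rel_val 0 l [x] \<longleftrightarrow> fst x = l"
  "rel_val (Suc 0) 0 [x, y] \<longleftrightarrow> J x y"
  "rel_val (Suc 0) (Suc 0) [x, y] \<longleftrightarrow> J (sc x) y"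
  "rel_val (Suc 0) 2 [x, y] \<longleftrightarrow> y = sc x"
  "rel_val (Suc 0) 3 [x, y, z] \<longleftrightarrow> agree x y z"
  "rel_val (Suc 0) 4 [x, y, z] \<longleftrightarrow> agree (sc x) y z"
  "rel_val (Suc 0) 5 [x, y] \<longleftrightarrow> fst x = K \<and> fst y = K \<and> snd x < snd y"
  "rel_val (Suc 0) 6 [x, y] \<longleftrightarrow> x = (0, length w) \<and> y = (0, length w)"
  "rel_val (Suc 0) 7 [x, y] \<longleftrightarrow> (\<exists>k\<le>length w. x = (0, k) \<and> y = (K, mid + k))"
  "rel_val (Suc 0) 8 [x] \<longleftrightarrow> fst x = K \<and> mid + length w \<le> snd x"
  "rel_val (Suc 0) 9 [x] \<longleftrightarrow> fst x = K \<and> snd x < mid"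
  "rel_val 2 a [x, y] \<longleftrightarrow> (\<exists>k<length w. w ! k = a \<and> x = (0, k) \<and> y = (0, Suc k))"
  "rel_val 3 q [x] \<longleftrightarrow> fst x = K \<and> fst (cf (snd x)) = q"
  "rel_val 4 r [x] \<longleftrightarrow> fst x = K \<and> snd x < n \<and> \<rho> (snd x) = r"
  "rel_val 5 j [x, y] \<longleftrightarrow> fst x = K \<and> fst y = K \<and> int (snd y) = int mid + snd (snd (cf (snd x)) ! j)"
  "rel_val (6 + j) a [x, y] \<longleftrightarrow> fst x = K \<and> fst y = K \<and> fst (snd (cf (snd x)) ! j) (int (snd y) - int mid) = a"
  "rel_val 6 a [x, y] \<longleftrightarrow> fst x = K \<and> fst y = K \<and> fst (snd (cf (snd x)) ! 0) (int (snd y) - int mid) = a"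
  by (simp_all add: rel_val_def)

lemma tw_pos: "0 < tw l"
  using le_tower[of "Suc (length w)" l] by linarith

lemma fst_sc [simp]: "fst (sc x) = fst x"
  by (simp add: sc_def)

lemma sc_Dom: "x \<in> Dom \<Longrightarrow> sc x \<in> Dom"
  using tw_pos by (auto simp: Dom_def sc_def)

lemma sc_cases: "x \<in> Dom \<Longrightarrow> (Suc (snd x) = tw (fst x) \<and> sc x = (fst x, 0)) \<or> (Suc (snd x) < tw (fst x) \<and> sc x = (fst x, Suc (snd x)))"
  by (cases "Suc (snd x) = tw (fst x)") (auto simp: Dom_def sc_def)

lemma sc_inj: "x \<in> Dom \<Longrightarrow> y \<in> Dom \<Longrightarrow> sc x = sc y \<Longrightarrow> x = y"
  using sc_cases[of x] sc_cases[of y] by (auto simp: prod_eq_iff)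

lemma const_val_Dom: "const_val i j \<in> Dom"
proof -
  have "length w < tw 0" by simp
  moreover have "mid < tw K" using room by (simp add: mid_def)
  ultimately show ?thesis using tw_pos by (auto simp: const_val_def Dom_def)
qed

text \<open>As \<open>sc b\<close> is the zero of level l, b is the last bit position and agreement
  up to b covers all \<open>tw l\<close> bits, hence all bits of numbers on level l + 1.\<close>

lemma agree_all:
  assumes "x \<in> Dom" "y \<in> Dom" "b \<in> Dom" "fst x = Suc l" "fst y = Suc l" "sc b = (l, 0)" "agree x y b"
  shows "x = y"
proof -
  have b: "fst b = l" "Suc (snd b) = tw l" using sc_cases[OF assms(3)] assms(6) by auto
  have "bit (snd x) i = bit (snd y) i" if "i < tw l" for i
    using assms(4,5,7) that b(2)[symmetric] unfolding agree_def J_def b(1) by simp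
  moreover have "snd x < 2 ^ tw l" "snd y < 2 ^ tw l" using assms by (auto simp: Dom_def)
  ultimately have "snd x = snd y" using bits_eqI by blast
  then show ?thesis using assms by (simp add: prod_eq_iff)
qed

lemma transition_tapes: "\<tau> \<in> transitions M \<Longrightarrow> length (snd (snd \<tau>)) = tapes M"
  using wf unfolding wf_tmachine_def by (cases \<tau>) fastforce

lemma c_tapes: "i \<le> n \<Longrightarrow> length (snd (c i)) = tapes M"
proof (induction i)
  case 0
  have "1 \<le> tapes M" using wf by (simp add: wf_tmachine_def)
  then show ?case using init by (simp add: init_def)
next
  case (Suc i)
  then have t: "ts ! \<rho> i \<in> transitions M" using trans[of i] ts by (metis Suc_le_lessD nth_mem)
  have "length (snd (snd (ts ! \<rho> i))) = tapes M" using transition_tapes[OF t] .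
  then show ?case using trans[of i] Suc by simp
qed

lemma c_step:
  assumes "i < n" "j < tapes M"
  shows "snd (c (Suc i)) ! j = act (snd (snd (ts ! \<rho> i)) ! j) (snd (c i) ! j)"
proof -
  have t: "ts ! \<rho> i \<in> transitions M" using trans[of i] assms ts by (metis nth_mem)
  have "length (snd (snd (ts ! \<rho> i))) = tapes M" using transition_tapes[OF t] .
  then show ?thesis using trans[of i] assms c_tapes[of i] by simp
qed

lemma c_scan:
  assumes "i < n" "j < tapes M"
  shows "snd (fst (ts ! \<rho> i)) ! j = fst (snd (c i) ! j) (snd (snd (c i) ! j))"
  using trans[of i] assms c_tapes[of i] by (simp add: scan_def)

lemma c_head: "i \<le> n \<Longrightarrow> j < tapes M \<Longrightarrow> \<bar>snd (snd (c i) ! j)\<bar> \<le> int i"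
proof (induction i)
  case 0
  then show ?case using init by (cases j) (auto simp: init_def)
next
  case (Suc i)
  then have "snd (snd (c (Suc i)) ! j) = move_head (snd (snd (snd (ts ! \<rho> i)) ! j)) (snd (snd (c i) ! j))"
    using c_step[of i j] by (simp add: act_def)
  then show ?case using Suc by (cases "snd (snd (snd (ts ! \<rho> i)) ! j)") auto
qed

lemma c_head_pos:
  assumes "i < n" "j < tapes M"
  shows "0 < int mid + snd (snd (c i) ! j)" "int mid + snd (snd (c i) ! j) + 1 < int (tw K)"
  using c_head[of i j] assms room by (auto simp: mid_def)

lemma cf_simps: "cf 0 = init M w" "i \<le> n \<Longrightarrow> cf i = c i" "n \<le> i \<Longrightarrow> cf i = c n"
  using init by (auto simp: cf_def min_def)

lemma init_tapes: "j < tapes M \<Longrightarrow> snd (init M w) ! j = (word_tape (if j = 0 then w else []), 0)"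
  by (cases j) (auto simp: init_def)

lemma time_sc: "fst t = K \<Longrightarrow> snd t < n \<Longrightarrow> sc t = (K, Suc (snd t))"
  using room by (simp add: sc_def)

lemma sat_base: "range e \<subseteq> Dom \<Longrightarrow> s \<in> set base_axs \<Longrightarrow> sat run_model e s"
proof -
  assume e: "range e \<subseteq> Dom" and s: "s \<in> set base_axs"
  then have D: "e x \<in> Dom" for x by blast
  \<comment> \<open>If \<open>sc b\<close> wraps round to zero, agreement up to it concerns bit 0
    alone, which is the second assumption.\<close>
  have 1: "agree x y (sc b)" if "agree x y b" "J x (sc b) = J y (sc b)" "b \<in> Dom" for x y b
    using that sc_cases[of b] by (auto simp: agree_def le_Suc_eq)
  have sc0: "sc (0, length w) = (0, 0)" by (simp add: sc_def)
  note facts = sc_inj[OF D[of "nm 0 0"] D[of "nm 0 (Suc 0)"]]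
    1[of "e (nm 0 0)" "e (nm 0 (Suc 0))", OF _ _ D[of "nm 0 2"]]
    1[of "sc (e (nm 0 0))" "e (nm 0 (Suc 0))", OF _ _ D[of "nm 0 2"]]
  from s show ?thesis unfolding base_axs_def list.set insert_iff empty_iff
    by (elim disjE) (simp_all add: sc0, (use facts in metis)+)
qed

lemma sat_letter: "s \<in> set (letter_axs a) \<Longrightarrow> sat run_model e s"
  unfolding letter_axs_def by (auto simp: sc_def)

lemma sat_order:
  assumes "range e \<subseteq> Dom" "s \<in> set order_axs"
  shows "sat run_model e s"
proof -
  have D: "e x \<in> Dom" for x using assms by blast
  show ?thesis using sc_cases[OF D[of "nm 0 0"]] assms(2) unfolding order_axs_def by auto
qed

lemma sat_level:
  assumes "range e \<subseteq> Dom" "l < K" "s \<in> set (level_axs l)"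
  shows "sat run_model e s"
proof -
  have D: "e x \<in> Dom" for x using assms by blast
  have 1: "e (nm 0 0) = e (nm 0 (Suc 0))"
    if "fst (e (nm 0 0)) = Suc l" "fst (e (nm 0 (Suc 0))) = Suc l" "(l, 0) = sc (e (nm 0 2))"
      "agree (e (nm 0 0)) (e (nm 0 (Suc 0))) (e (nm 0 2))"
    using agree_all[OF D D D that(1,2)] that(3,4) by simp
  have 2: "e (nm 0 (Suc 0)) = sc (e (nm 0 0))"
    if "fst (e (nm 0 0)) = Suc l" "fst (e (nm 0 (Suc 0))) = Suc l" "(l, 0) = sc (e (nm 0 2))"
      "agree (sc (e (nm 0 0))) (e (nm 0 (Suc 0))) (e (nm 0 2))"
    using agree_all[OF sc_Dom[OF D] D D _ that(2)] that(1,3,4) by fastforce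
  show ?thesis using assms(2,3) 1 2 unfolding level_axs_def by (auto simp: agree_def)
qed

lemma sat_sort:
  assumes "l \<le> K" "s \<in> set (sort_axs l)" "e (nm 2 l) = e (nm 1 l)" "e (nm 3 l) = sc (e (nm 1 l))"
  shows "sat run_model e s"
  using assms unfolding sort_axs_def by (auto simp: sc_def)

lemma sat_game:
  assumes "s \<in> set (game_axs l)" "e (nm 2 l) = e (nm 1 l)"
    "e (nm 2 (Suc l)) = e (nm 1 (Suc l))" "e (nm 3 (Suc l)) = sc (e (nm 1 (Suc l)))"
  shows "sat run_model e s"
  using assms unfolding game_axs_def Let_def by auto

lemma tapes_pos: "0 < tapes M"
  using wf by (simp add: wf_tmachine_def)

lemma sat_blank:
  assumes "range e \<subseteq> Dom" "s \<in> set blank_axs"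
  shows "sat run_model e s"
proof -
  have D: "e x \<in> Dom" for x using assms by blast
  have t0: "fst (snd (cf 0) ! 0) = word_tape w" using init_tapes[of 0] tapes_pos by (simp add: cf_simps)
  have up: "fst x = K \<Longrightarrow> sc x = (K, 0) \<or> snd (sc x) = Suc (snd x)" if "x \<in> Dom" for x
    using sc_cases[OF that] by auto
  have mid: "(K, mid) = sc x \<longrightarrow> fst x = K \<and> snd x < mid" if "x \<in> Dom" for x
    using sc_cases[OF that] by (auto simp: mid_def)
  have r: "word_tape w (int (snd x) - int mid) = 0" if "mid + length w \<le> snd x" for x :: "nat \<times> nat"
    using that by (simp add: word_tape_def)
  have l: "word_tape w (int (snd x) - int mid) = 0" if "snd x < mid" for x :: "nat \<times> nat"
    using that by (simp add: word_tape_def)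
  from assms(2) show ?thesis unfolding blank_axs_def list.set insert_iff empty_iff
    using up[OF D[of "nm 0 0"]] up[OF D[of "nm 0 (Suc 0)"]] mid[OF D[of "nm 0 0"]]
    by (elim disjE) (simp_all add: t0 r l, auto)
qed

lemma sat_input:
  assumes "range e \<subseteq> Dom" "s \<in> set (input_axs a)"
  shows "sat run_model e s"
proof -
  have D: "e x \<in> Dom" for x using assms by blast
  have t0: "fst (snd (cf 0) ! 0) = word_tape w" using init_tapes[of 0] tapes_pos by (simp add: cf_simps)
  have sc: "sc (K, mid + k) = (K, mid + Suc k)" if "k < length w" for k
    using room that by (simp add: sc_def mid_def)
  show ?thesis using assms(2) sc unfolding input_axs_def
    by (auto simp: t0 word_tape_def mid_def)
qed

lemma sat_start:
  assumes "s \<in> set start_axs"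
  shows "sat run_model e s"
proof -
  have 1: "fst (cf i) = accept M \<or> (\<exists>r<length ts. i < n \<and> \<rho> i = r)" for i
    using trans[of i] acc cf_simps(3)[of i] by (cases "i < n") auto
  show ?thesis using assms 1[of "snd (e (nm 0 0))"] unfolding start_axs_def
    by (auto simp: cf_simps init_def)
qed

lemma sat_tape: "j < tapes M \<Longrightarrow> s \<in> set (tape_axs j) \<Longrightarrow> sat run_model e s"
  unfolding tape_axs_def list.set insert_iff empty_iff
  by (elim disjE) (simp_all add: cf_simps init_tapes, simp add: prod_eq_iff)

lemma sat_empty_tape: "1 \<le> j \<Longrightarrow> j < tapes M \<Longrightarrow> sat run_model e (empty_tape_ax j)"
  unfolding empty_tape_ax_def by (auto simp: cf_simps init_tapes word_tape_def)

lemma sat_state: "p \<in> set (distinct_pairs xs) \<Longrightarrow> sat run_model e (state_ax p)"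
  unfolding state_ax_def distinct_pairs_def by auto

lemma sat_symbol: "p \<in> set (distinct_pairs xs) \<Longrightarrow> sat run_model e (symbol_ax j p)"
  unfolding symbol_ax_def distinct_pairs_def by auto

lemma sat_trans:
  assumes "range e \<subseteq> Dom" "s \<in> set (trans_axs r)"
  shows "sat run_model e s"
proof -
  have D: "e x \<in> Dom" for x using assms by blast
  define i where "i = snd (e (nm 0 0))"
  consider "s \<in> set (state_axs r)"
    | j where "j < tapes M" "s \<in> set (head_axs r j (snd (fst (ts ! r)) ! j) (snd (snd (ts ! r)) ! j))"
    using assms(2) by (auto simp: trans_axs_def)
  then show ?thesis
  proof cases
    case 1
    then show ?thesis using trans[of i] time_sc[of "e (nm 0 0)"] unfolding state_axs_def by (auto simp: i_def cf_simps)
  next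
    case (2 j)
    show ?thesis
    proof (cases "fst (e (nm 0 0)) = K \<and> i < n \<and> \<rho> i = r")
      \<comment> \<open>\<open>pR r\<close> is a premise of all sequents in \<open>head_axs\<close>,
        so nothing is to be checked at times at which r is not taken.\<close>
      case False
      then have R: "\<not> holds_atm run_model e (pR r (v 0))" by (auto simp: i_def)
      have mv: "pR r (v 0) \<in> set (fst s)" if "s \<in> set (move_axs r j m)" for m
        using that by (cases m) auto
      have "pR r (v 0) \<in> set (fst s)" using 2(2) mv unfolding head_axs_def by auto
      then show ?thesis using R by (cases s) auto
    next
      case True
      let ?tp = "snd (c i) ! j" and ?a = "snd (snd (ts ! r)) ! j"
      have t: "e (nm 0 0) = (K, i)" using True by (simp add: i_def prod_eq_iff)
      have sct: "sc (K, i) = (K, Suc i)" using time_sc[of "(K, i)"] True by simp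
      have cfi: "cf i = c i" "cf (Suc i) = c (Suc i)" using True by (auto simp: cf_simps)
      have tp': "snd (c (Suc i)) ! j = ((fst ?tp)(snd ?tp := fst ?a), move_head (snd ?a) (snd ?tp))"
        using c_step[of i j] True 2(1) by (simp add: act_def)
      have rd: "snd (fst (ts ! r)) ! j = fst ?tp (snd ?tp)" using c_scan[of i j] True 2(1) by simp
      note hp = c_head_pos[of i j, OF _ 2(1)]
      \<comment> \<open>The head is not on zero and, by \<open>hp\<close>, not on the last position
        either, so its neighbours are found without wrapping round and no forbidden crossing
        occurs.\<close>
      have z: "e (nm 0 2) \<noteq> (K, 0)" if "int (snd (e (nm 0 2))) = int mid + snd ?tp" using that hp True by auto
      have mv: ?thesis if "s \<in> set (move_axs r j (snd ?a))"
        using that True hp z sc_cases[OF D[of "nm 0 2"]] sc_cases[OF D[of "nm 0 3"]]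
        by (cases "snd ?a") (auto simp: t sct cfi tp')
      show ?thesis using 2(2) mv unfolding head_axs_def
        by (auto simp: t sct cfi tp' rd)
    qed
  qed
qed

lemma sat_axs:
  assumes e: "range e \<subseteq> Dom" and y: "\<And>l. l \<le> K \<Longrightarrow> e (nm 2 l) = e (nm 1 l) \<and> e (nm 3 l) = sc (e (nm 1 l))"
  shows "\<forall>s\<in>set axs. sat run_model e s"
  unfolding axs_def set_append ball_Un set_concat set_map ball_UN ball_simps
proof (intro conjI ballI)
  show "sat run_model e s" if "l \<in> set [0..<Suc K]" "s \<in> set (sort_axs l)" for s l
    using sat_sort[of l s e] that y by (auto simp del: upt_Suc)
  show "sat run_model e s" if "l \<in> set [0..<K]" "s \<in> set (game_axs l)" for s l
    using sat_game[of s l e] that y by auto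
qed (use sat_base[OF e] sat_order[OF e] sat_blank[OF e] sat_start sat_letter sat_input[OF e] sat_level[OF e] sat_tape
  sat_empty_tape sat_state sat_symbol sat_trans[OF e] in auto)

text \<open>Copying the move and answering with its successor wins the game here. What is played on
  level m survives the inner blocks because they bind only variables of lower levels.\<close>

lemma close_strategy:
  assumes "range e \<subseteq> Dom"
    and "\<And>e'. range e' \<subseteq> Dom \<Longrightarrow> (\<forall>x. x \<notin> bv m \<longrightarrow> e' x = e x) \<Longrightarrow>
      (\<forall>l<m. e' (nm 2 l) = e' (nm 1 l) \<and> e' (nm 3 l) = sc (e' (nm 1 l))) \<Longrightarrow> holds run_model e' \<psi>"
  shows "holds run_model e (close_prefix (blks m) \<psi>)"
  using assms
proof (induction m arbitrary: e)
  case 0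
  then show ?case by (simp add: blks_def)
next
  case (Suc m)
  have "holds run_model (e(nm 1 m := a, nm 2 m := a, nm 3 m := sc a)) (close_prefix (blks m) \<psi>)" if a: "a \<in> Dom" for a
  proof (rule Suc.IH)
    let ?e = "e(nm 1 m := a, nm 2 m := a, nm 3 m := sc a)"
    show "range ?e \<subseteq> Dom" using Suc.prems(1) a sc_Dom by auto
    fix e' assume e': "range e' \<subseteq> Dom" "\<forall>x. x \<notin> bv m \<longrightarrow> e' x = ?e x"
      "\<forall>l<m. e' (nm 2 l) = e' (nm 1 l) \<and> e' (nm 3 l) = sc (e' (nm 1 l))"
    have "nm i m \<notin> bv m" for i by (simp add: nm_bv)
    then have "e' (nm 1 m) = a" "e' (nm 2 m) = a" "e' (nm 3 m) = sc a" using e'(2) by auto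
    moreover have "\<forall>x. x \<notin> bv (Suc m) \<longrightarrow> e' x = e x" using e'(2) by (auto simp: bv_Suc)
    ultimately show "holds run_model e' \<psi>" using Suc.prems(2)[OF e'(1)] e'(3) by (auto simp: less_Suc_eq)
  qed
  then show ?case unfolding close_blks_Suc holds.simps run_model_simps using sc_Dom by blast
qed

lemma model_sentence: "models run_model (sentence w)"
  unfolding models_def
proof (intro conjI allI impI)
  show "is_structure run_model" unfolding is_structure_def using const_val_Dom by (auto simp: run_model_def)
  fix e :: "name \<Rightarrow> nat \<times> nat" assume "range e \<subseteq> universe run_model"
  then have e: "range e \<subseteq> Dom" by simp
  have *: "holds run_model e (close_prefix (blks (Suc K)) (matrix w))" if e: "range e \<subseteq> Dom" for e :: "name \<Rightarrow> nat \<times> nat"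
  proof (rule close_strategy[OF e])
    fix e' assume e': "range e' \<subseteq> Dom" "\<forall>l<Suc K. e' (nm 2 l) = e' (nm 1 l) \<and> e' (nm 3 l) = sc (e' (nm 1 l))"
    have "e' (nm 1 0) \<in> Dom" using e'(1) by blast
    then have "\<exists>i\<le>length w. e' (nm 1 0) = (0, min i (length w))" if "fst (e' (nm 1 0)) = 0"
      using that by (auto simp: Dom_def intro!: exI[of _ "snd (e' (nm 1 0))"] prod_eqI split: prod.splits)
    then show "holds run_model e' (matrix w)"
      unfolding holds_matrix using sat_axs[OF e'(1)] e'(2) by auto
  qed
  have eq: "sentence w = All (nm 0 0) (All (nm 0 1) (All (nm 0 2) (All (nm 0 3) (close_prefix (blks (Suc K)) (matrix w)))))"
    by (simp add: sentence_def prefix_def close_blks_Suc numeral_eq_Suc)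
  show "holds run_model e (sentence w)" unfolding eq holds.simps run_model_simps
    by (intro ballI, rule *) (use e in auto)
qed

end

section \<open>Correctness of the reduction and hardness\<close>

context machine_simulation
begin

lemma accepts_satisfiable:
  assumes "accepts M w" "all_runs_within M w T" "2 * T + length w + 3 < tower K (Suc (length w))"
  shows "satisfiable (sentence w)"
proof -
  obtain n d where d: "reaches_in M n w d" "fst d = accept M" using assms(1) by (auto simp: accepts_def)
  then have n: "n \<le> T" using assms(2) unfolding all_runs_within_def by blast
  from d(1) obtain c where c: "c 0 = init M w" "c n = d" "\<forall>i<n. step M (c i) (c (Suc i))"
    unfolding reaches_in_def relpowp_fun_conv by blast
  have "\<exists>r. r < length ts \<and> fst (ts ! r) = (fst (c i), map scan (snd (c i))) \<and>
      fst (snd (ts ! r)) = fst (c (Suc i)) \<and> snd (c (Suc i)) = map2 act (snd (snd (ts ! r))) (snd (c i))" if i: "i < n" for i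
  proof -
    obtain as where as: "((fst (c i), map scan (snd (c i))), (fst (c (Suc i)), as)) \<in> set ts"
      "snd (c (Suc i)) = map2 act as (snd (c i))"
      using c(3) i ts unfolding step_def by blast
    then obtain r where "r < length ts" "ts ! r = ((fst (c i), map scan (snd (c i))), (fst (c (Suc i)), as))"
      by (meson in_set_conv_nth)
    then show ?thesis using as by auto
  qed
  then obtain \<rho> where \<rho>: "\<forall>i<n. \<rho> i < length ts \<and> fst (ts ! \<rho> i) = (fst (c i), map scan (snd (c i))) \<and>
      fst (snd (ts ! \<rho> i)) = fst (c (Suc i)) \<and> snd (c (Suc i)) = map2 act (snd (snd (ts ! \<rho> i))) (snd (c i))"
    by metis
  interpret accepting_run M K ts Gs Qs w n c \<rho>
    by unfold_locales (use c \<rho> d n assms(3) in auto)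
  \<comment> \<open>The model has pairs of numbers as elements, while \<open>satisfiable\<close>
    asks for natural numbers.\<close>
  show ?thesis using satisfiable_of_model[OF model_sentence] .
qed

lemma satisfiable_accepts:
  assumes "satisfiable (sentence w)" "all_runs_within M w T" "set w \<subseteq> set Gs"
  shows "accepts M w"
proof -
  obtain S :: "nat fo_structure" where "models S (sentence w)" using assms(1) by (auto simp: satisfiable_def)
  then interpret sentence_model M K ts Gs Qs S w by unfold_locales (use assms in auto)
  show ?thesis using model_accepts[OF assms(2)] .
qed

end

theorem theorem2:
  fixes k :: nat
  assumes "k \<ge> 1"
  shows "k_nexptime_hard k gbsr_sat"
  unfolding k_nexptime_hard_def
proof
  fix A assume "A \<in> k_nexptime k"
  then have "\<exists>\<Sigma> L. A = (lists \<Sigma>, L) \<and> finite \<Sigma> \<and> 0 \<notin> \<Sigma> \<and> L \<subseteq> lists \<Sigma> \<and> (\<exists>M (p :: nat poly). wf_tmachine M \<and>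
      (\<forall>w\<in>lists \<Sigma>. all_runs_within M w (tower k (poly p (length w))) \<and> (w \<in> L \<longleftrightarrow> accepts M w)))"
    unfolding k_nexptime_def by (rule CollectD)
  then obtain \<Sigma> L M p where A: "A = (lists \<Sigma>, L)" and \<Sigma>: "finite \<Sigma>" "0 \<notin> \<Sigma>" and wfM: "wf_tmachine M"
    and M: "\<forall>w\<in>lists \<Sigma>. all_runs_within M w (tower k (poly p (length w))) \<and> (w \<in> L \<longleftrightarrow> accepts M w)"
    by (elim exE conjE)
  \<comment> \<open>K depends on k and p but not on the input, so one fixed transducer serves all
    inputs.\<close>
  obtain K where K: "\<And>m. 2 * tower k (poly p m) + m + 3 < tower K (Suc m)" using tower_dominates[of k p] by blast
  have fin: "finite (transitions M)" using wfM by (simp add: wf_tmachine_def)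
  from finite_list[OF this] obtain ts where tsE: "set ts = transitions M" by blast
  have "finite (insert 0 \<Sigma> \<union> (\<Union>\<tau>\<in>transitions M. set (snd (fst \<tau>)) \<union> fst ` set (snd (snd \<tau>))))"
    using fin \<Sigma> by simp
  from finite_list[OF this] obtain Gs where GsE: "set Gs = insert 0 \<Sigma> \<union> (\<Union>\<tau>\<in>transitions M. set (snd (fst \<tau>)) \<union> fst ` set (snd (snd \<tau>)))"
    by blast
  have "finite ({start M, accept M} \<union> (\<Union>\<tau>\<in>transitions M. {fst (fst \<tau>), fst (snd \<tau>)}))"
    using fin by simp
  from finite_list[OF this] obtain Qs where QsE: "set Qs = {start M, accept M} \<union> (\<Union>\<tau>\<in>transitions M. {fst (fst \<tau>), fst (snd \<tau>)})"
    by blast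
  interpret machine_simulation M K ts Gs Qs
  proof
    show "set rs \<subseteq> set Gs \<and> fst ` set as \<subseteq> set Gs" if "((q, rs), q', as) \<in> transitions M" for q rs q' as
      unfolding GsE using UN_upper[OF that, of "\<lambda>\<tau>. set (snd (fst \<tau>)) \<union> fst ` set (snd (snd \<tau>))"] by simp blast
    show "q \<in> set Qs \<and> q' \<in> set Qs" if "((q, rs), q', as) \<in> transitions M" for q rs q' as
      unfolding QsE using UN_upper[OF that, of "\<lambda>\<tau>. {fst (fst \<tau>), fst (snd \<tau>)}"] by simp
  qed (use wfM tsE GsE QsE in auto)
  have "w \<in> L \<longleftrightarrow> satisfiable (sentence w)" if w: "w \<in> lists \<Sigma>" for w
  proof -
    have "set w \<subseteq> set Gs" using w GsE by auto
    then show ?thesis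
      using accepts_satisfiable[OF _ _ K] satisfiable_accepts bspec[OF M w] by blast
  qed
  moreover have "enc_fm (sentence w) \<in> enc_fm ` {\<phi> \<in> gbsr. satisfiable \<phi>} \<longleftrightarrow> satisfiable (sentence w)" for w
    using sentence_gbsr[of w] inj_image_mem_iff[OF inj_enc_fm, of "sentence w"] by simp
  ultimately have "\<forall>w\<in>lists \<Sigma>. enc_fm (sentence w) \<in> enc_fm ` gbsr \<and>
      (w \<in> L \<longleftrightarrow> enc_fm (sentence w) \<in> enc_fm ` {\<phi> \<in> gbsr. satisfiable \<phi>})"
    using sentence_gbsr by simp
  then show "A \<le>\<^sub>p gbsr_sat"
    unfolding poly_reducible_def A gbsr_sat_def fst_conv snd_conv using polytime_sentence[OF \<Sigma>] by blast
qed

end
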